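(* $\mathbf{IKP}$ and $\mathbf{IKP}+\Sigma\text{-Reflection}$ prove the same $\Sigma$-sentences. In particular, if $\mathbf{IKP}\vdash A$ with $A$ a $\Sigma$-sentence, then $\mathbf{IKP}\vdash\exists x\,A^{x}$.
   Context: $\mathbf{IKP}$ is Kripke–Platek set theory with intuitionistic logic: axioms Extensionality, Pair, Union, Infinity, $\Delta_0$-Separation, $\Delta_0$-Collection, and Set Induction for all formulas ($\Delta_0$ = no unbounded quantifiers). $\Sigma$-formulas: every $\Delta_0$-formula is $\Sigma$ and $\Pi$; $\Sigma$ (resp. $\Pi$) formulas are closed under $\wedge,\vee$, bounded quantifiers $\forall x\in s,\exists x\in s$; $\exists xA$ is $\Sigma$ for $\Sigma$ $A$ and $\forall xA$ is $\Pi$ for $\Pi$ $A$; if $A$ is $\Pi$ and $B$ is $\Sigma$ then $A\to B,\neg A$ are $\Sigma$ and $B\to A,\neg B$ are $\Pi$. For a formula $A$ and variable $z$, $A^{z}$ results from $A$ by replacing each unbounded quantifier $\forall x,\exists y$ by $\forall x\in z,\exists y\in z$. $\Sigma$-Reflection is the schema $A\to\exists z\,A^{z}$ for all $\Sigma$-formulas $A$. *)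

theory Defs
  imports Main
begin

text \<open>Atomic formulas are membership and equality between variables. Bounded
  quantifiers are primitive constructors: BAll x s A is the formula (forall x in s) A,
  BEx x s A is (exists x in s) A; their meaning is fixed by the logical axioms below
  (BAll x s A is equivalent to All x (x in s --> A), BEx x s A to Ex x (x in s and A)).\<close>

datatype fm =
    Mem nat nat
  | Eq nat nat
  | Bot
  | Conj fm fm
  | Disj fm fm
  | Imp fm fm
  | All nat fm
  | Ex nat fm
  | BAll nat nat fm
  | BEx nat nat fm

definition Neg :: "fm \<Rightarrow> fm" where "Neg A = Imp A Bot"
definition Iff :: "fm \<Rightarrow> fm \<Rightarrow> fm" where "Iff A B = Conj (Imp A B) (Imp B A)"

fun fv :: "fm \<Rightarrow> nat set" where
  "fv (Mem x y) = {x, y}"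
| "fv (Eq x y) = {x, y}"
| "fv Bot = {}"
| "fv (Conj A B) = fv A \<union> fv B"
| "fv (Disj A B) = fv A \<union> fv B"
| "fv (Imp A B) = fv A \<union> fv B"
| "fv (All x A) = fv A - {x}"
| "fv (Ex x A) = fv A - {x}"
| "fv (BAll x s A) = (insert s (fv A)) - {x}"
| "fv (BEx x s A) = (insert s (fv A)) - {x}"

fun vars :: "fm \<Rightarrow> nat set" where
  "vars (Mem x y) = {x, y}"
| "vars (Eq x y) = {x, y}"
| "vars Bot = {}"
| "vars (Conj A B) = vars A \<union> vars B"
| "vars (Disj A B) = vars A \<union> vars B"
| "vars (Imp A B) = vars A \<union> vars B"
| "vars (All x A) = insert x (vars A)"
| "vars (Ex x A) = insert x (vars A)"
| "vars (BAll x s A) = insert x (insert s (vars A))"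
| "vars (BEx x s A) = insert x (insert s (vars A))"

definition sentence :: "fm \<Rightarrow> bool" where "sentence A \<longleftrightarrow> fv A = {}"

text \<open>Substitution of the variable t for the free occurrences of x (naive; used only
  under the side condition substitutable t x A).\<close>
definition sw :: "nat \<Rightarrow> nat \<Rightarrow> nat \<Rightarrow> nat" where
  "sw x t v = (if v = x then t else v)"

fun subst :: "fm \<Rightarrow> nat \<Rightarrow> nat \<Rightarrow> fm" where
  "subst (Mem a b) x t = Mem (sw x t a) (sw x t b)"
| "subst (Eq a b) x t = Eq (sw x t a) (sw x t b)"
| "subst Bot x t = Bot"
| "subst (Conj A B) x t = Conj (subst A x t) (subst B x t)"
| "subst (Disj A B) x t = Disj (subst A x t) (subst B x t)"
| "subst (Imp A B) x t = Imp (subst A x t) (subst B x t)"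
| "subst (All y A) x t = (if y = x then All y A else All y (subst A x t))"
| "subst (Ex y A) x t = (if y = x then Ex y A else Ex y (subst A x t))"
| "subst (BAll y s A) x t = (if y = x then BAll y s A else BAll y (sw x t s) (subst A x t))"
| "subst (BEx y s A) x t = (if y = x then BEx y s A else BEx y (sw x t s) (subst A x t))"

fun substitutable :: "nat \<Rightarrow> nat \<Rightarrow> fm \<Rightarrow> bool" where
  "substitutable t x (Mem a b) = True"
| "substitutable t x (Eq a b) = True"
| "substitutable t x Bot = True"
| "substitutable t x (Conj A B) = (substitutable t x A \<and> substitutable t x B)"
| "substitutable t x (Disj A B) = (substitutable t x A \<and> substitutable t x B)"
| "substitutable t x (Imp A B) = (substitutable t x A \<and> substitutable t x B)"
| "substitutable t x (All y A) = (x \<notin> fv (All y A) \<or> (y \<noteq> t \<and> substitutable t x A))"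
| "substitutable t x (Ex y A) = (x \<notin> fv (Ex y A) \<or> (y \<noteq> t \<and> substitutable t x A))"
| "substitutable t x (BAll y s A) = (x \<notin> fv (BAll y s A) \<or> (y \<noteq> t \<and> substitutable t x A))"
| "substitutable t x (BEx y s A) = (x \<notin> fv (BEx y s A) \<or> (y \<noteq> t \<and> substitutable t x A))"

inductive Delta0 :: "fm \<Rightarrow> bool" where
  "Delta0 (Mem x y)"
| "Delta0 (Eq x y)"
| "Delta0 Bot"
| "Delta0 A \<Longrightarrow> Delta0 B \<Longrightarrow> Delta0 (Conj A B)"
| "Delta0 A \<Longrightarrow> Delta0 B \<Longrightarrow> Delta0 (Disj A B)"
| "Delta0 A \<Longrightarrow> Delta0 B \<Longrightarrow> Delta0 (Imp A B)"
| "Delta0 A \<Longrightarrow> x \<noteq> s \<Longrightarrow> Delta0 (BAll x s A)"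
| "Delta0 A \<Longrightarrow> x \<noteq> s \<Longrightarrow> Delta0 (BEx x s A)"

inductive SigmaF :: "fm \<Rightarrow> bool" and PiF :: "fm \<Rightarrow> bool" where
  "Delta0 A \<Longrightarrow> SigmaF A"
| "Delta0 A \<Longrightarrow> PiF A"
| "SigmaF A \<Longrightarrow> SigmaF B \<Longrightarrow> SigmaF (Conj A B)"
| "SigmaF A \<Longrightarrow> SigmaF B \<Longrightarrow> SigmaF (Disj A B)"
| "PiF A \<Longrightarrow> PiF B \<Longrightarrow> PiF (Conj A B)"
| "PiF A \<Longrightarrow> PiF B \<Longrightarrow> PiF (Disj A B)"
| "SigmaF A \<Longrightarrow> x \<noteq> s \<Longrightarrow> SigmaF (BAll x s A)"
| "SigmaF A \<Longrightarrow> x \<noteq> s \<Longrightarrow> SigmaF (BEx x s A)"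
| "PiF A \<Longrightarrow> x \<noteq> s \<Longrightarrow> PiF (BAll x s A)"
| "PiF A \<Longrightarrow> x \<noteq> s \<Longrightarrow> PiF (BEx x s A)"
| "SigmaF A \<Longrightarrow> SigmaF (Ex x A)"
| "PiF A \<Longrightarrow> PiF (All x A)"
| "PiF A \<Longrightarrow> SigmaF B \<Longrightarrow> SigmaF (Imp A B)"
| "PiF A \<Longrightarrow> SigmaF (Neg A)"
| "SigmaF B \<Longrightarrow> PiF A \<Longrightarrow> PiF (Imp B A)"
| "SigmaF B \<Longrightarrow> PiF (Neg B)"

fun rel :: "nat \<Rightarrow> fm \<Rightarrow> fm" where
  "rel z (Mem x y) = Mem x y"
| "rel z (Eq x y) = Eq x y"
| "rel z Bot = Bot"
| "rel z (Conj A B) = Conj (rel z A) (rel z B)"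
| "rel z (Disj A B) = Disj (rel z A) (rel z B)"
| "rel z (Imp A B) = Imp (rel z A) (rel z B)"
| "rel z (All x A) = BAll x z (rel z A)"
| "rel z (Ex x A) = BEx x z (rel z A)"
| "rel z (BAll x s A) = BAll x s (rel z A)"
| "rel z (BEx x s A) = BEx x s (rel z A)"

text \<open>prov T A: A is derivable in intuitionistic predicate logic with equality from the
  non-logical axioms T (axioms with free variables are treated as their universal
  closures, as usual for axiom schemata).\<close>

inductive prov :: "fm set \<Rightarrow> fm \<Rightarrow> bool" for T :: "fm set" where
  hyp: "A \<in> T \<Longrightarrow> prov T A"
| ax_K: "prov T (Imp A (Imp B A))"
| ax_S: "prov T (Imp (Imp A (Imp B C)) (Imp (Imp A B) (Imp A C)))"
| ax_conjE1: "prov T (Imp (Conj A B) A)"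
| ax_conjE2: "prov T (Imp (Conj A B) B)"
| ax_conjI: "prov T (Imp A (Imp B (Conj A B)))"
| ax_disjI1: "prov T (Imp A (Disj A B))"
| ax_disjI2: "prov T (Imp B (Disj A B))"
| ax_disjE: "prov T (Imp (Imp A C) (Imp (Imp B C) (Imp (Disj A B) C)))"
| ax_efq: "prov T (Imp Bot A)"
| ax_allE: "substitutable t x A \<Longrightarrow> prov T (Imp (All x A) (subst A x t))"
| ax_exI: "substitutable t x A \<Longrightarrow> prov T (Imp (subst A x t) (Ex x A))"
| ax_refl: "prov T (Eq x x)"
| ax_eq_mem1: "prov T (Imp (Eq x y) (Imp (Mem x z) (Mem y z)))"
| ax_eq_mem2: "prov T (Imp (Eq x y) (Imp (Mem z x) (Mem z y)))"
| ax_eq_eq: "prov T (Imp (Eq x y) (Imp (Eq x z) (Eq y z)))"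
| ax_ball1: "prov T (Imp (BAll x s A) (All x (Imp (Mem x s) A)))"
| ax_ball2: "prov T (Imp (All x (Imp (Mem x s) A)) (BAll x s A))"
| ax_bex1: "prov T (Imp (BEx x s A) (Ex x (Conj (Mem x s) A)))"
| ax_bex2: "prov T (Imp (Ex x (Conj (Mem x s) A)) (BEx x s A))"
| mp: "prov T (Imp A B) \<Longrightarrow> prov T A \<Longrightarrow> prov T B"
| allI: "prov T (Imp B A) \<Longrightarrow> x \<notin> fv B \<Longrightarrow> prov T (Imp B (All x A))"
| exE: "prov T (Imp A B) \<Longrightarrow> x \<notin> fv B \<Longrightarrow> prov T (Imp (Ex x A) B)"

definition Extensionality :: fm where
  "Extensionality = All 0 (All 1 (Imp (Conj (BAll 2 0 (Mem 2 1)) (BAll 2 1 (Mem 2 0))) (Eq 0 1)))"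

definition Pairing :: fm where
  "Pairing = All 0 (All 1 (Ex 2 (Conj (Mem 0 2) (Mem 1 2))))"

definition Union_ax :: fm where
  "Union_ax = All 0 (Ex 1 (BAll 2 0 (BAll 3 2 (Mem 3 1))))"

definition Infinity :: fm where
  "Infinity = Ex 0 (Conj (Ex 1 (Mem 1 0)) (BAll 1 0 (BEx 2 0 (Mem 1 2))))"

definition Delta0_Sep :: "fm set" where
  "Delta0_Sep = {All a (Ex b (All x (Iff (Mem x b) (Conj (Mem x a) A)))) | A a b x.
                  Delta0 A \<and> distinct [a, b, x] \<and> b \<notin> fv A}"

definition Delta0_Coll :: "fm set" where
  "Delta0_Coll = {Imp (BAll x a (Ex y A)) (Ex b (BAll x a (BEx y b A))) | A a b x y.
                  Delta0 A \<and> distinct [a, b, x, y] \<and> b \<notin> fv A}"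

definition Set_Ind :: "fm set" where
  "Set_Ind = {Imp (All a (Imp (BAll x a (subst A a x)) A)) (All a A) | A a x.
              x \<noteq> a \<and> x \<notin> fv A \<and> substitutable x a A}"

definition IKP :: "fm set" where
  "IKP = {Extensionality, Pairing, Union_ax, Infinity} \<union> Delta0_Sep \<union> Delta0_Coll \<union> Set_Ind"

definition Sigma_Refl :: "fm set" where
  "Sigma_Refl = {Imp A (Ex z (rel z A)) | A z. SigmaF A \<and> z \<notin> vars A}"

end

theory Submission
  imports Defs "HOL-Library.Countable"
begin

text \<open>Work in a Kripke model of IKP. Fix finitely many formulas, closed under subformulas, and a bounded
  formula that is universal for their relativizations. A set \<open>p\<close> of codes is a condition: it stands for
  the statements \<open>\<Phi> p z\<close>, antitone in the stage \<open>z\<close>, and it satisfies a goal \<open>c\<close>, which is monotone in the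
  stage, if \<open>\<Phi> p z\<close> implies \<open>c\<close> at stage \<open>z\<close> for some \<open>z\<close>. Kripke forcing over the conditions, with disjunction
  and existence closed under the goals, is sound for intuitionistic logic. A \<open>\<Sigma>\<close> formula \<open>A\<close> is forced by \<open>p\<close>
  iff \<open>\<Phi> p z \<rightarrow> A\<^sup>z\<close> for some \<open>z\<close>, and a \<open>\<Pi>\<close> formula iff for every \<open>z\<close> there is \<open>z'\<close> with
  \<open>\<Phi> p z' \<rightarrow> A\<^sup>z\<close>; the case of implications holds because the antecedent can be added to the condition.
  Hence \<open>\<Sigma>\<close> reflection is forced. Set induction is forced because forcing is definable in IKP, and
  collection because a stage can be pulled out of a bounded premise by collecting over a subset of a
  singleton. For the empty condition a forced \<open>\<Sigma>\<close> sentence \<open>A\<close> yields \<open>\<exists>z. A\<^sup>z\<close> and thus \<open>A\<close>, and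
  completeness of Kripke models turns this into provability in IKP.\<close>

section \<open>Natural deduction over the Hilbert calculus\<close>

text \<open>The obstacle is a \<Sigma> implication A -> B with A a \<Pi> formula. Classically it
  splits into a counterexample to A or the truth of B, and either one yields a stage.
  Intuitionistically neither need hold, and a stage z with A^z -> B^z must be found before anything
  is known about A; hence the passage to conditions that contain A as an assumption. Conditions must
  be sets of the model, so that formulas can quantify over them and new assumptions can be joined to
  them. This calls for a truth definition for the statements they contain. A derivation uses only
  finitely many axioms, so a truth definition for finitely many bounded formulas suffices, and
  pairing of parameters provides one. Goals are needed because \<Phi> p z may imply that A^z or B^z
  holds without deciding which. The plain Kripke clauses for disjunction and existence would be too
  strong to agree with the description of forcing by stages. Kripke models enter only to replace
  formal derivations inside IKP by semantic arguments; in the end a single model is used, the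
  canonical one.\<close>

definition Top :: fm where "Top = Imp Bot Bot"

fun conjs :: "fm list \<Rightarrow> fm" where
  "conjs [] = Top"
| "conjs (B # Bs) = Conj B (conjs Bs)"

definition fvs :: "fm set \<Rightarrow> nat set" where "fvs \<Gamma> = (\<Union>B\<in>\<Gamma>. fv B)"

text \<open>Assumptions enter as one conjunction in front of the conclusion, so their free variables
  act as parameters, whereas a member of \<open>T\<close> counts as universally closed. Accordingly
  \<open>ded_allI\<close> restricts only the variables of \<open>\<Gamma>\<close>.\<close>

definition ded :: "fm set \<Rightarrow> fm set \<Rightarrow> fm \<Rightarrow> bool" where
  "ded T \<Gamma> A \<longleftrightarrow> (\<exists>Bs. set Bs \<subseteq> \<Gamma> \<and> prov T (Imp (conjs Bs) A))"

lemma prov_mono: "prov S A \<Longrightarrow> S \<subseteq> T \<Longrightarrow> prov T A"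
  by (induction rule: prov.induct) (auto intro: prov.intros)

lemma prov_weak: "prov T A \<Longrightarrow> prov T (Imp B A)"
  using ax_K mp by blast

lemma prov_mp2: "prov T (Imp H (Imp A B)) \<Longrightarrow> prov T (Imp H A) \<Longrightarrow> prov T (Imp H B)"
  using ax_S mp by blast

lemma prov_id: "prov T (Imp A A)"
  using ax_K prov_mp2 by blast

lemma prov_trans: "prov T (Imp A B) \<Longrightarrow> prov T (Imp B C) \<Longrightarrow> prov T (Imp A C)"
  using prov_mp2 prov_weak by blast

lemma prov_conjI: "prov T (Imp H A) \<Longrightarrow> prov T (Imp H B) \<Longrightarrow> prov T (Imp H (Conj A B))"
  by (rule prov_mp2[OF prov_trans[OF _ ax_conjI]])

lemma prov_curry: "prov T (Imp (Conj A B) C) \<Longrightarrow> prov T (Imp A (Imp B C))"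
proof -
  assume h: "prov T (Imp (Conj A B) C)"
  have "prov T (Imp A (Imp B (Imp (Conj A B) C)))"
    using h prov_weak by blast
  hence "prov T (Imp A (Imp (Imp B (Conj A B)) (Imp B C)))"
    using ax_S prov_trans by blast
  thus ?thesis using ax_conjI prov_mp2 by blast
qed

lemma prov_swap: "prov T (Imp A (Imp B C)) \<Longrightarrow> prov T (Imp B (Imp A C))"
  by (rule prov_curry) (rule prov_mp2[OF prov_trans[OF ax_conjE2] ax_conjE1])

lemma conjs_mem: "B \<in> set Bs \<Longrightarrow> prov T (Imp (conjs Bs) B)"
  by (induction Bs) (auto intro: ax_conjE1 prov_trans[OF ax_conjE2])

lemma conjs_mono: "set Bs \<subseteq> set Cs \<Longrightarrow> prov T (Imp (conjs Cs) (conjs Bs))"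
  by (induction Bs) (simp_all add: Top_def prov_conjI conjs_mem prov_weak prov_id)

lemma fv_conjs: "fv (conjs Bs) = fvs (set Bs)"
  by (induction Bs) (auto simp: fvs_def Top_def)

lemma ded_mono: "ded T \<Gamma> A \<Longrightarrow> \<Gamma> \<subseteq> \<Delta> \<Longrightarrow> ded T \<Delta> A"
  unfolding ded_def by blast

lemma ded_prov: "prov T A \<Longrightarrow> ded T \<Gamma> A"
  unfolding ded_def by (rule exI[of _ "[]"]) (auto intro: prov_weak)

lemma ded_empty: "ded T {} A \<Longrightarrow> prov T A"
  unfolding ded_def Top_def using prov_id mp by (auto simp: Top_def)

lemma ded_hyp: "A \<in> \<Gamma> \<Longrightarrow> ded T \<Gamma> A"
  unfolding ded_def by (rule exI[of _ "[A]"]) (auto intro: ax_conjE1)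

lemma ded_mp: assumes "ded T \<Gamma> (Imp A B)" "ded T \<Gamma> A" shows "ded T \<Gamma> B"
proof -
  obtain Bs Cs where "set Bs \<subseteq> \<Gamma>" "set Cs \<subseteq> \<Gamma>" and
    p: "prov T (Imp (conjs Bs) (Imp A B))" "prov T (Imp (conjs Cs) A)"
    using assms unfolding ded_def by auto
  moreover have "prov T (Imp (conjs (Bs @ Cs)) B)"
    by (rule prov_mp2[OF prov_trans[OF conjs_mono p(1)] prov_trans[OF conjs_mono p(2)]]) auto
  ultimately show ?thesis unfolding ded_def by (intro exI[of _ "Bs @ Cs"]) auto
qed

lemma ded_impI: assumes "ded T (insert A \<Gamma>) B" shows "ded T \<Gamma> (Imp A B)"
proof -
  obtain Bs where Bs: "set Bs \<subseteq> insert A \<Gamma>" and p: "prov T (Imp (conjs Bs) B)"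
    using assms unfolding ded_def by auto
  let ?Cs = "filter (\<lambda>C. C \<noteq> A) Bs"
  have "prov T (Imp (conjs (A # ?Cs)) B)"
    using p conjs_mono[of Bs "A # ?Cs"] by (rule_tac prov_trans) auto
  hence "prov T (Imp A (Imp (conjs ?Cs) B))" using prov_curry by simp
  hence "prov T (Imp (conjs ?Cs) (Imp A B))" by (rule prov_swap)
  thus ?thesis unfolding ded_def using Bs by (intro exI[of _ ?Cs]) auto
qed

lemma ded_ax: "prov T (Imp A B) \<Longrightarrow> ded T \<Gamma> A \<Longrightarrow> ded T \<Gamma> B"
  using ded_mp ded_prov by blast

lemma ded_cut: "ded T (insert A \<Gamma>) B \<Longrightarrow> ded T \<Gamma> A \<Longrightarrow> ded T \<Gamma> B"
  using ded_impI ded_mp by blast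

lemma ded_allI: assumes "ded T \<Gamma> A" "x \<notin> fvs \<Gamma>" shows "ded T \<Gamma> (All x A)"
proof -
  obtain Bs where Bs: "set Bs \<subseteq> \<Gamma>" and p: "prov T (Imp (conjs Bs) A)"
    using assms unfolding ded_def by auto
  moreover have "x \<notin> fv (conjs Bs)" using Bs assms(2) by (auto simp: fv_conjs fvs_def)
  ultimately show ?thesis unfolding ded_def using allI by blast
qed

lemma ded_conjI: "ded T \<Gamma> A \<Longrightarrow> ded T \<Gamma> B \<Longrightarrow> ded T \<Gamma> (Conj A B)"
  using ax_conjI ded_ax ded_mp by blast

lemma ded_disjE:
  "ded T \<Gamma> (Disj A B) \<Longrightarrow> ded T (insert A \<Gamma>) C \<Longrightarrow> ded T (insert B \<Gamma>) C \<Longrightarrow> ded T \<Gamma> C"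
  by (meson ax_disjE ded_ax ded_impI ded_mp)

lemma ded_allE: "ded T \<Gamma> (All x A) \<Longrightarrow> substitutable t x A \<Longrightarrow> ded T \<Gamma> (subst A x t)"
  using ax_allE ded_ax by blast

lemma ded_exI: "ded T \<Gamma> (subst A x t) \<Longrightarrow> substitutable t x A \<Longrightarrow> ded T \<Gamma> (Ex x A)"
  using ax_exI ded_ax by blast

lemma ded_exE:
  assumes ex: "ded T \<Gamma> (Ex x A)" and C: "ded T (insert A \<Gamma>) C" and x: "x \<notin> fv C" "x \<notin> fvs \<Gamma>"
  shows "ded T \<Gamma> C"
proof -
  obtain Bs where Bs: "set Bs \<subseteq> \<Gamma>" and p: "prov T (Imp (conjs Bs) (Imp A C))"
    using ded_impI[OF C] unfolding ded_def by auto
  have "prov T (Imp A (Imp (conjs Bs) C))"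
    using p by (rule prov_swap)
  moreover have "x \<notin> fv (Imp (conjs Bs) C)" using Bs x by (auto simp: fv_conjs fvs_def)
  ultimately have "prov T (Imp (Ex x A) (Imp (conjs Bs) C))" by (rule exE)
  hence "ded T \<Gamma> (Imp (conjs Bs) C)" using ex ded_ax by blast
  moreover have "ded T \<Gamma> (conjs Bs)" unfolding ded_def using Bs prov_id by blast
  ultimately show ?thesis by (rule ded_mp)
qed

section \<open>Variables, substitution and elimination of equations\<close>

lemma fv_subset_vars: "fv A \<subseteq> vars A"
  by (induction A) auto

lemma nonvar_nonfree: "x \<notin> vars A \<Longrightarrow> x \<notin> fv A"
  using fv_subset_vars by blast

lemma finite_vars: "finite (vars A)"
  by (induction A) auto

lemma subst_nonfree: "x \<notin> fv A \<Longrightarrow> subst A x t = A"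
  by (induction A) (auto simp: sw_def)

lemma substitutable_nonfree: "x \<notin> fv A \<Longrightarrow> substitutable t x A"
  by (induction A) auto

lemma substitutable_self: "substitutable x x A"
  by (induction A) auto

lemma subst_self: "subst A x x = A"
  by (induction A) (auto simp: sw_def)

lemma substitutable_fresh: "n \<notin> vars A \<Longrightarrow> substitutable n x A"
  by (induction A) auto

lemma subst_back: "n \<notin> vars A \<Longrightarrow> subst (subst A x n) n x = A"
  by (induction A) (auto simp: sw_def subst_nonfree nonvar_nonfree)

lemma fv_subst: "fv (subst A x n) \<subseteq> insert n (fv A - {x})"
  by (induction A) (auto simp: sw_def split: if_splits)

lemma substitutable_back: "n \<notin> vars A \<Longrightarrow> substitutable x n (subst A x n)"
  by (induction A) (auto simp: sw_def substitutable_nonfree nonvar_nonfree)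

lemma ded_allE_self: "ded T \<Gamma> (All x A) \<Longrightarrow> ded T \<Gamma> A"
  using ded_allE substitutable_self subst_self by metis

lemma ded_exI_self: "ded T \<Gamma> A \<Longrightarrow> ded T \<Gamma> (Ex x A)"
  using ded_exI substitutable_self subst_self by metis

text \<open>An equation for a variable \<open>x\<close> that occurs nowhere else carries no
  information: generalising over \<open>x\<close> and instantiating it by the other side
  \<open>t\<close> leaves an instance of reflexivity.\<close>

lemma ded_eq_elim:
  assumes "ded T \<Gamma> (Imp (Eq a b) C)" "x \<notin> fv C" "x \<notin> fvs \<Gamma>" "(x = a \<and> t = b) \<or> (x = b \<and> t = a)"
  shows "ded T \<Gamma> C"
proof -
  have "ded T \<Gamma> (subst (Imp (Eq a b) C) x t)"
    by (rule ded_allE[OF ded_allI[OF assms(1,3)]]) (simp add: substitutable_nonfree assms(2))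
  hence "ded T \<Gamma> (Imp (Eq t t) C)" using assms(2,4) by (auto simp: sw_def subst_nonfree)
  thus ?thesis using ax_refl ded_mp ded_prov by blast
qed

section \<open>Renaming of free and bound variables\<close>

text \<open>The maps act separately, \<open>f\<close> on free occurrences and \<open>b\<close> on
  binders, with \<open>f\<close> overwritten by \<open>b\<close> inside a scope. Capture is not
  checked here; it is excluded by conditions such as \<open>capture_free\<close> and
  \<open>fresh_ren\<close>.\<close>

fun ren :: "(nat \<Rightarrow> nat) \<Rightarrow> (nat \<Rightarrow> nat) \<Rightarrow> fm \<Rightarrow> fm" where
  "ren f b (Mem x y) = Mem (f x) (f y)"
| "ren f b (Eq x y) = Eq (f x) (f y)"
| "ren f b Bot = Bot"
| "ren f b (Conj A B) = Conj (ren f b A) (ren f b B)"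
| "ren f b (Disj A B) = Disj (ren f b A) (ren f b B)"
| "ren f b (Imp A B) = Imp (ren f b A) (ren f b B)"
| "ren f b (All x A) = All (b x) (ren (f(x := b x)) b A)"
| "ren f b (Ex x A) = Ex (b x) (ren (f(x := b x)) b A)"
| "ren f b (BAll x s A) = BAll (b x) ((f(x := b x)) s) (ren (f(x := b x)) b A)"
| "ren f b (BEx x s A) = BEx (b x) ((f(x := b x)) s) (ren (f(x := b x)) b A)"

lemma ren_cong: "\<forall>x\<in>fv A. f x = g x \<Longrightarrow> \<forall>x\<in>vars A. b x = b' x \<Longrightarrow> ren f b A = ren g b' A"
proof (induction A arbitrary: f g)
  case (All x A) then show ?case by (auto intro!: All.IH)
next
  case (Ex x A) then show ?case by (auto intro!: Ex.IH)
next
  case (BAll x s A) then show ?case by (auto intro!: BAll.IH)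
next
  case (BEx x s A) then show ?case by (auto intro!: BEx.IH)
next
  case (Conj A B)
  have "ren f b A = ren g b' A" "ren f b B = ren g b' B"
    using Conj.prems by (intro Conj.IH; simp)+
  then show ?case by simp
next
  case (Disj A B)
  have "ren f b A = ren g b' A" "ren f b B = ren g b' B"
    using Disj.prems by (intro Disj.IH; simp)+
  then show ?case by simp
next
  case (Imp A B)
  have "ren f b A = ren g b' A" "ren f b B = ren g b' B"
    using Imp.prems by (intro Imp.IH; simp)+
  then show ?case by simp
qed auto

text \<open>The equality \<open>f x = b x\<close> stays allowed, since it is what arises below a
  binder; this makes the condition survive the update in \<open>capture_free_upd\<close>.\<close>

definition capture_free :: "(nat \<Rightarrow> nat) \<Rightarrow> (nat \<Rightarrow> nat) \<Rightarrow> bool" where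
  "capture_free f b \<longleftrightarrow> inj b \<and> (\<forall>z x. f z = b x \<longrightarrow> z = x)"

lemma capture_free_upd: "capture_free f b \<Longrightarrow> capture_free (f(x := b x)) b"
  unfolding capture_free_def by (metis fun_upd_apply injD)

lemma fv_ren_capture_free: "capture_free f b \<Longrightarrow> fv (ren f b A) = f ` fv A"
proof (induction A arbitrary: f)
  case (All x A)
  have "fv (ren (f(x := b x)) b A) = (f(x := b x)) ` fv A"
    by (rule All.IH[OF capture_free_upd[OF All.prems]])
  then show ?case using All.prems by (auto simp: capture_free_def)
next
  case (Ex x A)
  have "fv (ren (f(x := b x)) b A) = (f(x := b x)) ` fv A"
    by (rule Ex.IH[OF capture_free_upd[OF Ex.prems]])
  then show ?case using Ex.prems by (auto simp: capture_free_def)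
next
  case (BAll x s A)
  have "fv (ren (f(x := b x)) b A) = (f(x := b x)) ` fv A"
    by (rule BAll.IH[OF capture_free_upd[OF BAll.prems]])
  then show ?case using BAll.prems by (auto simp: capture_free_def)
next
  case (BEx x s A)
  have "fv (ren (f(x := b x)) b A) = (f(x := b x)) ` fv A"
    by (rule BEx.IH[OF capture_free_upd[OF BEx.prems]])
  then show ?case using BEx.prems by (auto simp: capture_free_def)
qed auto

text \<open>All new names lie outside \<open>S\<close>, so that old and new variables can be linked
  by equations without clashes. Again \<open>f x = b x\<close> is permitted, for use below
  binders.\<close>

definition fresh_ren :: "nat set \<Rightarrow> (nat \<Rightarrow> nat) \<Rightarrow> (nat \<Rightarrow> nat) \<Rightarrow> bool" where
  "fresh_ren S f b \<longleftrightarrow> (\<forall>x\<in>S. b x \<notin> S \<and> f x \<notin> S) \<and> (\<forall>x\<in>S. \<forall>z\<in>S. z \<noteq> x \<longrightarrow> b x \<noteq> f z \<and> b x \<noteq> b z)"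

lemma fresh_ren_upd: "fresh_ren S f b \<Longrightarrow> x \<in> S \<Longrightarrow> fresh_ren S (f(x := b x)) b"
  by (auto simp: fresh_ren_def)

lemma fv_ren: "fresh_ren S f b \<Longrightarrow> vars A \<subseteq> S \<Longrightarrow> fv (ren f b A) = f ` fv A"
proof (induction A arbitrary: f)
  case (All x A)
  have "fv (ren (f(x := b x)) b A) = (f(x := b x)) ` fv A"
    using All by (intro All.IH fresh_ren_upd) auto
  moreover have "f z \<noteq> b x" if "z \<in> fv A" "z \<noteq> x" for z
    using that All.prems fv_subset_vars[of A] by (force simp: fresh_ren_def)
  ultimately show ?case by auto
next
  case (Ex x A)
  have "fv (ren (f(x := b x)) b A) = (f(x := b x)) ` fv A"
    using Ex by (intro Ex.IH fresh_ren_upd) auto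
  moreover have "f z \<noteq> b x" if "z \<in> fv A" "z \<noteq> x" for z
    using that Ex.prems fv_subset_vars[of A] by (force simp: fresh_ren_def)
  ultimately show ?case by auto
next
  case (BAll x s A)
  have "fv (ren (f(x := b x)) b A) = (f(x := b x)) ` fv A"
    using BAll by (intro BAll.IH fresh_ren_upd) auto
  moreover have "f z \<noteq> b x" if "z \<in> insert s (fv A)" "z \<noteq> x" for z
    using that BAll.prems fv_subset_vars[of A] by (force simp: fresh_ren_def)
  ultimately show ?case by auto
next
  case (BEx x s A)
  have "fv (ren (f(x := b x)) b A) = (f(x := b x)) ` fv A"
    using BEx by (intro BEx.IH fresh_ren_upd) auto
  moreover have "f z \<noteq> b x" if "z \<in> insert s (fv A)" "z \<noteq> x" for z
    using that BEx.prems fv_subset_vars[of A] by (force simp: fresh_ren_def)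
  ultimately show ?case by auto
qed auto

definition eqs :: "(nat \<Rightarrow> nat) \<Rightarrow> nat set \<Rightarrow> fm set" where
  "eqs f S = (\<lambda>z. Eq z (f z)) ` S"

text \<open>The calculus has no rule for renaming bound variables, and an induction over formulas
  passes through open ones. Expressing the change of free variables by hypotheses
  \<open>Eq z (f z)\<close>, rather than by substitution, gives a statement that follows by
  induction from the equality axioms for atoms.\<close>

definition alpha :: "fm set \<Rightarrow> (nat \<Rightarrow> nat) \<Rightarrow> (nat \<Rightarrow> nat) \<Rightarrow> fm \<Rightarrow> bool" where
  "alpha T f b A \<longleftrightarrow> ded T (insert A (eqs f (fv A))) (ren f b A) \<and>
                      ded T (insert (ren f b A) (eqs f (fv A))) A"

lemma prov_eq_sym: "prov T (Imp (Eq x y) (Eq y x))"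
  using ax_eq_eq[of T x y x] ax_refl prov_mp2 prov_weak by blast

lemma alpha_ded:
  assumes "alpha T f b A" "eqs f (fv A) \<subseteq> \<Gamma>"
  shows "ded T \<Gamma> A \<Longrightarrow> ded T \<Gamma> (ren f b A)" "ded T \<Gamma> (ren f b A) \<Longrightarrow> ded T \<Gamma> A"
proof -
  have 1: "ded T (insert A \<Gamma>) (ren f b A)"
    using assms unfolding alpha_def by (elim conjE, elim ded_mono[of _ "insert A (eqs f (fv A))"]) auto
  have 2: "ded T (insert (ren f b A) \<Gamma>) A"
    using assms unfolding alpha_def by (elim conjE, elim ded_mono[of _ "insert (ren f b A) (eqs f (fv A))"]) auto
  show "ded T \<Gamma> A \<Longrightarrow> ded T \<Gamma> (ren f b A)" "ded T \<Gamma> (ren f b A) \<Longrightarrow> ded T \<Gamma> A"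
    using 1 2 ded_cut by blast+
qed

lemma ded_subst_eq_Mem:
  assumes "ded T \<Gamma> (Eq x x')" "ded T \<Gamma> (Eq y y')" "ded T \<Gamma> (Mem x y)"
  shows "ded T \<Gamma> (Mem x' y')"
  by (meson assms ax_eq_mem1 ax_eq_mem2 ded_ax ded_mp)

lemma ded_subst_eq_Eq:
  assumes "ded T \<Gamma> (Eq x x')" "ded T \<Gamma> (Eq y y')" "ded T \<Gamma> (Eq x y)"
  shows "ded T \<Gamma> (Eq x' y')"
  by (meson assms ax_eq_eq prov_eq_sym ded_ax ded_mp)

lemma alpha_Mem: "alpha T f b (Mem x y)"
  unfolding alpha_def
proof
  let ?E = "eqs f (fv (Mem x y))"
  have e: "ded T (insert C ?E) (Eq x (f x))" "ded T (insert C ?E) (Eq y (f y))" for C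
    by (auto intro!: ded_hyp simp: eqs_def)
  show "ded T (insert (Mem x y) ?E) (ren f b (Mem x y))"
    unfolding ren.simps by (rule ded_subst_eq_Mem[OF e]) (simp add: ded_hyp)
  show "ded T (insert (ren f b (Mem x y)) ?E) (Mem x y)"
    unfolding ren.simps
    by (rule ded_subst_eq_Mem[OF ded_ax[OF prov_eq_sym e(1)] ded_ax[OF prov_eq_sym e(2)]]) (simp add: ded_hyp)
qed

lemma alpha_Eq: "alpha T f b (Eq x y)"
  unfolding alpha_def
proof
  let ?E = "eqs f (fv (Eq x y))"
  have e: "ded T (insert C ?E) (Eq x (f x))" "ded T (insert C ?E) (Eq y (f y))" for C
    by (auto intro!: ded_hyp simp: eqs_def)
  show "ded T (insert (Eq x y) ?E) (ren f b (Eq x y))"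
    unfolding ren.simps by (rule ded_subst_eq_Eq[OF e]) (simp add: ded_hyp)
  show "ded T (insert (ren f b (Eq x y)) ?E) (Eq x y)"
    unfolding ren.simps
    by (rule ded_subst_eq_Eq[OF ded_ax[OF prov_eq_sym e(1)] ded_ax[OF prov_eq_sym e(2)]]) (simp add: ded_hyp)
qed

lemma alpha_Conj: assumes "alpha T f b A" "alpha T f b B" shows "alpha T f b (Conj A B)"
proof -
  have *: "eqs f (fv A) \<subseteq> insert C (eqs f (fv (Conj A B)))" "eqs f (fv B) \<subseteq> insert C (eqs f (fv (Conj A B)))" for C
    by (auto simp: eqs_def)
  have h: "ded T (insert (Conj C D) \<Gamma>) C" "ded T (insert (Conj C D) \<Gamma>) D" for C D \<Gamma>
    by (rule ded_ax[OF ax_conjE1 ded_hyp[of "Conj C D"]], simp)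
      (rule ded_ax[OF ax_conjE2 ded_hyp[of "Conj C D"]], simp)
  show ?thesis unfolding alpha_def ren.simps
    using alpha_ded[OF assms(1) *(1)] alpha_ded[OF assms(2) *(2)] h by (metis ded_conjI)
qed

lemma alpha_Disj: assumes "alpha T f b A" "alpha T f b B" shows "alpha T f b (Disj A B)"
proof -
  have *: "eqs f (fv A) \<subseteq> insert C (insert D (eqs f (fv (Disj A B))))"
    "eqs f (fv B) \<subseteq> insert C (insert D (eqs f (fv (Disj A B))))" for C D
    by (auto simp: eqs_def)
  note a = alpha_ded[OF assms(1) *(1)] alpha_ded[OF assms(2) *(2)]
  have h: "ded T (insert C \<Gamma>) C" for C \<Gamma> by (rule ded_hyp) simp
  show ?thesis unfolding alpha_def ren.simps
  proof
    show "ded T (insert (Disj A B) (eqs f (fv (Disj A B)))) (Disj (ren f b A) (ren f b B))"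
      by (rule ded_disjE[OF h ded_ax[OF ax_disjI1 a(1)[OF h]] ded_ax[OF ax_disjI2 a(3)[OF h]]])
    show "ded T (insert (Disj (ren f b A) (ren f b B)) (eqs f (fv (Disj A B)))) (Disj A B)"
      by (rule ded_disjE[OF h ded_ax[OF ax_disjI1 a(2)[OF h]] ded_ax[OF ax_disjI2 a(4)[OF h]]])
  qed
qed

lemma alpha_Imp: assumes "alpha T f b A" "alpha T f b B" shows "alpha T f b (Imp A B)"
proof -
  have *: "eqs f (fv A) \<subseteq> insert C (insert D (eqs f (fv (Imp A B))))"
    "eqs f (fv B) \<subseteq> insert C (insert D (eqs f (fv (Imp A B))))" for C D
    by (auto simp: eqs_def)
  note a = alpha_ded[OF assms(1) *(1)] alpha_ded[OF assms(2) *(2)]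
  have h: "ded T (insert C \<Gamma>) C" "ded T (insert C (insert D \<Gamma>)) D" for C D \<Gamma>
    by (rule ded_hyp, simp)+
  show ?thesis unfolding alpha_def ren.simps
  proof
    show "ded T (insert (Imp A B) (eqs f (fv (Imp A B)))) (Imp (ren f b A) (ren f b B))"
      by (rule ded_impI[OF a(3)[OF ded_mp[OF h(2) a(2)[OF h(1)]]]])
    show "ded T (insert (Imp (ren f b A) (ren f b B)) (eqs f (fv (Imp A B)))) (Imp A B)"
      by (rule ded_impI[OF a(4)[OF ded_mp[OF h(2) a(1)[OF h(1)]]]])
  qed
qed

text \<open>The hypothesis \<open>Eq x (b x)\<close> of the induction hypothesis is discharged by generalising over
  whichever of the two variables does not occur elsewhere and identifying it with the other one.\<close>

lemma alpha_quantifiers: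
  assumes IH: "alpha T (f(x := b x)) b A" and fr: "fresh_ren S f b" and S: "insert x (vars A) \<subseteq> S"
  shows "alpha T f b (All x A)" "alpha T f b (Ex x A)"
proof -
  define \<Gamma> where "\<Gamma> = eqs f (fv A - {x})"
  let ?A = "ren (f(x := b x)) b A"
  have fvA: "fv A \<subseteq> S" using S fv_subset_vars[of A] by auto
  have fvA': "fv ?A = (f(x := b x)) ` fv A" using fr S by (intro fv_ren[OF fresh_ren_upd]) auto
  have sub: "eqs (f(x := b x)) (fv A) \<subseteq> insert (Eq x (b x)) (insert C \<Gamma>)" for C
    by (auto simp: eqs_def \<Gamma>_def)
  note a = alpha_ded[OF IH sub]
  have h: "ded T (insert C \<Gamma>') C" "ded T (insert C (insert D \<Gamma>')) D" for C D \<Gamma>'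
    by (rule ded_hyp, simp)+
  have bx: "b x \<notin> fvs \<Gamma>" "b x \<notin> fv A"
    using fr S fvA by (auto simp: fvs_def \<Gamma>_def eqs_def fresh_ren_def)
  have x: "x \<notin> fvs \<Gamma>" "x \<notin> fv ?A"
    using fr S fvA unfolding fvA' by (auto simp: fvs_def \<Gamma>_def eqs_def fresh_ren_def)
  have fvi: "fvs (insert C \<Gamma>) = fv C \<union> fvs \<Gamma>" for C by (auto simp: fvs_def)
  show "alpha T f b (All x A)"
    unfolding alpha_def fv.simps ren.simps \<Gamma>_def[symmetric]
  proof
    have "ded T (insert (All x A) \<Gamma>) (Imp (Eq x (b x)) ?A)"
      by (rule ded_impI[OF a(1)[OF ded_allE_self[OF h(2)]]])
    hence "ded T (insert (All x A) \<Gamma>) ?A"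
      by (rule ded_eq_elim[of _ _ _ _ _ x]) (use x in \<open>auto simp: fvi\<close>)
    thus "ded T (insert (All x A) \<Gamma>) (All (b x) ?A)"
      by (rule ded_allI) (use bx in \<open>auto simp: fvi\<close>)
    have "ded T (insert (All (b x) ?A) \<Gamma>) (Imp (Eq x (b x)) A)"
      by (rule ded_impI[OF a(2)[OF ded_allE_self[OF h(2)]]])
    hence "ded T (insert (All (b x) ?A) \<Gamma>) A"
      by (rule ded_eq_elim[of _ _ _ _ _ "b x"]) (use bx in \<open>auto simp: fvi\<close>)
    thus "ded T (insert (All (b x) ?A) \<Gamma>) (All x A)"
      by (rule ded_allI) (use x in \<open>auto simp: fvi\<close>)
  qed
  show "alpha T f b (Ex x A)"
    unfolding alpha_def fv.simps ren.simps \<Gamma>_def[symmetric]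
  proof
    have "ded T (insert A \<Gamma>) (Imp (Eq x (b x)) (Ex (b x) ?A))"
      by (rule ded_impI[OF ded_exI_self[OF a(1)[OF h(2)]]])
    hence "ded T (insert A \<Gamma>) (Ex (b x) ?A)"
      by (rule ded_eq_elim[of _ _ _ _ _ "b x"]) (use bx in \<open>auto simp: fvi\<close>)
    hence "ded T (insert A (insert (Ex x A) \<Gamma>)) (Ex (b x) ?A)"
      by (rule ded_mono) auto
    thus "ded T (insert (Ex x A) \<Gamma>) (Ex (b x) ?A)"
      by (rule ded_exE[OF h(1)]) (use x h in \<open>auto simp: fvi\<close>)
    have "ded T (insert ?A \<Gamma>) (Imp (Eq x (b x)) (Ex x A))"
      by (rule ded_impI[OF ded_exI_self[OF a(2)[OF h(2)]]])
    hence "ded T (insert ?A \<Gamma>) (Ex x A)"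
      by (rule ded_eq_elim[of _ _ _ _ _ x]) (use x in \<open>auto simp: fvi\<close>)
    hence "ded T (insert ?A (insert (Ex (b x) ?A) \<Gamma>)) (Ex x A)"
      by (rule ded_mono) auto
    thus "ded T (insert (Ex (b x) ?A) \<Gamma>) (Ex x A)"
      by (rule ded_exE[OF h(1)]) (use bx h in \<open>auto simp: fvi\<close>)
  qed
qed

text \<open>Moves \<open>alpha\<close> between formulas that are interderivable both before and
  after renaming; it reduces the bounded quantifiers to the unbounded ones.\<close>

lemma alpha_equiv:
  assumes "alpha T f b A" "fv A = fv A'"
    and "\<And>\<Gamma>. ded T \<Gamma> A \<longleftrightarrow> ded T \<Gamma> A'" "\<And>\<Gamma>. ded T \<Gamma> (ren f b A) \<longleftrightarrow> ded T \<Gamma> (ren f b A')"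
  shows "alpha T f b A'"
proof -
  have "ded T (insert A' (eqs f (fv A))) A" "ded T (insert (ren f b A') (eqs f (fv A))) (ren f b A)"
    using assms(3,4) by (simp_all add: ded_hyp)
  hence "ded T (insert A' (eqs f (fv A))) (ren f b A)" "ded T (insert (ren f b A') (eqs f (fv A))) A"
    using alpha_ded[OF assms(1), of "insert A' (eqs f (fv A))"]
      alpha_ded[OF assms(1), of "insert (ren f b A') (eqs f (fv A))"] by auto
  thus ?thesis unfolding alpha_def using assms(2-4) by simp
qed

lemma alpha_ren: "fresh_ren S f b \<Longrightarrow> vars A \<subseteq> S \<Longrightarrow> alpha T f b A"
proof (induction A arbitrary: f)
  case (BAll x s A)
  have "alpha T (f(x := b x)) b (Imp (Mem x s) A)"
    using BAll by (intro alpha_Imp alpha_Mem BAll.IH fresh_ren_upd) auto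
  hence "alpha T f b (All x (Imp (Mem x s) A))"
    using BAll by (intro alpha_quantifiers(1)[of _ _ _ _ _ S]) auto
  thus ?case
    by (rule alpha_equiv) (auto intro: ded_ax[OF ax_ball1] ded_ax[OF ax_ball2])
next
  case (BEx x s A)
  have "alpha T (f(x := b x)) b (Conj (Mem x s) A)"
    using BEx by (intro alpha_Conj alpha_Mem BEx.IH fresh_ren_upd) auto
  hence "alpha T f b (Ex x (Conj (Mem x s) A))"
    using BEx by (intro alpha_quantifiers(2)[of _ _ _ _ _ S]) auto
  thus ?case
    by (rule alpha_equiv) (auto intro: ded_ax[OF ax_bex1] ded_ax[OF ax_bex2])
next
  case Bot thus ?case by (auto simp: alpha_def intro: ded_hyp)
next
  case (All x A) thus ?case by (intro alpha_quantifiers(1)[of _ _ _ _ _ S] All.IH fresh_ren_upd) auto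
next
  case (Ex x A) thus ?case by (intro alpha_quantifiers(2)[of _ _ _ _ _ S] Ex.IH fresh_ren_upd) auto
qed (auto intro: alpha_Mem alpha_Eq alpha_Conj alpha_Disj alpha_Imp)

text \<open>The equations go one at a time by \<open>ded_eq_elim\<close>. If no old variable occurs
  in \<open>C\<close>, the old side is generalised; otherwise the new side is, and injectivity keeps
  it out of the remaining equations.\<close>

lemma ded_eqs_elim:
  assumes "finite S" "ded T (eqs f S) C" "\<forall>z\<in>S. \<forall>z'\<in>S. f z \<noteq> z'"
    and "S \<inter> fv C = {} \<or> f ` S \<inter> fv C = {} \<and> inj_on f S"
  shows "ded T {} C"
  using assms
proof (induction S rule: finite_induct)
  case empty thus ?case by (simp add: eqs_def)
next
  case (insert z S)
  have "ded T (eqs f S) (Imp (Eq z (f z)) C)"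
    using insert.prems(1) by (auto simp: eqs_def intro: ded_impI)
  hence "ded T (eqs f S) C"
  proof (cases "insert z S \<inter> fv C = {}")
    case True
    show ?thesis using insert True \<open>ded T (eqs f S) (Imp _ _)\<close>
      by (intro ded_eq_elim[of T "eqs f S" z "f z" C z "f z"]) (auto simp: fvs_def eqs_def)
  next
    case False
    thus ?thesis using insert \<open>ded T (eqs f S) (Imp _ _)\<close>
      by (intro ded_eq_elim[of T "eqs f S" z "f z" C "f z" z]) (auto simp: fvs_def eqs_def)
  qed
  thus ?case using insert by auto
qed

text \<open>The way back asks for injectivity because a renaming that identifies free variables may
  turn an underivable formula into a derivable one.\<close>

lemma prov_ren_fresh:
  assumes "fresh_ren (vars A) f b"
  shows "prov T A \<Longrightarrow> prov T (ren f b A)"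
    and "inj_on f (fv A) \<Longrightarrow> prov T (ren f b A) \<Longrightarrow> prov T A"
proof -
  have al: "alpha T f b A" using assms by (intro alpha_ren[of "vars A"]) auto
  have fin: "finite (fv A)" using finite_vars fv_subset_vars finite_subset by blast
  have f: "fv (ren f b A) = f ` fv A" using assms by (intro fv_ren[of "vars A"]) auto
  have d: "\<forall>z\<in>fv A. \<forall>z'\<in>fv A. f z \<noteq> z'"
    using assms fv_subset_vars[of A] by (auto simp: fresh_ren_def)
  note a = alpha_ded[OF al order_refl]
  show "prov T (ren f b A)" if "prov T A"
    using ded_eqs_elim[OF fin a(1)[OF ded_prov[OF that]] d] f d by (auto intro!: ded_empty)
  show "prov T A" if "inj_on f (fv A)" "prov T (ren f b A)"
    using ded_eqs_elim[OF fin a(2)[OF ded_prov[OF that(2)]] d] that d by (auto intro!: ded_empty)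
qed

lemma ren_shift: "ren f b (ren (\<lambda>x. x + N) (\<lambda>x. x + N) A) = ren (\<lambda>x. f (x + N)) (\<lambda>x. b (x + N)) A"
proof -
  have u: "(\<lambda>x. x + N)(x := x + N) = (\<lambda>x. x + N)" for x :: nat by auto
  have w: "(\<lambda>z. if z = x then c else f (z + N)) = (\<lambda>z. f (z + N))(x := c)" for x f and c :: nat by auto
  show ?thesis by (induction A arbitrary: f) (simp_all add: u w)
qed

lemma vars_shift: "vars (ren (\<lambda>x. x + N) (\<lambda>x. x + N) A) = (\<lambda>x. x + N) ` vars A"
proof -
  have u: "(\<lambda>x. x + N)(x := x + N) = (\<lambda>x. x + N)" for x :: nat by auto
  show ?thesis by (induction A) (auto simp: u)
qed

text \<open>\<open>N\<close> exceeds every old and new name, so the renaming factors through the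
  shift by \<open>N\<close> into two fresh ones.\<close>

lemma prov_ren:
  assumes ne: "\<And>x z. z \<noteq> x \<Longrightarrow> b x \<noteq> f z \<and> b x \<noteq> b z"
  shows "prov T A \<Longrightarrow> prov T (ren f b A)"
    and "inj f \<Longrightarrow> prov T (ren f b A) \<Longrightarrow> prov T A"
proof -
  have "finite (vars A \<union> f ` vars A \<union> b ` vars A)" using finite_vars by auto
  then obtain N where N: "\<forall>x\<in>vars A. x < N \<and> f x < N \<and> b x < N"
    by (metis (no_types, lifting) finite_nat_set_iff_bounded UnCI imageI)
  let ?s = "\<lambda>x. x + N"
  let ?A = "ren ?s ?s A"
  have s: "fresh_ren (vars A) ?s ?s" using N by (force simp: fresh_ren_def)
  have 2: "fresh_ren (vars ?A) (\<lambda>x. f (x - N)) (\<lambda>x. b (x - N))"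
    using N ne by (force simp: fresh_ren_def vars_shift)
  have e: "ren (\<lambda>x. f (x - N)) (\<lambda>x. b (x - N)) ?A = ren f b A" by (simp add: ren_shift)
  show "prov T (ren f b A)" if "prov T A"
    using that prov_ren_fresh(1)[OF s] prov_ren_fresh(1)[OF 2] e by metis
  have fv: "fv ?A \<subseteq> ?s ` UNIV" using fv_ren[OF s] by auto
  show "prov T A" if "inj f" "prov T (ren f b A)"
  proof -
    have "inj_on (\<lambda>x. f (x - N)) (fv ?A)"
      using fv that(1) by (smt (verit, del_insts) add_diff_cancel_right' imageE inj_on_def subsetD)
    thus ?thesis using prov_ren_fresh(2)[OF 2] prov_ren_fresh(2)[OF s] e that by (auto simp: inj_on_def)
  qed
qed

section \<open>Kripke models\<close>

text \<open>Reflexivity is demanded only for points related to something, so \<open>le w w\<close>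
  reads: \<open>w\<close> is a world. The type of worlds may then contain other points, as it does
  for the canonical model. Equality is interpreted by a congruence that may grow along
  \<open>le\<close>, not by identity.\<close>

locale kripke =
  fixes le :: "'w \<Rightarrow> 'w \<Rightarrow> bool"
    and D :: "'w \<Rightarrow> 'd set"
    and mem eq :: "'w \<Rightarrow> 'd \<Rightarrow> 'd \<Rightarrow> bool"
  assumes le_refl: "le w v \<Longrightarrow> le w w" "le w v \<Longrightarrow> le v v"
    and le_trans: "le u v \<Longrightarrow> le v w \<Longrightarrow> le u w"
    and D_mono: "le w v \<Longrightarrow> D w \<subseteq> D v"
    and D_ne: "le w w \<Longrightarrow> D w \<noteq> {}"
    and mem_mono: "le w v \<Longrightarrow> mem w x y \<Longrightarrow> mem v x y"
    and eq_mono: "le w v \<Longrightarrow> eq w x y \<Longrightarrow> eq v x y"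
    and eq_refl: "le w w \<Longrightarrow> x \<in> D w \<Longrightarrow> eq w x x"
    and eq_mem1: "eq w x y \<Longrightarrow> mem w x z \<Longrightarrow> le w w \<Longrightarrow> x \<in> D w \<Longrightarrow> y \<in> D w \<Longrightarrow> z \<in> D w \<Longrightarrow> mem w y z"
    and eq_mem2: "eq w x y \<Longrightarrow> mem w z x \<Longrightarrow> le w w \<Longrightarrow> x \<in> D w \<Longrightarrow> y \<in> D w \<Longrightarrow> z \<in> D w \<Longrightarrow> mem w z y"
    and eq_eq: "eq w x y \<Longrightarrow> eq w x z \<Longrightarrow> le w w \<Longrightarrow> x \<in> D w \<Longrightarrow> y \<in> D w \<Longrightarrow> z \<in> D w \<Longrightarrow> eq w y z"
begin

fun sem :: "'w \<Rightarrow> (nat \<Rightarrow> 'd) \<Rightarrow> fm \<Rightarrow> bool" where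
  "sem w \<rho> (Mem x y) = mem w (\<rho> x) (\<rho> y)"
| "sem w \<rho> (Eq x y) = eq w (\<rho> x) (\<rho> y)"
| "sem w \<rho> Bot = False"
| "sem w \<rho> (Conj A B) = (sem w \<rho> A \<and> sem w \<rho> B)"
| "sem w \<rho> (Disj A B) = (sem w \<rho> A \<or> sem w \<rho> B)"
| "sem w \<rho> (Imp A B) = (\<forall>v. le w v \<longrightarrow> sem v \<rho> A \<longrightarrow> sem v \<rho> B)"
| "sem w \<rho> (All x A) = (\<forall>v. le w v \<longrightarrow> (\<forall>d\<in>D v. sem v (\<rho>(x := d)) A))"
| "sem w \<rho> (Ex x A) = (\<exists>d\<in>D w. sem w (\<rho>(x := d)) A)"
| "sem w \<rho> (BAll x s A) =
    (\<forall>v. le w v \<longrightarrow> (\<forall>d\<in>D v. mem v d ((\<rho>(x := d)) s) \<longrightarrow> sem v (\<rho>(x := d)) A))"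
| "sem w \<rho> (BEx x s A) = (\<exists>d\<in>D w. mem w d ((\<rho>(x := d)) s) \<and> sem w (\<rho>(x := d)) A)"

definition valid :: "fm \<Rightarrow> bool" where
  "valid A \<longleftrightarrow> (\<forall>w \<rho>. le w w \<longrightarrow> range \<rho> \<subseteq> D w \<longrightarrow> sem w \<rho> A)"

lemma sem_mono: "sem w \<rho> A \<Longrightarrow> le w v \<Longrightarrow> sem v \<rho> A"
proof (induction A arbitrary: w v \<rho>)
  case (Imp A B)
  have "le w v'" if "le v v'" for v' using Imp.prems(2) that by (rule le_trans)
  thus ?case using Imp.prems(1) unfolding sem.simps by blast
next
  case (All x A)
  have "le w v'" if "le v v'" for v' using All.prems(2) that by (rule le_trans)
  thus ?case using All.prems(1) unfolding sem.simps by blast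
next
  case (Ex x A) thus ?case using D_mono by fastforce
next
  case (BAll x s A)
  have "le w v'" if "le v v'" for v' using BAll.prems(2) that by (rule le_trans)
  thus ?case using BAll.prems(1) unfolding sem.simps by blast
next
  case (BEx x s A) thus ?case using D_mono mem_mono by fastforce
qed (auto intro: mem_mono eq_mono)

lemma sem_BAll: "sem w \<rho> (BAll x s A) \<longleftrightarrow> sem w \<rho> (All x (Imp (Mem x s) A))"
  unfolding sem.simps fun_upd_same by (meson le_refl(2) le_trans D_mono subsetD)

end

section \<open>The canonical model\<close>

text \<open>Parameters are odd and come in blocks indexed by \<open>k\<close>: each level adds
  infinitely many to its predecessor, and the even numbers stay available for bound
  variables.\<close>

definition param :: "nat \<Rightarrow> nat \<Rightarrow> nat" where "param k j = Suc (2 * prod_encode (k, j))"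

definition level :: "nat \<Rightarrow> nat set" where "level k = {param i j | i j. i \<le> k}"

lemma level_mono: "k \<le> l \<Longrightarrow> level k \<subseteq> level l"
  unfolding level_def by (auto intro: order_trans)

lemma level_odd: "n \<in> level k \<Longrightarrow> odd n"
  unfolding level_def param_def by auto

lemma param_level: "param i j \<in> level k \<longleftrightarrow> i \<le> k"
  unfolding level_def param_def by auto

lemma infinite_level: "infinite (level (Suc k) - level k)"
proof -
  have "inj (param (Suc k))" by (auto simp: inj_def param_def)
  hence "infinite (range (param (Suc k)))" using finite_imageD infinite_UNIV_nat by blast
  moreover have "range (param (Suc k)) \<subseteq> level (Suc k) - level k" by (auto simp: param_level)
  ultimately show ?thesis using finite_subset by blast
qed

text \<open>A prime theory with Henkin witnesses in the language whose free variables are the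
  parameters of level \<open>k\<close>; deductive closure is meant within that language.\<close>

definition saturated :: "fm set \<Rightarrow> nat \<Rightarrow> fm set \<Rightarrow> bool" where
  "saturated T k \<Gamma> \<longleftrightarrow> (\<forall>C\<in>\<Gamma>. fv C \<subseteq> level k) \<and> (\<forall>C. fv C \<subseteq> level k \<longrightarrow> ded T \<Gamma> C \<longrightarrow> C \<in> \<Gamma>) \<and>
    Bot \<notin> \<Gamma> \<and> (\<forall>A B. Disj A B \<in> \<Gamma> \<longrightarrow> A \<in> \<Gamma> \<or> B \<in> \<Gamma>) \<and>
    (\<forall>y B. Ex y B \<in> \<Gamma> \<longrightarrow> (\<exists>n\<in>level k. subst B y n \<in> \<Gamma>))"

lemma prov_ex_rename:
  assumes "m \<notin> vars B"
  shows "prov T (Imp (Ex y B) (Ex m (subst B y m)))"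
proof (rule exE)
  show "prov T (Imp B (Ex m (subst B y m)))"
    using ax_exI[OF substitutable_back[OF assms, of y], of T] subst_back[OF assms] by simp
  show "y \<notin> fv (Ex m (subst B y m))" using fv_subst by fastforce
qed

lemma ded_all_rename:
  assumes "m \<notin> vars B" "m \<notin> fvs \<Gamma>" "y \<notin> fvs \<Gamma>" "ded T \<Gamma> (subst B y m)"
  shows "ded T \<Gamma> (All y B)"
  using ded_allE[OF ded_allI[OF assms(4,2)] substitutable_back[OF assms(1)]] subst_back[OF assms(1)]
    ded_allI assms(3) by simp

lemma fvs_insert: "fvs (insert C \<Gamma>) = fv C \<union> fvs \<Gamma>"
  by (auto simp: fvs_def)

lemma ded_Conj_iff: "ded T \<Gamma> (Conj A B) \<longleftrightarrow> ded T \<Gamma> A \<and> ded T \<Gamma> B"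
  using ded_conjI ded_ax[OF ax_conjE1] ded_ax[OF ax_conjE2] by blast

lemma finite_fv: "finite (fv A)"
  using finite_vars fv_subset_vars finite_subset by blast

instance fm :: countable by countable_datatype

lemma extend_saturated:
  assumes nd: "\<not> ded T \<Gamma> A" and fr: "fvs \<Gamma> \<subseteq> level (Suc k)" "finite (fvs \<Gamma> - level k)"
  obtains \<Delta> where "\<Gamma> \<subseteq> \<Delta>" "saturated T (Suc k) \<Delta>" "\<not> ded T \<Delta> A"
proof -
  let ?V = "level (Suc k)"
  define P where "P S \<longleftrightarrow> \<Gamma> \<subseteq> S \<and> \<not> ded T S A \<and> fvs S \<subseteq> ?V \<and> finite (fvs S - level k)" for S
  define Q where "Q n S S' \<longleftrightarrow> S \<subseteq> S' \<and> (fv (from_nat n) \<subseteq> ?V \<longrightarrow> ded T (insert (from_nat n) S) A \<or>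
    (from_nat n \<in> S' \<and> (\<forall>y B. from_nat n = Ex y B \<longrightarrow> (\<exists>m\<in>?V. subst B y m \<in> S'))))" for n S S'
  have step: "\<exists>S'. P S' \<and> Q n S S'" if S: "P S" for n S
  proof (cases "fv (from_nat n) \<subseteq> ?V \<and> \<not> ded T (insert (from_nat n) S) A")
    case False
    thus ?thesis using S by (intro exI[of _ S]) (auto simp: Q_def)
  next
    case True
    define C :: fm where "C = from_nat n"
    have C: "fv C \<subseteq> ?V" "\<not> ded T (insert C S) A" using True by (auto simp: C_def)
    have PC: "P (insert C S)" using S C finite_fv[of C] by (auto simp: P_def fvs_insert Un_Diff)
    show ?thesis
    proof (cases "\<exists>y B. C = Ex y B")
      case False
      thus ?thesis using PC by (intro exI[of _ "insert C S"]) (auto simp: Q_def C_def)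
    next
      case True
      then obtain y B where yB: "C = Ex y B" by auto
      have "infinite (level (Suc k) - level k - (vars B \<union> fv A \<union> (fvs (insert C S) - level k)))"
        by (rule Diff_infinite_finite[OF _ infinite_level]) (use PC in \<open>auto simp: P_def finite_vars finite_fv\<close>)
      then obtain m where "m \<in> level (Suc k) - level k - (vars B \<union> fv A \<union> (fvs (insert C S) - level k))"
        by (metis (no_types, lifting) all_not_in_conv finite.emptyI)
      hence m: "m \<in> ?V" "m \<notin> vars B" "m \<notin> fv A" "m \<notin> fvs (insert C S)" by auto
      have "ded T (insert C S) (Ex m (subst B y m))"
        by (rule ded_ax[OF prov_ex_rename[OF m(2)]], rule ded_hyp) (simp add: yB)
      hence "\<not> ded T (insert (subst B y m) (insert C S)) A"
        using ded_exE[OF _ _ m(3,4)] C(2) by blast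
      moreover have "fv (subst B y m) \<subseteq> insert m (fv C)" using fv_subst[of B y m] yB by auto
      ultimately have "P (insert (subst B y m) (insert C S))"
        using PC m finite_fv[of "subst B y m"] C(1)
        unfolding P_def fvs_insert[of "subst B y m"] by (auto simp: Un_Diff)
      thus ?thesis using m yB by (intro exI[of _ "insert (subst B y m) (insert C S)"]) (auto simp: Q_def C_def)
    qed
  qed
  have "\<exists>S. P S" using assms by (auto simp: P_def)
  then obtain G where G: "\<And>n. P (G n)" "\<And>n. Q n (G n) (G (Suc n))"
    using dependent_nat_choice[of "\<lambda>_. P" Q] step by blast
  have mono: "G n \<subseteq> G m" if "n \<le> m" for n m
    by (rule lift_Suc_mono_le[OF _ that]) (use G(2) in \<open>auto simp: Q_def\<close>)
  define \<Delta> where "\<Delta> = (\<Union>n. G n)"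
  have nA: "\<not> ded T \<Delta> A"
  proof
    assume "ded T \<Delta> A"
    then obtain Bs where Bs: "set Bs \<subseteq> \<Delta>" "prov T (Imp (conjs Bs) A)" unfolding ded_def by auto
    have "\<exists>n. set Bs \<subseteq> G n" using Bs(1)
    proof (induction Bs)
      case (Cons B Bs)
      then obtain n m where "set Bs \<subseteq> G n" "B \<in> G m" by (auto simp: \<Delta>_def)
      thus ?case using mono[of n "max n m"] mono[of m "max n m"] by (intro exI[of _ "max n m"]) auto
    qed auto
    thus False using G(1) Bs(2) unfolding P_def ded_def by blast
  qed
  \<comment> \<open>A formula is left out only because it derives \<open>A\<close> together with
    what had been accepted by then. Deductive closure and primeness both follow from this
    dichotomy.\<close>
  have dich: "C \<in> \<Delta> \<or> ded T (insert C \<Delta>) A" if "fv C \<subseteq> ?V" for C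
  proof -
    have "C \<in> G (Suc (to_nat C)) \<or> ded T (insert C (G (to_nat C))) A"
      using G(2)[of "to_nat C"] that by (auto simp: Q_def)
    thus ?thesis unfolding \<Delta>_def by (blast intro: ded_mono)
  qed
  have fv: "fv C \<subseteq> ?V" if "C \<in> \<Delta>" for C
    using that G(1) unfolding \<Delta>_def P_def fvs_def by blast
  have "saturated T (Suc k) \<Delta>"
    unfolding saturated_def
  proof (intro conjI ballI HOL.allI impI)
    fix C assume "fv C \<subseteq> ?V" "ded T \<Delta> C"
    thus "C \<in> \<Delta>" using dich nA ded_cut by blast
  next
    show "Bot \<notin> \<Delta>" using nA ded_ax[OF ax_efq ded_hyp] by blast
  next
    fix B C assume BC: "Disj B C \<in> \<Delta>"
    show "B \<in> \<Delta> \<or> C \<in> \<Delta>"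
    proof (rule ccontr)
      assume "\<not> ?thesis"
      hence "ded T (insert B \<Delta>) A" "ded T (insert C \<Delta>) A" using dich fv[OF BC] by auto
      thus False using ded_disjE[OF ded_hyp[OF BC]] nA by blast
    qed
  next
    fix y B assume yB: "Ex y B \<in> \<Delta>"
    let ?n = "to_nat (Ex y B)"
    have "\<not> ded T (insert (Ex y B) (G ?n)) A"
      using nA yB ded_mono[of T "insert (Ex y B) (G ?n)" A \<Delta>] by (auto simp: \<Delta>_def)
    hence "\<exists>m\<in>?V. subst B y m \<in> G (Suc ?n)" using G(2)[of ?n] fv[OF yB] by (auto simp: Q_def)
    thus "\<exists>m\<in>?V. subst B y m \<in> \<Delta>" unfolding \<Delta>_def by blast
  qed (use fv in auto)
  moreover have "\<Gamma> \<subseteq> \<Delta>" using G(1) by (auto simp: P_def \<Delta>_def)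
  ultimately show ?thesis using that nA by blast
qed

text \<open>Instances by parameters: bound variables become even and parameters are odd, so that no
  variable is ever captured.\<close>

abbreviation dbl :: "nat \<Rightarrow> nat" where "dbl x \<equiv> 2 * x"

abbreviation inst :: "(nat \<Rightarrow> nat) \<Rightarrow> fm \<Rightarrow> fm" where "inst f A \<equiv> ren f dbl A"

lemma capture_free_odd: "(\<And>z. odd (f z)) \<Longrightarrow> capture_free f dbl"
  unfolding capture_free_def inj_def by (metis dvd_triv_left mult_cancel1 zero_neq_numeral)

lemma range_odd: "range f \<subseteq> level k \<Longrightarrow> odd (f z)"
  using level_odd by blast

lemma fv_inst: "range f \<subseteq> level k \<Longrightarrow> fv (inst f A) \<subseteq> level k"
  by (subst fv_ren_capture_free[OF capture_free_odd[OF range_odd]]) auto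

lemma substitutable_inst: "odd n \<Longrightarrow> substitutable n y (inst f A)"
  by (induction A arbitrary: f) auto

text \<open>Stated for all capture-free \<open>f\<close>, because below a binder \<open>f\<close>
  takes even values and no longer only parameters.\<close>

lemma subst_inst_aux:
  "capture_free f dbl \<Longrightarrow> subst (inst f A) (2 * x) n = inst (\<lambda>z. if f z = 2 * x then n else f z) A"
proof (induction A arbitrary: f)
  case (All y A)
  let ?g = "\<lambda>f z. if f z = 2 * x then n else f z"
  have "subst (inst (f(y := 2 * y)) A) (2 * x) n = inst (?g (f(y := 2 * y))) A"
    by (rule All.IH[OF capture_free_upd[OF All.prems]])
  moreover have "?g (f(y := 2 * y)) = (?g f)(y := 2 * y)" if "y \<noteq> x"
    using that by auto
  moreover have e: "f z = 2 * x \<Longrightarrow> z = x" for z using All.prems by (simp add: capture_free_def)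
  hence "inst ((?g f)(x := 2 * x)) A = inst (f(x := 2 * x)) A" by (intro ren_cong) auto
  ultimately show ?case using e by (cases "y = x") (auto simp: sw_def)
next
  case (Ex y A)
  let ?g = "\<lambda>f z. if f z = 2 * x then n else f z"
  have "subst (inst (f(y := 2 * y)) A) (2 * x) n = inst (?g (f(y := 2 * y))) A"
    by (rule Ex.IH[OF capture_free_upd[OF Ex.prems]])
  moreover have "?g (f(y := 2 * y)) = (?g f)(y := 2 * y)" if "y \<noteq> x"
    using that by auto
  moreover have e: "f z = 2 * x \<Longrightarrow> z = x" for z using Ex.prems by (simp add: capture_free_def)
  hence "inst ((?g f)(x := 2 * x)) A = inst (f(x := 2 * x)) A" by (intro ren_cong) auto
  ultimately show ?case using e by (cases "y = x") (auto simp: sw_def)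
next
  case (BAll y s A)
  let ?g = "\<lambda>f z. if f z = 2 * x then n else f z"
  have "subst (inst (f(y := 2 * y)) A) (2 * x) n = inst (?g (f(y := 2 * y))) A"
    by (rule BAll.IH[OF capture_free_upd[OF BAll.prems]])
  moreover have "?g (f(y := 2 * y)) = (?g f)(y := 2 * y)" if "y \<noteq> x"
    using that by auto
  moreover have e: "f z = 2 * x \<Longrightarrow> z = x" for z using BAll.prems by (simp add: capture_free_def)
  hence "inst ((?g f)(x := 2 * x)) A = inst (f(x := 2 * x)) A" by (intro ren_cong) auto
  ultimately show ?case using e by (cases "y = x") (auto simp: sw_def)
next
  case (BEx y s A)
  let ?g = "\<lambda>f z. if f z = 2 * x then n else f z"
  have "subst (inst (f(y := 2 * y)) A) (2 * x) n = inst (?g (f(y := 2 * y))) A"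
    by (rule BEx.IH[OF capture_free_upd[OF BEx.prems]])
  moreover have "?g (f(y := 2 * y)) = (?g f)(y := 2 * y)" if "y \<noteq> x"
    using that by auto
  moreover have e: "f z = 2 * x \<Longrightarrow> z = x" for z using BEx.prems by (simp add: capture_free_def)
  hence "inst ((?g f)(x := 2 * x)) A = inst (f(x := 2 * x)) A" by (intro ren_cong) auto
  ultimately show ?case using e by (cases "y = x") (auto simp: sw_def)
qed (auto simp: sw_def)

text \<open>The left side is what the quantifier axioms make of an instantiated quantifier: its
  body, in which \<open>x\<close> has become the even variable \<open>2 * x\<close>, with that
  variable replaced.\<close>

lemma subst_inst: assumes "range f \<subseteq> level k"
  shows "subst (inst (f(x := 2 * x)) A) (2 * x) n = inst (f(x := n)) A"
proof -
  have *: "odd (f z)" for z by (rule range_odd[OF assms])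
  hence ne: "f z \<noteq> 2 * y" for z y by (metis dvd_triv_left)
  have "capture_free (f(x := 2 * x)) dbl" by (rule capture_free_upd[OF capture_free_odd[OF *]])
  moreover have "(\<lambda>z. if (f(x := 2 * x)) z = 2 * x then n else (f(x := 2 * x)) z) = f(x := n)"
    using ne by (simp add: fun_eq_iff)
  ultimately show ?thesis using subst_inst_aux by simp
qed

lemma vars_ren: "vars (ren f b A) \<subseteq> f ` fv A \<union> range b"
proof (induction A arbitrary: f)
  case (All x A)
  have "(f(x := b x)) ` fv A \<subseteq> f ` (fv A - {x}) \<union> range b" by auto
  hence "vars (ren (f(x := b x)) b A) \<subseteq> f ` (fv A - {x}) \<union> range b" using All.IH[of "f(x := b x)"] by blast
  thus ?case by auto
next
  case (Ex x A)
  have "(f(x := b x)) ` fv A \<subseteq> f ` (fv A - {x}) \<union> range b" by auto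
  hence "vars (ren (f(x := b x)) b A) \<subseteq> f ` (fv A - {x}) \<union> range b" using Ex.IH[of "f(x := b x)"] by blast
  thus ?case by auto
next
  case (BAll x s A)
  have "(f(x := b x)) ` fv A \<subseteq> f ` (fv A - {x}) \<union> range b" by auto
  hence "vars (ren (f(x := b x)) b A) \<subseteq> f ` (fv A - {x}) \<union> range b" using BAll.IH[of "f(x := b x)"] by blast
  thus ?case by auto
next
  case (BEx x s A)
  have "(f(x := b x)) ` fv A \<subseteq> f ` (fv A - {x}) \<union> range b" by auto
  hence "vars (ren (f(x := b x)) b A) \<subseteq> f ` (fv A - {x}) \<union> range b" using BEx.IH[of "f(x := b x)"] by blast
  thus ?case by auto
next
  case (Conj A B) show ?case using Conj.IH[of f] by auto
next
  case (Disj A B) show ?case using Disj.IH[of f] by auto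
next
  case (Imp A B) show ?case using Imp.IH[of f] by auto
qed auto

text \<open>The parameter \<open>param (Suc k) 0\<close> lies outside level \<open>k\<close> and is
  therefore generic over \<open>\<rho>\<close> and \<open>\<Gamma>\<close>.\<close>

lemma generic_instance:
  assumes \<rho>: "range \<rho> \<subseteq> level k" and \<Gamma>: "fvs \<Gamma> \<subseteq> level k"
    and d: "ded T \<Gamma> (inst (\<rho>(x := param (Suc k) 0)) A)"
  shows "ded T \<Gamma> (All (2 * x) (inst (\<rho>(x := 2 * x)) A))"
proof (rule ded_all_rename)
  let ?m = "param (Suc k) 0"
  have m: "?m \<notin> level k" "odd ?m" by (simp_all add: param_level) (simp add: param_def)
  show "?m \<notin> vars (inst (\<rho>(x := 2 * x)) A)"
  proof
    assume "?m \<in> vars (inst (\<rho>(x := 2 * x)) A)"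
    hence "?m \<in> (\<rho>(x := 2 * x)) ` fv A \<union> range dbl" using vars_ren by blast
    thus False using m \<rho> by (auto split: if_splits)
  qed
  show "?m \<notin> fvs \<Gamma>" "2 * x \<notin> fvs \<Gamma>" using m \<Gamma> level_odd by force+
  show "ded T \<Gamma> (subst (inst (\<rho>(x := 2 * x)) A) (2 * x) ?m)"
    using d subst_inst[OF \<rho>] by simp
qed

section \<open>Worlds of the canonical model and the truth lemma\<close>

definition can_le :: "fm set \<Rightarrow> nat \<times> fm set \<Rightarrow> nat \<times> fm set \<Rightarrow> bool" where
  "can_le T w v \<longleftrightarrow> saturated T (fst w) (snd w) \<and> saturated T (fst v) (snd v) \<and> fst w \<le> fst v \<and> snd w \<subseteq> snd v"

lemma saturated_ded: "saturated T k \<Gamma> \<Longrightarrow> fv C \<subseteq> level k \<Longrightarrow> ded T \<Gamma> C \<longleftrightarrow> C \<in> \<Gamma>"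
  unfolding saturated_def using ded_hyp by blast

interpretation can: kripke "can_le T" "\<lambda>w. level (fst w)" "\<lambda>w x y. Mem x y \<in> snd w" "\<lambda>w x y. Eq x y \<in> snd w"
  for T
proof
  have c: "C \<in> snd w" if "can_le T w w" "fv C \<subseteq> level (fst w)" "ded T (snd w) C" for w C
    using that saturated_ded unfolding can_le_def by blast
  fix w assume w: "can_le T w w"
  show "level (fst w) \<noteq> {}" using param_level by blast
  fix x y z
  show "x \<in> level (fst w) \<Longrightarrow> Eq x x \<in> snd w"
    by (rule c[OF w]) (auto intro: ded_prov ax_refl)
  assume "Eq x y \<in> snd w" "x \<in> level (fst w)" "y \<in> level (fst w)" "z \<in> level (fst w)"
  note h = ded_hyp[OF this(1)] this(2-)
  show "Mem x z \<in> snd w \<Longrightarrow> Mem y z \<in> snd w"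
    by (rule c[OF w]) (use h in \<open>auto intro: ded_mp[OF ded_ax[OF ax_eq_mem1]] ded_hyp\<close>)
  show "Mem z x \<in> snd w \<Longrightarrow> Mem z y \<in> snd w"
    by (rule c[OF w]) (use h in \<open>auto intro: ded_mp[OF ded_ax[OF ax_eq_mem2]] ded_hyp\<close>)
  show "Eq x z \<in> snd w \<Longrightarrow> Eq y z \<in> snd w"
    by (rule c[OF w]) (use h in \<open>auto intro: ded_mp[OF ded_ax[OF ax_eq_eq]] ded_hyp\<close>)
qed (use level_mono in \<open>auto simp: can_le_def\<close>)

text \<open>The truth lemma for a single formula, kept as a predicate so that the connectives can be
  treated separately and the bounded quantifiers reduced to their unbounded equivalents.\<close>

definition truthful :: "fm set \<Rightarrow> fm \<Rightarrow> bool" where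
  "truthful T A \<longleftrightarrow> (\<forall>k \<Gamma> \<rho>. saturated T k \<Gamma> \<longrightarrow> range \<rho> \<subseteq> level k \<longrightarrow>
    (can.sem T (k, \<Gamma>) \<rho> A \<longleftrightarrow> inst \<rho> A \<in> \<Gamma>))"

lemma truthfulI:
  "(\<And>k \<Gamma> \<rho>. saturated T k \<Gamma> \<Longrightarrow> range \<rho> \<subseteq> level k \<Longrightarrow> can.sem T (k, \<Gamma>) \<rho> A \<longleftrightarrow> inst \<rho> A \<in> \<Gamma>)
    \<Longrightarrow> truthful T A"
  by (simp add: truthful_def)

lemma truthfulD:
  "truthful T A \<Longrightarrow> saturated T k \<Gamma> \<Longrightarrow> range \<rho> \<subseteq> level k \<Longrightarrow> can.sem T (k, \<Gamma>) \<rho> A \<longleftrightarrow> inst \<rho> A \<in> \<Gamma>"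
  by (simp add: truthful_def)

lemma saturated_inst:
  "saturated T k \<Gamma> \<Longrightarrow> range \<rho> \<subseteq> level k \<Longrightarrow> ded T \<Gamma> (inst \<rho> A) \<longleftrightarrow> inst \<rho> A \<in> \<Gamma>"
  by (rule saturated_ded[OF _ fv_inst])

text \<open>The later world lives one level higher, which renews the supply of fresh
  parameters.\<close>

lemma extend_world:
  assumes \<Gamma>: "saturated T k \<Gamma>" and nd: "\<not> ded T (insert B \<Gamma>) A" and B: "fv B \<subseteq> level (Suc k)"
  obtains \<Delta> where "insert B \<Gamma> \<subseteq> \<Delta>" "saturated T (Suc k) \<Delta>" "\<not> ded T \<Delta> A" "can_le T (k, \<Gamma>) (Suc k, \<Delta>)"
proof -
  have f: "fvs \<Gamma> \<subseteq> level k" using \<Gamma> by (auto simp: saturated_def fvs_def)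
  hence "fvs (insert B \<Gamma>) \<subseteq> level (Suc k)" using B level_mono[of k "Suc k"] unfolding fvs_insert by auto
  moreover have "finite (fvs (insert B \<Gamma>) - level k)"
    by (rule finite_subset[OF _ finite_fv[of B]]) (use f in \<open>auto simp: fvs_insert\<close>)
  ultimately obtain \<Delta> where "insert B \<Gamma> \<subseteq> \<Delta>" "saturated T (Suc k) \<Delta>" "\<not> ded T \<Delta> A"
    using extend_saturated nd by metis
  thus ?thesis using that \<Gamma> by (auto simp: can_le_def)
qed

lemma truthful_Conj:
  assumes "truthful T A" "truthful T B" shows "truthful T (Conj A B)"
proof (rule truthfulI)
  fix k \<Gamma> and \<rho> :: "nat \<Rightarrow> nat"
  assume w: "saturated T k \<Gamma>" "range \<rho> \<subseteq> level k"
  note s = saturated_inst[OF w, symmetric]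
  have "inst \<rho> (Conj A B) \<in> \<Gamma> \<longleftrightarrow> inst \<rho> A \<in> \<Gamma> \<and> inst \<rho> B \<in> \<Gamma>" unfolding s by (simp add: ded_Conj_iff)
  thus "can.sem T (k, \<Gamma>) \<rho> (Conj A B) \<longleftrightarrow> inst \<rho> (Conj A B) \<in> \<Gamma>" using assms w by (simp add: truthfulD)
qed

lemma truthful_Disj:
  assumes "truthful T A" "truthful T B" shows "truthful T (Disj A B)"
proof (rule truthfulI)
  fix k \<Gamma> and \<rho> :: "nat \<Rightarrow> nat"
  assume w: "saturated T k \<Gamma>" "range \<rho> \<subseteq> level k"
  note s = saturated_inst[OF w]
  have "ded T \<Gamma> (inst \<rho> A) \<Longrightarrow> ded T \<Gamma> (inst \<rho> (Disj A B))" "ded T \<Gamma> (inst \<rho> B) \<Longrightarrow> ded T \<Gamma> (inst \<rho> (Disj A B))"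
    using ded_ax[OF ax_disjI1] ded_ax[OF ax_disjI2] by auto
  hence "inst \<rho> A \<in> \<Gamma> \<or> inst \<rho> B \<in> \<Gamma> \<Longrightarrow> inst \<rho> (Disj A B) \<in> \<Gamma>" unfolding s by blast
  moreover have "Disj (inst \<rho> A) (inst \<rho> B) \<in> \<Gamma> \<Longrightarrow> inst \<rho> A \<in> \<Gamma> \<or> inst \<rho> B \<in> \<Gamma>"
    using w(1) unfolding saturated_def by blast
  ultimately show "can.sem T (k, \<Gamma>) \<rho> (Disj A B) \<longleftrightarrow> inst \<rho> (Disj A B) \<in> \<Gamma>"
    using truthfulD[OF assms(1) w] truthfulD[OF assms(2) w] by auto
qed

lemma truthful_Imp:
  assumes A: "truthful T A" and B: "truthful T B" shows "truthful T (Imp A B)"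
proof (rule truthfulI)
  fix k \<Gamma> and \<rho> :: "nat \<Rightarrow> nat"
  assume w: "saturated T k \<Gamma>" "range \<rho> \<subseteq> level k"
  have r: "range \<rho> \<subseteq> level l" if "k \<le> l" for l using level_mono[OF that] w(2) by auto
  show "can.sem T (k, \<Gamma>) \<rho> (Imp A B) \<longleftrightarrow> inst \<rho> (Imp A B) \<in> \<Gamma>"
  proof
    assume i: "inst \<rho> (Imp A B) \<in> \<Gamma>"
    show "can.sem T (k, \<Gamma>) \<rho> (Imp A B)"
      unfolding can.sem.simps
    proof (intro HOL.allI impI)
      fix v assume v: "can_le T (k, \<Gamma>) v" and a: "can.sem T v \<rho> A"
      obtain l \<Delta> where l: "v = (l, \<Delta>)" by force
      hence s: "saturated T l \<Delta>" "k \<le> l" "\<Gamma> \<subseteq> \<Delta>" using v by (auto simp: can_le_def)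
      have "ded T \<Delta> (inst \<rho> A)" "ded T \<Delta> (Imp (inst \<rho> A) (inst \<rho> B))"
        using i s a l truthfulD[OF A s(1) r[OF s(2)]] by (auto intro: ded_hyp)
      hence "inst \<rho> B \<in> \<Delta>" using saturated_inst[OF s(1) r[OF s(2)]] ded_mp by blast
      thus "can.sem T v \<rho> B" using truthfulD[OF B s(1) r[OF s(2)]] l by simp
    qed
  next
    assume sem: "can.sem T (k, \<Gamma>) \<rho> (Imp A B)"
    show "inst \<rho> (Imp A B) \<in> \<Gamma>"
    proof (rule ccontr)
      assume "\<not> ?thesis"
      hence nd: "\<not> ded T (insert (inst \<rho> A) \<Gamma>) (inst \<rho> B)"
        using saturated_inst[OF w, of "Imp A B"] ded_impI by auto
      obtain \<Delta> where \<Delta>: "insert (inst \<rho> A) \<Gamma> \<subseteq> \<Delta>" "saturated T (Suc k) \<Delta>"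
        "\<not> ded T \<Delta> (inst \<rho> B)" "can_le T (k, \<Gamma>) (Suc k, \<Delta>)"
        by (rule extend_world[OF w(1) nd fv_inst[OF r[OF le_SucI[OF order_refl]]]])
      thus False using sem truthfulD[OF A \<Delta>(2) r] truthfulD[OF B \<Delta>(2) r] ded_hyp by auto
    qed
  qed
qed

lemma truthful_All:
  assumes A: "truthful T A" shows "truthful T (All x A)"
proof (rule truthfulI)
  fix k \<Gamma> and \<rho> :: "nat \<Rightarrow> nat"
  assume w: "saturated T k \<Gamma>" "range \<rho> \<subseteq> level k"
  have r: "range (\<rho>(x := n)) \<subseteq> level l" if "k \<le> l" "n \<in> level l" for l n
    using level_mono[OF that(1)] w(2) that(2) by auto
  show "can.sem T (k, \<Gamma>) \<rho> (All x A) \<longleftrightarrow> inst \<rho> (All x A) \<in> \<Gamma>"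
  proof
    assume i: "inst \<rho> (All x A) \<in> \<Gamma>"
    show "can.sem T (k, \<Gamma>) \<rho> (All x A)"
      unfolding can.sem.simps
    proof (intro HOL.allI impI ballI)
      fix v n assume v: "can_le T (k, \<Gamma>) v" and n: "n \<in> level (fst v)"
      obtain l \<Delta> where l: "v = (l, \<Delta>)" by force
      hence s: "saturated T l \<Delta>" "k \<le> l" "\<Gamma> \<subseteq> \<Delta>" using v by (auto simp: can_le_def)
      have n: "n \<in> level l" using n l by simp
      have "ded T \<Delta> (All (2 * x) (inst (\<rho>(x := 2 * x)) A))"
        using i s by (auto intro: ded_hyp)
      hence "ded T \<Delta> (inst (\<rho>(x := n)) A)"
        using ded_allE[OF _ substitutable_inst[OF level_odd[OF n]]] subst_inst[OF w(2)] by metis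
      thus "can.sem T v (\<rho>(x := n)) A"
        unfolding l using truthfulD[OF A s(1) r[OF s(2) n]] saturated_inst[OF s(1) r[OF s(2) n]] by blast
    qed
  next
    assume sem: "can.sem T (k, \<Gamma>) \<rho> (All x A)"
    let ?m = "param (Suc k) 0"
    have m: "?m \<in> level (Suc k)" by (simp add: param_level)
    have \<Gamma>: "fvs \<Gamma> \<subseteq> level k" using w(1) by (auto simp: saturated_def fvs_def)
    show "inst \<rho> (All x A) \<in> \<Gamma>"
    proof (rule ccontr)
      assume "\<not> ?thesis"
      hence "\<not> ded T \<Gamma> (inst (\<rho>(x := ?m)) A)"
        using saturated_inst[OF w, of "All x A"] generic_instance[OF w(2) \<Gamma>] by auto
      \<comment> \<open>\<open>extend_world\<close> always adds a formula; the derivable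
        \<open>Top\<close> takes that place because a universal quantifier has no
        antecedent.\<close>
      hence nd: "\<not> ded T (insert Top \<Gamma>) (inst (\<rho>(x := ?m)) A)"
        using ded_cut ded_prov[OF prov_id] unfolding Top_def by blast
      have "fv Top \<subseteq> level (Suc k)" by (simp add: Top_def)
      then obtain \<Delta> where \<Delta>: "insert Top \<Gamma> \<subseteq> \<Delta>" "saturated T (Suc k) \<Delta>"
        "\<not> ded T \<Delta> (inst (\<rho>(x := ?m)) A)" "can_le T (k, \<Gamma>) (Suc k, \<Delta>)"
        by (rule extend_world[OF w(1) nd])
      have "\<not> can.sem T (Suc k, \<Delta>) (\<rho>(x := ?m)) A"
        using \<Delta>(3) truthfulD[OF A \<Delta>(2) r[OF le_SucI[OF order_refl] m]] ded_hyp by blast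
      thus False using sem m \<Delta>(4) unfolding can.sem.simps by force
    qed
  qed
qed

lemma truthful_Ex:
  assumes A: "truthful T A" shows "truthful T (Ex x A)"
proof (rule truthfulI)
  fix k \<Gamma> and \<rho> :: "nat \<Rightarrow> nat"
  assume w: "saturated T k \<Gamma>" "range \<rho> \<subseteq> level k"
  have IH: "can.sem T (k, \<Gamma>) (\<rho>(x := n)) A \<longleftrightarrow> inst (\<rho>(x := n)) A \<in> \<Gamma>" if "n \<in> level k" for n
    using w that by (intro truthfulD[OF A]) auto
  have "inst \<rho> (Ex x A) \<in> \<Gamma> \<longleftrightarrow> (\<exists>n\<in>level k. inst (\<rho>(x := n)) A \<in> \<Gamma>)"
  proof
    assume "inst \<rho> (Ex x A) \<in> \<Gamma>"
    thus "\<exists>n\<in>level k. inst (\<rho>(x := n)) A \<in> \<Gamma>"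
      using w(1) subst_inst[OF w(2)] unfolding saturated_def ren.simps(8) by metis
  next
    assume "\<exists>n\<in>level k. inst (\<rho>(x := n)) A \<in> \<Gamma>"
    then obtain n where n: "n \<in> level k" "inst (\<rho>(x := n)) A \<in> \<Gamma>" by auto
    hence "ded T \<Gamma> (Ex (2 * x) (inst (\<rho>(x := 2 * x)) A))"
      using ded_exI[OF _ substitutable_inst[OF level_odd[OF n(1)]]] subst_inst[OF w(2)] ded_hyp by metis
    thus "inst \<rho> (Ex x A) \<in> \<Gamma>" using saturated_inst[OF w, of "Ex x A"] by simp
  qed
  thus "can.sem T (k, \<Gamma>) \<rho> (Ex x A) \<longleftrightarrow> inst \<rho> (Ex x A) \<in> \<Gamma>" using IH by auto
qed

lemma truthful_equiv:
  assumes A: "truthful T A" and d: "\<And>\<Gamma> \<rho>. ded T \<Gamma> (inst \<rho> A) \<longleftrightarrow> ded T \<Gamma> (inst \<rho> B)"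
    and s: "\<And>w \<rho>. can.sem T w \<rho> A \<longleftrightarrow> can.sem T w \<rho> B"
  shows "truthful T B"
proof (rule truthfulI)
  fix k \<Gamma> and \<rho> :: "nat \<Rightarrow> nat"
  assume w: "saturated T k \<Gamma>" "range \<rho> \<subseteq> level k"
  show "can.sem T (k, \<Gamma>) \<rho> B \<longleftrightarrow> inst \<rho> B \<in> \<Gamma>"
    using truthfulD[OF A w] saturated_inst[OF w, of A] saturated_inst[OF w, of B] d s by simp
qed

lemma truthful: "truthful T A"
proof (induction A)
  case (Mem x y) show ?case by (simp add: truthful_def)
next
  case (Eq x y) show ?case by (simp add: truthful_def)
next
  case Bot show ?case by (simp add: truthful_def saturated_def)
next
  case (BAll x s A)
  have "truthful T (Mem x s)" by (simp add: truthful_def)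
  hence "truthful T (All x (Imp (Mem x s) A))" using BAll truthful_All truthful_Imp by blast
  thus ?case
    by (rule truthful_equiv) (auto intro: ded_ax[OF ax_ball1] ded_ax[OF ax_ball2] simp: can.sem_BAll simp del: can.sem.simps)
next
  case (BEx x s A)
  have "truthful T (Mem x s)" by (simp add: truthful_def)
  hence "truthful T (Ex x (Conj (Mem x s) A))" using BEx truthful_Ex truthful_Conj by blast
  thus ?case
    by (rule truthful_equiv) (auto intro: ded_ax[OF ax_bex1] ded_ax[OF ax_bex2])
qed (simp_all add: truthful_Conj truthful_Disj truthful_Imp truthful_All truthful_Ex)

text \<open>The hypothesis speaks of the canonical model of \<open>T\<close> alone and may use that
  the axioms hold there. An argument about derivability in IKP can thus be carried out in one
  concrete model.\<close>

theorem completeness: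
  fixes T
  assumes "(\<And>B. B \<in> T \<Longrightarrow> can.valid T B) \<Longrightarrow> can.valid T A"
  shows "prov T A"
proof (rule ccontr)
  assume nA: "\<not> prov T A"
  have T: "can.valid T B" if "B \<in> T" for B
    unfolding can.valid_def
  proof (intro HOL.allI impI)
    fix w and \<rho> :: "nat \<Rightarrow> nat"
    assume w: "can_le T w w" and \<rho>: "range \<rho> \<subseteq> level (fst w)"
    have odd: "odd (\<rho> z)" for z by (rule range_odd[OF \<rho>])
    \<comment> \<open>Axioms may be open formulas; renaming derives their instances at the
      parameters given by \<open>\<rho>\<close>.\<close>
    have "prov T (inst \<rho> B)"
      by (rule prov_ren(1)[OF _ hyp[OF that]]) (use odd in \<open>metis dvd_triv_left mult_cancel1 zero_neq_numeral\<close>)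
    hence "inst \<rho> B \<in> snd w" using w saturated_inst[OF _ \<rho>] ded_prov unfolding can_le_def by blast
    thus "can.sem T w \<rho> B" using truthfulD[OF truthful, of T "fst w" "snd w" \<rho> B] w \<rho> by (simp add: can_le_def)
  qed
  \<comment> \<open>Distinct free variables receive distinct parameters, and this injectivity allows
    a derivation of the instance to be renamed back to one of \<open>A\<close>.\<close>
  define f where "f = param 0"
  have "inj f" by (auto simp: f_def inj_def param_def)
  moreover have "2 * x \<noteq> f z" for x z unfolding f_def param_def by presburger
  ultimately have "\<not> prov T (inst f A)" using nA prov_ren(2)[of dbl f T A] by auto
  hence "\<not> ded T {} (inst f A)" using ded_empty by blast
  then obtain \<Delta> where \<Delta>: "saturated T (Suc 0) \<Delta>" "\<not> ded T \<Delta> (inst f A)"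
    using extend_saturated[of T "{}" "inst f A" 0] by (auto simp: fvs_def)
  have "range f \<subseteq> level (Suc 0)" by (auto simp: f_def param_level)
  hence "\<not> can.sem T (Suc 0, \<Delta>) f A" using truthfulD[OF truthful \<Delta>(1)] \<Delta>(2) ded_hyp by blast
  moreover have "can.valid T A" using assms T by blast
  ultimately show False using \<Delta> \<open>range f \<subseteq> _\<close> unfolding can.valid_def can_le_def by auto
qed

section \<open>Forcing with goals\<close>

text \<open>Conjunction, implication and universal quantification preserve closure under the goals. The other
  statements are replaced by their closure: such a statement is forced when every goal that it
  implies is already satisfied.\<close>

locale goal_forcing =
  fixes le :: "'a \<Rightarrow> 'a \<Rightarrow> bool"
    and D :: "'a \<Rightarrow> 'd set"
    and mem eq :: "'a \<Rightarrow> 'd \<Rightarrow> 'd \<Rightarrow> bool"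
    and GD :: "'a \<Rightarrow> 'c set"
    and J :: "'a \<Rightarrow> 'c \<Rightarrow> bool"
  assumes le_refl: "le w v \<Longrightarrow> le w w" "le w v \<Longrightarrow> le v v"
    and le_trans: "le u v \<Longrightarrow> le v w \<Longrightarrow> le u w"
    and D_mono: "le w v \<Longrightarrow> D w \<subseteq> D v"
    and GD_mono: "le w v \<Longrightarrow> GD w \<subseteq> GD v"
    and mem_mono: "le w v \<Longrightarrow> mem w x y \<Longrightarrow> mem v x y"
    and eq_mono: "le w v \<Longrightarrow> eq w x y \<Longrightarrow> eq v x y"
    and eq_refl: "le w w \<Longrightarrow> x \<in> D w \<Longrightarrow> eq w x x"
    and eq_mem1: "eq w x y \<Longrightarrow> mem w x z \<Longrightarrow> le w w \<Longrightarrow> x \<in> D w \<Longrightarrow> y \<in> D w \<Longrightarrow> z \<in> D w \<Longrightarrow> mem w y z"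
    and eq_mem2: "eq w x y \<Longrightarrow> mem w z x \<Longrightarrow> le w w \<Longrightarrow> x \<in> D w \<Longrightarrow> y \<in> D w \<Longrightarrow> z \<in> D w \<Longrightarrow> mem w z y"
    and eq_eq: "eq w x y \<Longrightarrow> eq w x z \<Longrightarrow> le w w \<Longrightarrow> x \<in> D w \<Longrightarrow> y \<in> D w \<Longrightarrow> z \<in> D w \<Longrightarrow> eq w y z"
begin

text \<open>With respect to \<open>le\<close> this is the nucleus that sends X to the conjunction
  over all goals c of (X -> c) -> c: a Friedman translation with many answers instead of
  one.\<close>

definition cl :: "('a \<Rightarrow> bool) \<Rightarrow> 'a \<Rightarrow> bool" where
  "cl X a \<longleftrightarrow> (\<forall>b. le a b \<longrightarrow> (\<forall>c\<in>GD b. (\<forall>b'. le b b' \<longrightarrow> X b' \<longrightarrow> J b' c) \<longrightarrow> J b c))"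

fun frc :: "'a \<Rightarrow> (nat \<Rightarrow> 'd) \<Rightarrow> fm \<Rightarrow> bool" where
  "frc a \<rho> (Mem x y) = cl (\<lambda>b. mem b (\<rho> x) (\<rho> y)) a"
| "frc a \<rho> (Eq x y) = cl (\<lambda>b. eq b (\<rho> x) (\<rho> y)) a"
| "frc a \<rho> Bot = cl (\<lambda>b. False) a"
| "frc a \<rho> (Conj A B) = (frc a \<rho> A \<and> frc a \<rho> B)"
| "frc a \<rho> (Disj A B) = cl (\<lambda>b. frc b \<rho> A \<or> frc b \<rho> B) a"
| "frc a \<rho> (Imp A B) = (\<forall>b. le a b \<longrightarrow> frc b \<rho> A \<longrightarrow> frc b \<rho> B)"
| "frc a \<rho> (All x A) = (\<forall>b. le a b \<longrightarrow> (\<forall>d\<in>D b. frc b (\<rho>(x := d)) A))"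
| "frc a \<rho> (Ex x A) = cl (\<lambda>b. \<exists>d\<in>D b. frc b (\<rho>(x := d)) A) a"
| "frc a \<rho> (BAll x s A) = (\<forall>b. le a b \<longrightarrow>
    (\<forall>d\<in>D b. cl (\<lambda>b. mem b d ((\<rho>(x := d)) s)) b \<longrightarrow> frc b (\<rho>(x := d)) A))"
| "frc a \<rho> (BEx x s A) = cl (\<lambda>b. \<exists>d\<in>D b. cl (\<lambda>b. mem b d ((\<rho>(x := d)) s)) b \<and> frc b (\<rho>(x := d)) A) a"

lemma cl_mono: "cl X a \<Longrightarrow> le a b \<Longrightarrow> cl X b"
  unfolding cl_def using le_trans by blast

lemma clI: "(\<And>b. le a b \<Longrightarrow> X b) \<Longrightarrow> cl X a"
  unfolding cl_def using le_refl by blast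

text \<open>The bind law of the closure: a closed consequence has to be verified only where
  \<open>X\<close> holds outright, and nested closures collapse. A goal at \<open>b\<close> must
  still be a goal later, which is \<open>GD_mono\<close>.\<close>

lemma cl_bind:
  assumes X: "cl X a" and Y: "\<And>b. le a b \<Longrightarrow> X b \<Longrightarrow> cl Y b"
  shows "cl Y a"
  unfolding cl_def[of Y]
proof (intro HOL.allI impI ballI)
  fix b c
  assume b: "le a b" and c: "c \<in> GD b" and h: "\<forall>b'. le b b' \<longrightarrow> Y b' \<longrightarrow> J b' c"
  have "J b' c" if b': "le b b'" "X b'" for b'
  proof -
    have "cl Y b'" using Y le_trans b b' by blast
    moreover have "c \<in> GD b'" "le b' b'" using c b' GD_mono le_refl by blast+
    moreover have "\<forall>b''. le b' b'' \<longrightarrow> Y b'' \<longrightarrow> J b'' c" using h le_trans b' by blast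
    ultimately show ?thesis unfolding cl_def by blast
  qed
  thus "J b c" using X b c unfolding cl_def by blast
qed

lemma cl_imp: "cl X a \<Longrightarrow> (\<And>b. le a b \<Longrightarrow> X b \<Longrightarrow> Y b) \<Longrightarrow> cl Y a"
  unfolding cl_def using le_trans by blast

lemma frc_mono: "frc a \<rho> A \<Longrightarrow> le a b \<Longrightarrow> frc b \<rho> A"
proof (induction A arbitrary: a b \<rho>)
  case (Imp A B)
  have "le a v" if "le b v" for v using Imp.prems(2) that by (rule le_trans)
  thus ?case using Imp.prems(1) by auto
next
  case (All x A)
  have "le a v" if "le b v" for v using All.prems(2) that by (rule le_trans)
  thus ?case using All.prems(1) unfolding frc.simps by blast
next
  case (BAll x s A)
  have "le a v" if "le b v" for v using BAll.prems(2) that by (rule le_trans)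
  thus ?case using BAll.prems(1) unfolding frc.simps by blast
next
  case (BEx x s A)
  show ?case using BEx.prems unfolding frc.simps by (rule cl_mono)
qed (auto intro: cl_mono)

text \<open>Conjunction, implication and universal quantification preserve closedness, and the
  remaining clauses are closures already. It is this property that lets \<open>soundness\<close>
  eliminate disjunctions and existentials into arbitrary formulas.\<close>

lemma frc_closed: "le a a \<Longrightarrow> cl (\<lambda>b. frc b \<rho> A) a \<Longrightarrow> frc a \<rho> A"
proof (induction A arbitrary: a \<rho>)
  case (Conj A B)
  have "cl (\<lambda>b. frc b \<rho> A) a" "cl (\<lambda>b. frc b \<rho> B) a" using Conj.prems(2) by (auto elim: cl_imp)
  thus ?case using Conj by auto
next
  case (Imp A B)
  show ?case unfolding frc.simps
  proof (intro HOL.allI impI)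
    fix b assume b: "le a b" "frc b \<rho> A"
    have "cl (\<lambda>b. frc b \<rho> B) b"
    proof (rule cl_imp[OF cl_mono[OF Imp.prems(2) b(1)]])
      fix c assume c: "le b c" "frc c \<rho> (Imp A B)"
      thus "frc c \<rho> B" using le_refl(2)[OF c(1)] frc_mono[OF b(2) c(1)] unfolding frc.simps by blast
    qed
    thus "frc b \<rho> B" using Imp.IH le_refl b by blast
  qed
next
  case (All x A)
  show ?case unfolding frc.simps
  proof (intro HOL.allI impI ballI)
    fix b d assume b: "le a b" "d \<in> D b"
    have "cl (\<lambda>b. frc b (\<rho>(x := d)) A) b"
    proof (rule cl_imp[OF cl_mono[OF All.prems(2) b(1)]])
      fix c assume c: "le b c" "frc c \<rho> (All x A)"
      thus "frc c (\<rho>(x := d)) A"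
        using le_refl(2)[OF c(1)] b(2) D_mono[OF c(1)] unfolding frc.simps by blast
    qed
    thus "frc b (\<rho>(x := d)) A" using All.IH le_refl b by blast
  qed
next
  case (BAll x s A)
  show ?case unfolding frc.simps
  proof (intro HOL.allI impI ballI)
    fix b d assume b: "le a b" "d \<in> D b" "cl (\<lambda>b. mem b d ((\<rho>(x := d)) s)) b"
    have "cl (\<lambda>b. frc b (\<rho>(x := d)) A) b"
    proof (rule cl_imp[OF cl_mono[OF BAll.prems(2) b(1)]])
      fix c assume c: "le b c" "frc c \<rho> (BAll x s A)"
      thus "frc c (\<rho>(x := d)) A"
        using le_refl(2)[OF c(1)] b(2) D_mono[OF c(1)] cl_mono[OF b(3) c(1)] unfolding frc.simps by blast
    qed
    thus "frc b (\<rho>(x := d)) A" using BAll.IH le_refl b by blast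
  qed
next
  case (BEx x s A)
  show ?case using BEx.prems(2) unfolding frc.simps by (rule cl_bind)
qed (auto elim: cl_bind)

lemma frc_cong: "\<forall>x\<in>fv A. \<rho> x = \<sigma> x \<Longrightarrow> frc a \<rho> A = frc a \<sigma> A"
proof (induction A arbitrary: \<rho> \<sigma> a)
  case (Conj A B)
  have "frc a \<rho> A = frc a \<sigma> A" "frc a \<rho> B = frc a \<sigma> B" for a using Conj by auto
  thus ?case by simp
next
  case (Disj A B)
  have "frc a \<rho> A = frc a \<sigma> A" "frc a \<rho> B = frc a \<sigma> B" for a using Disj by auto
  thus ?case by simp
next
  case (Imp A B)
  have "frc a \<rho> A = frc a \<sigma> A" "frc a \<rho> B = frc a \<sigma> B" for a using Imp by auto
  thus ?case by simp
next
  case (All x A)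
  have "frc a (\<rho>(x := d)) A = frc a (\<sigma>(x := d)) A" for a d using All.prems by (intro All.IH) auto
  thus ?case by simp
next
  case (Ex x A)
  have "frc a (\<rho>(x := d)) A = frc a (\<sigma>(x := d)) A" for a d using Ex.prems by (intro Ex.IH) auto
  thus ?case by simp
next
  case (BAll x s A)
  have "frc a (\<rho>(x := d)) A = frc a (\<sigma>(x := d)) A" "(\<rho>(x := d)) s = (\<sigma>(x := d)) s" for a d
    using BAll.prems by (auto intro!: BAll.IH)
  thus ?case by (simp only: frc.simps)
next
  case (BEx x s A)
  have "frc a (\<rho>(x := d)) A = frc a (\<sigma>(x := d)) A" "(\<rho>(x := d)) s = (\<sigma>(x := d)) s" for a d
    using BEx.prems by (auto intro!: BEx.IH)
  thus ?case by (simp only: frc.simps)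
qed auto

lemma frc_subst: "substitutable t x A \<Longrightarrow> frc a \<rho> (subst A x t) = frc a (\<rho>(x := \<rho> t)) A"
proof (induction A arbitrary: \<rho> a)
  case (All y A)
  show ?case
  proof (cases "x \<in> fv (All y A)")
    case True
    hence *: "y \<noteq> t" "substitutable t x A" "y \<noteq> x" using All.prems by auto
    have "(\<rho>(y := d))(x := (\<rho>(y := d)) t) = \<rho>(x := \<rho> t, y := d)" for d
      using * by (auto simp: fun_eq_iff)
    hence "frc a (\<rho>(y := d)) (subst A x t) = frc a (\<rho>(x := \<rho> t, y := d)) A" for a d
      using All.IH[OF *(2), of a "\<rho>(y := d)"] by metis
    thus ?thesis unfolding subst.simps if_not_P[OF *(3)] frc.simps by simp
  next
    case False thus ?thesis by (metis subst_nonfree frc_cong fun_upd_other)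
  qed
next
  case (Ex y A)
  show ?case
  proof (cases "x \<in> fv (Ex y A)")
    case True
    hence *: "y \<noteq> t" "substitutable t x A" "y \<noteq> x" using Ex.prems by auto
    have "(\<rho>(y := d))(x := (\<rho>(y := d)) t) = \<rho>(x := \<rho> t, y := d)" for d
      using * by (auto simp: fun_eq_iff)
    hence "frc a (\<rho>(y := d)) (subst A x t) = frc a (\<rho>(x := \<rho> t, y := d)) A" for a d
      using Ex.IH[OF *(2), of a "\<rho>(y := d)"] by metis
    thus ?thesis unfolding subst.simps if_not_P[OF *(3)] frc.simps by simp
  next
    case False thus ?thesis by (metis subst_nonfree frc_cong fun_upd_other)
  qed
next
  case (BAll y s A)
  show ?case
  proof (cases "x \<in> fv (BAll y s A)")
    case True
    hence *: "y \<noteq> t" "substitutable t x A" "y \<noteq> x" using BAll.prems by auto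
    have "(\<rho>(y := d))(x := (\<rho>(y := d)) t) = \<rho>(x := \<rho> t, y := d)" for d
      using * by (auto simp: fun_eq_iff)
    hence "frc a (\<rho>(y := d)) (subst A x t) = frc a (\<rho>(x := \<rho> t, y := d)) A" for a d
      using BAll.IH[OF *(2), of a "\<rho>(y := d)"] by metis
    moreover have "(\<rho>(y := d)) (sw x t s) = (\<rho>(x := \<rho> t, y := d)) s" for d using * by (simp add: sw_def)
    ultimately show ?thesis unfolding subst.simps if_not_P[OF *(3)] frc.simps by simp
  next
    case False thus ?thesis by (metis subst_nonfree frc_cong fun_upd_other)
  qed
next
  case (BEx y s A)
  show ?case
  proof (cases "x \<in> fv (BEx y s A)")
    case True
    hence *: "y \<noteq> t" "substitutable t x A" "y \<noteq> x" using BEx.prems by auto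
    have "(\<rho>(y := d))(x := (\<rho>(y := d)) t) = \<rho>(x := \<rho> t, y := d)" for d
      using * by (auto simp: fun_eq_iff)
    hence "frc a (\<rho>(y := d)) (subst A x t) = frc a (\<rho>(x := \<rho> t, y := d)) A" for a d
      using BEx.IH[OF *(2), of a "\<rho>(y := d)"] by metis
    moreover have "(\<rho>(y := d)) (sw x t s) = (\<rho>(x := \<rho> t, y := d)) s" for d using * by (simp add: sw_def)
    ultimately show ?thesis unfolding subst.simps if_not_P[OF *(3)] frc.simps by simp
  next
    case False thus ?thesis by (metis subst_nonfree frc_cong fun_upd_other)
  qed
qed (auto simp: sw_def)

lemma frc_BAll_iff: "frc a \<rho> (BAll x s A) \<longleftrightarrow> frc a \<rho> (All x (Imp (Mem x s) A))"
proof
  assume h: "frc a \<rho> (BAll x s A)"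
  show "frc a \<rho> (All x (Imp (Mem x s) A))"
    unfolding frc.simps fun_upd_same
  proof (intro HOL.allI impI ballI)
    fix b d c assume b: "le a b" "d \<in> D b" "le b c" "cl (\<lambda>b. mem b d ((\<rho>(x := d)) s)) c"
    have "le a c" "d \<in> D c" using le_trans[OF b(1,3)] D_mono[OF b(3)] b(2) by auto
    thus "frc c (\<rho>(x := d)) A" using h b(4) unfolding frc.simps by blast
  qed
next
  assume h: "frc a \<rho> (All x (Imp (Mem x s) A))"
  show "frc a \<rho> (BAll x s A)"
    using h le_refl(2) unfolding frc.simps fun_upd_same by blast
qed

lemma range_upd: "range \<rho> \<subseteq> D a \<Longrightarrow> d \<in> D a \<Longrightarrow> range (\<rho>(x := d)) \<subseteq> D a"
  by auto

lemma frc_ImpI: "(\<And>b. le a b \<Longrightarrow> frc b \<rho> A \<Longrightarrow> frc b \<rho> B) \<Longrightarrow> frc a \<rho> (Imp A B)"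
  by simp

lemma range_mono: "range \<rho> \<subseteq> D a \<Longrightarrow> le a b \<Longrightarrow> range \<rho> \<subseteq> D b"
  using D_mono by blast

theorem soundness:
  assumes "prov T A" and T: "\<And>B a \<rho>. B \<in> T \<Longrightarrow> le a a \<Longrightarrow> range \<rho> \<subseteq> D a \<Longrightarrow> frc a \<rho> B"
  shows "le a a \<Longrightarrow> range \<rho> \<subseteq> D a \<Longrightarrow> frc a \<rho> A"
  using assms(1)
proof (induction arbitrary: a \<rho> rule: prov.induct)
  case (hyp A) thus ?case using T by blast
next
  case (ax_K A B)
  show ?case using frc_mono by auto
next
  case (ax_S A B C)
  show ?case
  proof (intro frc_ImpI)
    fix b1 b2 b3
    assume h: "frc b1 \<rho> (Imp A (Imp B C))" "le b1 b2" "frc b2 \<rho> (Imp A B)" "le b2 b3" "frc b3 \<rho> A"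
    have "le b1 b3" "le b3 b3" using h le_trans le_refl by blast+
    thus "frc b3 \<rho> C" using h by auto
  qed
next
  case (ax_conjI A B)
  show ?case using frc_mono by auto
next
  case (ax_disjI1 A B)
  show ?case using frc_mono by (auto intro!: clI)
next
  case (ax_disjI2 B A)
  show ?case using frc_mono by (auto intro!: clI)
next
  case (ax_disjE A C B)
  show ?case
  proof (intro frc_ImpI)
    fix b1 b2 b3
    assume h: "frc b1 \<rho> (Imp A C)" "le b1 b2" "frc b2 \<rho> (Imp B C)" "le b2 b3" "frc b3 \<rho> (Disj A B)"
    have "le b1 b3" "le b3 b3" using h le_trans le_refl by blast+
    have "cl (\<lambda>b. frc b \<rho> C) b3"
    proof (rule cl_imp)
      show "cl (\<lambda>b. frc b \<rho> A \<or> frc b \<rho> B) b3" using h by simp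
      fix b assume b: "le b3 b" "frc b \<rho> A \<or> frc b \<rho> B"
      have "le b1 b" "le b2 b" using b h \<open>le b1 b3\<close> le_trans by blast+
      thus "frc b \<rho> C" using b h by auto
    qed
    thus "frc b3 \<rho> C" using frc_closed \<open>le b3 b3\<close> by blast
  qed
next
  case (ax_efq A)
  show ?case
  proof (rule frc_ImpI)
    fix b assume b: "le a b" "frc b \<rho> Bot"
    have "cl (\<lambda>b. frc b \<rho> A) b" by (rule cl_imp[of "\<lambda>_. False"]) (use b in auto)
    thus "frc b \<rho> A" using frc_closed le_refl b by blast
  qed
next
  case (ax_allE t x A)
  show ?case
  proof (rule frc_ImpI)
    fix b assume b: "le a b" "frc b \<rho> (All x A)"
    have "\<rho> t \<in> D b" using ax_allE.prems b D_mono by blast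
    thus "frc b \<rho> (subst A x t)" using b ax_allE.hyps le_refl(2)[OF b(1)] by (simp add: frc_subst)
  qed
next
  case (ax_exI t x A)
  show ?case
  proof (rule frc_ImpI)
    fix b assume b: "le a b" "frc b \<rho> (subst A x t)"
    have "\<rho> t \<in> D b" using ax_exI.prems b D_mono by blast
    moreover have "frc b (\<rho>(x := \<rho> t)) A" using b ax_exI.hyps by (simp add: frc_subst)
    ultimately show "frc b \<rho> (Ex x A)" using D_mono frc_mono unfolding frc.simps by (blast intro: clI)
  qed
next
  case (ax_refl x)
  show ?case using ax_refl D_mono le_refl eq_refl by (auto intro!: clI eq_refl)
next
  case (ax_eq_mem1 x y z)
  show ?case
  proof (intro frc_ImpI)
    fix b1 b2 assume h: "le a b1" "frc b1 \<rho> (Eq x y)" "le b1 b2" "frc b2 \<rho> (Mem x z)"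
    show "frc b2 \<rho> (Mem y z)" unfolding frc.simps
    proof (rule cl_bind[OF cl_mono[OF h(2)[unfolded frc.simps] h(3)]])
      fix b3 assume b3: "le b2 b3" "eq b3 (\<rho> x) (\<rho> y)"
      show "cl (\<lambda>b. mem b (\<rho> y) (\<rho> z)) b3"
      proof (rule cl_imp[OF cl_mono[OF h(4)[unfolded frc.simps] b3(1)]])
        fix b4 assume b4: "le b3 b4" "mem b4 (\<rho> x) (\<rho> z)"
        have "le a b4" using h(1,3) b3(1) b4(1) le_trans by blast
        hence "le b4 b4" "\<rho> x \<in> D b4" "\<rho> y \<in> D b4" "\<rho> z \<in> D b4"
          using le_refl(2)[OF \<open>le a b4\<close>] range_mono[OF ax_eq_mem1.prems(2) \<open>le a b4\<close>] by auto
        thus "mem b4 (\<rho> y) (\<rho> z)" using eq_mem1[OF eq_mono[OF b4(1) b3(2)] b4(2)] by simp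
      qed
    qed
  qed
next
  case (ax_eq_mem2 x y z)
  show ?case
  proof (intro frc_ImpI)
    fix b1 b2 assume h: "le a b1" "frc b1 \<rho> (Eq x y)" "le b1 b2" "frc b2 \<rho> (Mem z x)"
    show "frc b2 \<rho> (Mem z y)" unfolding frc.simps
    proof (rule cl_bind[OF cl_mono[OF h(2)[unfolded frc.simps] h(3)]])
      fix b3 assume b3: "le b2 b3" "eq b3 (\<rho> x) (\<rho> y)"
      show "cl (\<lambda>b. mem b (\<rho> z) (\<rho> y)) b3"
      proof (rule cl_imp[OF cl_mono[OF h(4)[unfolded frc.simps] b3(1)]])
        fix b4 assume b4: "le b3 b4" "mem b4 (\<rho> z) (\<rho> x)"
        have "le a b4" using h(1,3) b3(1) b4(1) le_trans by blast
        hence "le b4 b4" "\<rho> x \<in> D b4" "\<rho> y \<in> D b4" "\<rho> z \<in> D b4"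
          using le_refl(2)[OF \<open>le a b4\<close>] range_mono[OF ax_eq_mem2.prems(2) \<open>le a b4\<close>] by auto
        thus "mem b4 (\<rho> z) (\<rho> y)" using eq_mem2[OF eq_mono[OF b4(1) b3(2)] b4(2)] by simp
      qed
    qed
  qed
next
  case (ax_eq_eq x y z)
  show ?case
  proof (intro frc_ImpI)
    fix b1 b2 assume h: "le a b1" "frc b1 \<rho> (Eq x y)" "le b1 b2" "frc b2 \<rho> (Eq x z)"
    show "frc b2 \<rho> (Eq y z)" unfolding frc.simps
    proof (rule cl_bind[OF cl_mono[OF h(2)[unfolded frc.simps] h(3)]])
      fix b3 assume b3: "le b2 b3" "eq b3 (\<rho> x) (\<rho> y)"
      show "cl (\<lambda>b. eq b (\<rho> y) (\<rho> z)) b3"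
      proof (rule cl_imp[OF cl_mono[OF h(4)[unfolded frc.simps] b3(1)]])
        fix b4 assume b4: "le b3 b4" "eq b4 (\<rho> x) (\<rho> z)"
        have "le a b4" using h(1,3) b3(1) b4(1) le_trans by blast
        hence "le b4 b4" "\<rho> x \<in> D b4" "\<rho> y \<in> D b4" "\<rho> z \<in> D b4"
          using le_refl(2)[OF \<open>le a b4\<close>] range_mono[OF ax_eq_eq.prems(2) \<open>le a b4\<close>] by auto
        thus "eq b4 (\<rho> y) (\<rho> z)" using eq_eq[OF eq_mono[OF b4(1) b3(2)] b4(2)] by simp
      qed
    qed
  qed
next
  case (ax_ball1 x s A)
  show ?case by (rule frc_ImpI) (simp only: frc_BAll_iff)
next
  case (ax_ball2 x s A)
  show ?case by (rule frc_ImpI) (simp only: frc_BAll_iff)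
next
  case (ax_bex1 x s A)
  show ?case by simp
next
  case (ax_bex2 x s A)
  show ?case by simp
next
  case (mp A B)
  show ?case using mp.IH(1)[OF mp.prems] mp.IH(2)[OF mp.prems] mp.prems(1) by simp
next
  case (allI B A x)
  show ?case
  proof (rule frc_ImpI)
    fix b assume b: "le a b" "frc b \<rho> B"
    show "frc b \<rho> (All x A)" unfolding frc.simps
    proof (intro HOL.allI impI ballI)
      fix b' d assume b': "le b b'" "d \<in> D b'"
      have "le a b'" using b b' le_trans by blast
      hence r: "le b' b'" "range (\<rho>(x := d)) \<subseteq> D b'"
        using le_refl range_upd[OF range_mono[OF allI.prems(2)] b'(2)] by blast+
      have "frc b' \<rho> B" using b b' frc_mono by blast
      hence "frc b' (\<rho>(x := d)) B" using frc_cong[of B \<rho> "\<rho>(x := d)"] allI.hyps(2) by auto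
      thus "frc b' (\<rho>(x := d)) A" using allI.IH[OF r] r(1) unfolding frc.simps by blast
    qed
  qed
next
  case (exE A B x)
  show ?case
  proof (rule frc_ImpI)
    fix b assume b: "le a b" "frc b \<rho> (Ex x A)"
    have "cl (\<lambda>b. frc b \<rho> B) b"
    proof (rule cl_imp[OF b(2)[unfolded frc.simps]])
      fix b' assume b': "le b b'" "\<exists>d\<in>D b'. frc b' (\<rho>(x := d)) A"
      then obtain d where d: "d \<in> D b'" "frc b' (\<rho>(x := d)) A" by blast
      have "le a b'" using b b' le_trans by blast
      hence r: "le b' b'" "range (\<rho>(x := d)) \<subseteq> D b'"
        using le_refl range_upd[OF range_mono[OF exE.prems(2)] d(1)] by blast+
      have "frc b' (\<rho>(x := d)) B" using exE.IH[OF r] r(1) d(2) unfolding frc.simps by blast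
      thus "frc b' \<rho> B" using frc_cong[of B \<rho> "\<rho>(x := d)"] exE.hyps(2) by auto
    qed
    thus "frc b \<rho> B" using frc_closed le_refl b by blast
  qed
qed auto

end

section \<open>Bounded formulas, renaming and equality in Kripke models\<close>

inductive_cases Delta0_ConjE: "Delta0 (Conj A B)"
inductive_cases Delta0_DisjE: "Delta0 (Disj A B)"
inductive_cases Delta0_ImpE: "Delta0 (Imp A B)"
inductive_cases Delta0_AllE: "Delta0 (All x A)"
inductive_cases Delta0_ExE: "Delta0 (Ex x A)"
inductive_cases Delta0_BAllE: "Delta0 (BAll x s A)"
inductive_cases Delta0_BExE: "Delta0 (BEx x s A)"
lemmas Delta0_elims = Delta0_ConjE Delta0_DisjE Delta0_ImpE Delta0_AllE Delta0_ExE Delta0_BAllE Delta0_BExE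

lemma Delta0_ren: "Delta0 A \<Longrightarrow> capture_free f b \<Longrightarrow> Delta0 (ren f b A)"
proof (induction A arbitrary: f)
  case (BAll x s A)
  thus ?case by (auto intro!: Delta0.intros capture_free_upd elim!: Delta0_elims)
      (metis capture_free_def)
next
  case (BEx x s A)
  thus ?case by (auto intro!: Delta0.intros capture_free_upd elim!: Delta0_elims)
      (metis capture_free_def)
qed (auto intro: Delta0.intros elim: Delta0_elims)

lemma fresh_var: "finite S \<Longrightarrow> \<exists>x::nat. x \<notin> S"
  using ex_new_if_finite infinite_UNIV_nat by blast

context kripke
begin

lemma sem_cong: "\<forall>x\<in>fv A. \<rho> x = \<sigma> x \<Longrightarrow> sem w \<rho> A = sem w \<sigma> A"
proof (induction A arbitrary: \<rho> \<sigma> w)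
  case (Conj A B)
  have "sem w \<rho> A = sem w \<sigma> A" "sem w \<rho> B = sem w \<sigma> B" for w using Conj by auto
  thus ?case by simp
next
  case (Disj A B)
  have "sem w \<rho> A = sem w \<sigma> A" "sem w \<rho> B = sem w \<sigma> B" for w using Disj by auto
  thus ?case by simp
next
  case (Imp A B)
  have "sem w \<rho> A = sem w \<sigma> A" "sem w \<rho> B = sem w \<sigma> B" for w using Imp by auto
  thus ?case by simp
next
  case (All x A)
  have "sem w (\<rho>(x := d)) A = sem w (\<sigma>(x := d)) A" for w d using All.prems by (intro All.IH) auto
  thus ?case by simp
next
  case (Ex x A)
  have "sem w (\<rho>(x := d)) A = sem w (\<sigma>(x := d)) A" for w d using Ex.prems by (intro Ex.IH) auto
  thus ?case by simp
next
  case (BAll x s A)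
  have "sem w (\<rho>(x := d)) A = sem w (\<sigma>(x := d)) A" "(\<rho>(x := d)) s = (\<sigma>(x := d)) s" for w d
    using BAll.prems by (auto intro!: BAll.IH)
  thus ?case by (simp only: sem.simps)
next
  case (BEx x s A)
  have "sem w (\<rho>(x := d)) A = sem w (\<sigma>(x := d)) A" "(\<rho>(x := d)) s = (\<sigma>(x := d)) s" for w d
    using BEx.prems by (auto intro!: BEx.IH)
  thus ?case by (simp only: sem.simps)
qed auto

lemma sem_ren: "capture_free f b \<Longrightarrow> sem w \<rho> (ren f b A) = sem w (\<rho> \<circ> f) A"
proof (induction A arbitrary: f \<rho> w)
  case (All x A)
  have "(\<rho>(b x := d)) \<circ> (f(x := b x)) = (\<rho> \<circ> f)(x := d)" for d
    using All.prems by (auto simp: capture_free_def fun_eq_iff)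
  thus ?case using All.IH[OF capture_free_upd[OF All.prems]] unfolding ren.simps sem.simps by metis
next
  case (Ex x A)
  have "(\<rho>(b x := d)) \<circ> (f(x := b x)) = (\<rho> \<circ> f)(x := d)" for d
    using Ex.prems by (auto simp: capture_free_def fun_eq_iff)
  thus ?case using Ex.IH[OF capture_free_upd[OF Ex.prems]] unfolding ren.simps sem.simps by metis
next
  case (BAll x s A)
  have *: "(\<rho>(b x := d)) \<circ> (f(x := b x)) = (\<rho> \<circ> f)(x := d)" for d
    using BAll.prems by (auto simp: capture_free_def fun_eq_iff)
  hence "(\<rho>(b x := d)) ((f(x := b x)) s) = ((\<rho> \<circ> f)(x := d)) s" for d by (metis comp_apply)
  moreover have "sem w (\<rho>(b x := d)) (ren (f(x := b x)) b A) = sem w ((\<rho> \<circ> f)(x := d)) A" for w d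
    using BAll.IH[OF capture_free_upd[OF BAll.prems]] * by metis
  ultimately show ?case by (simp only: ren.simps sem.simps)
next
  case (BEx x s A)
  have *: "(\<rho>(b x := d)) \<circ> (f(x := b x)) = (\<rho> \<circ> f)(x := d)" for d
    using BEx.prems by (auto simp: capture_free_def fun_eq_iff)
  hence "(\<rho>(b x := d)) ((f(x := b x)) s) = ((\<rho> \<circ> f)(x := d)) s" for d by (metis comp_apply)
  moreover have "sem w (\<rho>(b x := d)) (ren (f(x := b x)) b A) = sem w ((\<rho> \<circ> f)(x := d)) A" for w d
    using BEx.IH[OF capture_free_upd[OF BEx.prems]] * by metis
  ultimately show ?case by (simp only: ren.simps sem.simps)
qed auto

text \<open>The map \<open>f\<close> may identify variables. Bound variables are shifted beyond the
  finitely many names that it produces on the free variables of \<open>A\<close>, so nothing is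
  captured.\<close>

lemma ex_rename:
  obtains A' where "Delta0 A \<Longrightarrow> Delta0 A'" "fv A' = f ` fv A" "\<And>w \<rho>. sem w \<rho> A' = sem w (\<rho> \<circ> f) A"
proof -
  \<comment> \<open>The default 0 makes the range finite; outside the free variables of
    \<open>A\<close> the value has no effect on the meaning.\<close>
  define g where "g z = (if z \<in> fv A then f z else 0)" for z
  have "range g \<subseteq> insert 0 (f ` fv A)" by (auto simp: g_def)
  hence "finite (range g)" using finite_fv finite_subset by blast
  then obtain N where N: "\<forall>z. g z < N" by (auto simp: finite_nat_set_iff_bounded)
  define b where "b x = N + x" for x
  have cf: "capture_free g b" using N by (auto simp: capture_free_def inj_def b_def) (metis not_add_less1)
  show ?thesis
  proof (rule that[of "ren g b A"])
    show "Delta0 A \<Longrightarrow> Delta0 (ren g b A)" using Delta0_ren cf by blast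
    show "fv (ren g b A) = f ` fv A" unfolding fv_ren_capture_free[OF cf] by (auto simp: g_def)
    show "sem w \<rho> (ren g b A) = sem w (\<rho> \<circ> f) A" for w \<rho>
      unfolding sem_ren[OF cf] by (rule sem_cong) (simp add: g_def)
  qed
qed

lemma sem_subst: "substitutable t x A \<Longrightarrow> sem w \<rho> (subst A x t) = sem w (\<rho>(x := \<rho> t)) A"
proof (induction A arbitrary: \<rho> w)
  case (All y A)
  show ?case
  proof (cases "x \<in> fv (All y A)")
    case True
    hence *: "y \<noteq> t" "substitutable t x A" "y \<noteq> x" using All.prems by auto
    have "(\<rho>(y := d))(x := (\<rho>(y := d)) t) = \<rho>(x := \<rho> t, y := d)" for d
      using * by (auto simp: fun_eq_iff)
    hence "sem w (\<rho>(y := d)) (subst A x t) = sem w (\<rho>(x := \<rho> t, y := d)) A" for w d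
      using All.IH[OF *(2), of w "\<rho>(y := d)"] by metis
    thus ?thesis unfolding subst.simps if_not_P[OF *(3)] sem.simps by simp
  next
    case False thus ?thesis by (metis subst_nonfree sem_cong fun_upd_other)
  qed
next
  case (Ex y A)
  show ?case
  proof (cases "x \<in> fv (Ex y A)")
    case True
    hence *: "y \<noteq> t" "substitutable t x A" "y \<noteq> x" using Ex.prems by auto
    have "(\<rho>(y := d))(x := (\<rho>(y := d)) t) = \<rho>(x := \<rho> t, y := d)" for d
      using * by (auto simp: fun_eq_iff)
    hence "sem w (\<rho>(y := d)) (subst A x t) = sem w (\<rho>(x := \<rho> t, y := d)) A" for w d
      using Ex.IH[OF *(2), of w "\<rho>(y := d)"] by metis
    thus ?thesis unfolding subst.simps if_not_P[OF *(3)] sem.simps by simp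
  next
    case False thus ?thesis by (metis subst_nonfree sem_cong fun_upd_other)
  qed
next
  case (BAll y s A)
  show ?case
  proof (cases "x \<in> fv (BAll y s A)")
    case True
    hence *: "y \<noteq> t" "substitutable t x A" "y \<noteq> x" using BAll.prems by auto
    have "(\<rho>(y := d))(x := (\<rho>(y := d)) t) = \<rho>(x := \<rho> t, y := d)" for d
      using * by (auto simp: fun_eq_iff)
    hence "sem w (\<rho>(y := d)) (subst A x t) = sem w (\<rho>(x := \<rho> t, y := d)) A" for w d
      using BAll.IH[OF *(2), of w "\<rho>(y := d)"] by metis
    moreover have "(\<rho>(y := d)) (sw x t s) = (\<rho>(x := \<rho> t, y := d)) s" for d using * by (simp add: sw_def)
    ultimately show ?thesis unfolding subst.simps if_not_P[OF *(3)] sem.simps by simp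
  next
    case False thus ?thesis by (metis subst_nonfree sem_cong fun_upd_other)
  qed
next
  case (BEx y s A)
  show ?case
  proof (cases "x \<in> fv (BEx y s A)")
    case True
    hence *: "y \<noteq> t" "substitutable t x A" "y \<noteq> x" using BEx.prems by auto
    have "(\<rho>(y := d))(x := (\<rho>(y := d)) t) = \<rho>(x := \<rho> t, y := d)" for d
      using * by (auto simp: fun_eq_iff)
    hence "sem w (\<rho>(y := d)) (subst A x t) = sem w (\<rho>(x := \<rho> t, y := d)) A" for w d
      using BEx.IH[OF *(2), of w "\<rho>(y := d)"] by metis
    moreover have "(\<rho>(y := d)) (sw x t s) = (\<rho>(x := \<rho> t, y := d)) s" for d using * by (simp add: sw_def)
    ultimately show ?thesis unfolding subst.simps if_not_P[OF *(3)] sem.simps by simp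
  next
    case False thus ?thesis by (metis subst_nonfree sem_cong fun_upd_other)
  qed
qed (auto simp: sw_def)

lemma eq_sym: "eq w x y \<Longrightarrow> le w w \<Longrightarrow> x \<in> D w \<Longrightarrow> y \<in> D w \<Longrightarrow> eq w y x"
  using eq_eq eq_refl by blast

lemma eq_trans: "eq w x y \<Longrightarrow> eq w y z \<Longrightarrow> le w w \<Longrightarrow> x \<in> D w \<Longrightarrow> y \<in> D w \<Longrightarrow> z \<in> D w \<Longrightarrow> eq w x z"
  using eq_eq eq_sym by blast

lemma sem_mp: "sem w \<rho> (Imp A B) \<Longrightarrow> le w w \<Longrightarrow> sem w \<rho> A \<Longrightarrow> sem w \<rho> B"
  by simp

lemma env_mono: "range \<rho> \<subseteq> D w \<Longrightarrow> le w v \<Longrightarrow> range \<rho> \<subseteq> D v"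
  using D_mono by blast

lemma env_upd: "range \<rho> \<subseteq> D w \<Longrightarrow> d \<in> D w \<Longrightarrow> range (\<rho>(x := d)) \<subseteq> D w"
  by auto

definition env_eq :: "'w \<Rightarrow> (nat \<Rightarrow> 'd) \<Rightarrow> (nat \<Rightarrow> 'd) \<Rightarrow> bool" where
  "env_eq w \<rho> \<sigma> \<longleftrightarrow> le w w \<and> range \<rho> \<subseteq> D w \<and> range \<sigma> \<subseteq> D w \<and> (\<forall>x. eq w (\<rho> x) (\<sigma> x))"

lemma env_eq_mono: "env_eq w \<rho> \<sigma> \<Longrightarrow> le w v \<Longrightarrow> env_eq v \<rho> \<sigma>"
  using le_refl(2)[of w v] env_mono[of \<rho> w v] env_mono[of \<sigma> w v] eq_mono[of w v] unfolding env_eq_def by simp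

lemma env_eq_upd: "env_eq w \<rho> \<sigma> \<Longrightarrow> d \<in> D w \<Longrightarrow> env_eq w (\<rho>(x := d)) (\<sigma>(x := d))"
  unfolding env_eq_def by (auto intro: eq_refl)

lemma env_eq_Mem: "env_eq w \<rho> \<sigma> \<Longrightarrow> mem w (\<rho> x) (\<rho> y) \<longleftrightarrow> mem w (\<sigma> x) (\<sigma> y)"
  unfolding env_eq_def by (meson eq_mem1 eq_mem2 eq_sym range_subsetD)

lemma env_eq_Eq: "env_eq w \<rho> \<sigma> \<Longrightarrow> eq w (\<rho> x) (\<rho> y) \<longleftrightarrow> eq w (\<sigma> x) (\<sigma> y)"
  unfolding env_eq_def by (meson eq_eq eq_sym range_subsetD)

text \<open>Leibniz's law, required because \<open>eq\<close> is a congruence: the components of an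
  ordered pair, for instance, are recovered only up to \<open>eq\<close>.\<close>

lemma sem_eq_cong: "env_eq w \<rho> \<sigma> \<Longrightarrow> sem w \<rho> A \<longleftrightarrow> sem w \<sigma> A"
proof (induction A arbitrary: w \<rho> \<sigma>)
  case (Imp A B)
  have "sem v \<rho> A = sem v \<sigma> A" "sem v \<rho> B = sem v \<sigma> B" if "le w v" for v
    using Imp.IH env_eq_mono[OF Imp.prems that] by blast+
  thus ?case by auto
next
  case (All x A)
  have "sem v (\<rho>(x := d)) A = sem v (\<sigma>(x := d)) A" if "le w v" "d \<in> D v" for v d
    using All.IH env_eq_upd[OF env_eq_mono[OF All.prems that(1)] that(2)] by blast
  thus ?case by auto
next
  case (Ex x A)
  have "sem w (\<rho>(x := d)) A = sem w (\<sigma>(x := d)) A" if "d \<in> D w" for d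
    using Ex.IH env_eq_upd[OF Ex.prems that] by blast
  thus ?case by auto
next
  case (BAll x s A)
  have "sem v (\<rho>(x := d)) A = sem v (\<sigma>(x := d)) A"
    "mem v d ((\<rho>(x := d)) s) = mem v d ((\<sigma>(x := d)) s)" if "le w v" "d \<in> D v" for v d
  proof -
    have e: "env_eq v (\<rho>(x := d)) (\<sigma>(x := d))" by (rule env_eq_upd[OF env_eq_mono[OF BAll.prems that(1)] that(2)])
    show "sem v (\<rho>(x := d)) A = sem v (\<sigma>(x := d)) A" using BAll.IH e by blast
    show "mem v d ((\<rho>(x := d)) s) = mem v d ((\<sigma>(x := d)) s)"
      using env_eq_Mem[OF e, of x s] by simp
  qed
  thus ?case unfolding sem.simps by blast
next
  case (BEx x s A)
  have "sem w (\<rho>(x := d)) A = sem w (\<sigma>(x := d)) A"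
    "mem w d ((\<rho>(x := d)) s) = mem w d ((\<sigma>(x := d)) s)" if "d \<in> D w" for d
  proof -
    have e: "env_eq w (\<rho>(x := d)) (\<sigma>(x := d))" by (rule env_eq_upd[OF BEx.prems that])
    show "sem w (\<rho>(x := d)) A = sem w (\<sigma>(x := d)) A" using BEx.IH e by blast
    show "mem w d ((\<rho>(x := d)) s) = mem w d ((\<sigma>(x := d)) s)"
      using env_eq_Mem[OF e, of x s] by simp
  qed
  thus ?case unfolding sem.simps by blast
next
  case (Mem x y) thus ?case using env_eq_Mem by simp
next
  case (Eq x y) thus ?case using env_eq_Eq by simp
qed auto

end

section \<open>Kripke models of IKP\<close>

lemma Delta0_Sep_IKP:
  assumes "Delta0 A" "distinct [a, b, x]" "b \<notin> fv A"
  shows "All a (Ex b (All x (Iff (Mem x b) (Conj (Mem x a) A)))) \<in> IKP"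
proof -
  have "All a (Ex b (All x (Iff (Mem x b) (Conj (Mem x a) A)))) \<in> Delta0_Sep"
    unfolding Delta0_Sep_def using assms by blast
  thus ?thesis by (simp add: IKP_def)
qed

lemma Delta0_Coll_IKP:
  assumes "Delta0 A" "distinct [a, b, x, y]" "b \<notin> fv A"
  shows "Imp (BAll x a (Ex y A)) (Ex b (BAll x a (BEx y b A))) \<in> IKP"
proof -
  have "Imp (BAll x a (Ex y A)) (Ex b (BAll x a (BEx y b A))) \<in> Delta0_Coll"
    unfolding Delta0_Coll_def using assms by blast
  thus ?thesis by (simp add: IKP_def)
qed

lemma Set_Ind_IKP:
  assumes "x \<noteq> a" "x \<notin> fv A" "substitutable x a A"
  shows "Imp (All a (Imp (BAll x a (subst A a x)) A)) (All a A) \<in> IKP"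
proof -
  have "Imp (All a (Imp (BAll x a (subst A a x)) A)) (All a A) \<in> Set_Ind"
    unfolding Set_Ind_def using assms by blast
  thus ?thesis by (simp add: IKP_def)
qed

locale kripke_ikp = kripke +
  assumes IKP: "B \<in> IKP \<Longrightarrow> valid B"
begin

lemma IKP_sem: "B \<in> IKP \<Longrightarrow> le w w \<Longrightarrow> range \<rho> \<subseteq> D w \<Longrightarrow> sem w \<rho> B"
  using IKP unfolding valid_def by blast

lemma separation:
  assumes A: "Delta0 A" and w: "le w w" "range \<rho> \<subseteq> D w" "s \<in> D w"
  obtains b where "b \<in> D w"
    "\<And>v d. le w v \<Longrightarrow> d \<in> D v \<Longrightarrow> mem v d b \<longleftrightarrow> mem v d s \<and> sem v (\<rho>(x := d)) A"
proof -
  obtain a where a: "a \<notin> insert x (vars A)"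
    using fresh_var[of "insert x (vars A)"] by (auto simp: finite_vars)
  obtain b where b: "b \<notin> insert a (insert x (vars A))"
    using fresh_var[of "insert a (insert x (vars A))"] by (auto simp: finite_vars)
  have "All a (Ex b (All x (Iff (Mem x b) (Conj (Mem x a) A)))) \<in> IKP"
    by (rule Delta0_Sep_IKP[OF A]) (use a b nonvar_nonfree[of b A] in auto)
  from IKP_sem[OF this w(1,2)]
  have "\<exists>e\<in>D w. sem w (\<rho>(a := s, b := e)) (All x (Iff (Mem x b) (Conj (Mem x a) A)))"
    unfolding sem.simps(7)[of _ _ a] sem.simps(8) using w(1,3) by blast
  then obtain e where e: "e \<in> D w"
    "sem w (\<rho>(a := s, b := e)) (All x (Iff (Mem x b) (Conj (Mem x a) A)))" by blast
  show ?thesis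
  proof (rule that[OF e(1)])
    fix v d assume v: "le w v" "d \<in> D v"
    hence "le v v" using le_refl by blast
    moreover have "sem v (\<rho>(a := s, b := e, x := d)) A \<longleftrightarrow> sem v (\<rho>(x := d)) A"
      using a b nonvar_nonfree[of _ A] by (intro sem_cong) auto
    moreover have "sem v (\<rho>(a := s, b := e, x := d)) (Iff (Mem x b) (Conj (Mem x a) A))"
      using e(2) v unfolding sem.simps(7) by blast
    hence "sem v (\<rho>(a := s, b := e, x := d)) (Mem x b) \<longleftrightarrow>
        sem v (\<rho>(a := s, b := e, x := d)) (Conj (Mem x a) A)"
      using sem_mp \<open>le v v\<close> unfolding Iff_def sem.simps(4)[of _ _ "Imp _ _"] by blast
    ultimately show "mem v d e \<longleftrightarrow> mem v d s \<and> sem v (\<rho>(x := d)) A" using a b by simp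
  qed
qed

text \<open>The premise is asked for at all later worlds, as this is how the bounded universal of
  the axiom is read; in return a single \<open>b\<close> serves all later worlds.\<close>

lemma collection:
  assumes A: "Delta0 A" and xy: "x \<noteq> y" and w: "le w w" "range \<rho> \<subseteq> D w" "s \<in> D w"
    and h: "\<And>v d. le w v \<Longrightarrow> d \<in> D v \<Longrightarrow> mem v d s \<Longrightarrow> \<exists>e\<in>D v. sem v (\<rho>(x := d, y := e)) A"
  obtains b where "b \<in> D w"
    "\<And>v d. le w v \<Longrightarrow> d \<in> D v \<Longrightarrow> mem v d s \<Longrightarrow> \<exists>e\<in>D v. mem v e b \<and> sem v (\<rho>(x := d, y := e)) A"
proof -
  obtain a where a: "a \<notin> insert y (insert x (vars A))"
    using fresh_var[of "insert y (insert x (vars A))"] by (auto simp: finite_vars)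
  obtain b where b: "b \<notin> insert a (insert y (insert x (vars A)))"
    using fresh_var[of "insert a (insert y (insert x (vars A)))"] by (auto simp: finite_vars)
  have "Imp (BAll x a (Ex y A)) (Ex b (BAll x a (BEx y b A))) \<in> IKP"
    by (rule Delta0_Coll_IKP[OF A]) (use a b xy nonvar_nonfree[of b A] in auto)
  note i = sem_mp[OF IKP_sem[OF this w(1) env_upd[OF w(2,3), of a]] w(1)]
  have c: "sem v (\<rho>(a := s, x := d, y := e)) A \<longleftrightarrow> sem v (\<rho>(x := d, y := e)) A"
    "sem v (\<rho>(a := s, b := f, x := d, y := e)) A \<longleftrightarrow> sem v (\<rho>(x := d, y := e)) A" for v d e f
    using a b nonvar_nonfree[of _ A] by (intro sem_cong; auto)+
  have "sem w (\<rho>(a := s)) (BAll x a (Ex y A))"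
    unfolding sem.simps c using h a by auto
  from i[OF this] obtain f where f: "f \<in> D w" "sem w (\<rho>(a := s, b := f)) (BAll x a (BEx y b A))"
    unfolding sem.simps(8) by blast
  show ?thesis
  proof (rule that[OF f(1)])
    fix v d assume "le w v" "d \<in> D v" "mem v d s"
    thus "\<exists>e\<in>D v. mem v e f \<and> sem v (\<rho>(x := d, y := e)) A"
      using f(2) a b unfolding sem.simps c by auto
  qed
qed

lemma ex_pair:
  assumes w: "le w w" "a \<in> D w" "b \<in> D w"
  shows "\<exists>c\<in>D w. mem w a c \<and> mem w b c"
proof -
  have "range (\<lambda>_. a) \<subseteq> D w" using w by auto
  from IKP_sem[OF _ w(1) this, of Pairing] show ?thesis
    using w unfolding IKP_def Pairing_def by (auto simp: fun_upd_def)
qed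

lemma ex_union:
  assumes w: "le w w" "a \<in> D w"
  shows "\<exists>b\<in>D w. \<forall>v x y. le w v \<longrightarrow> x \<in> D v \<longrightarrow> y \<in> D v \<longrightarrow> mem v x a \<longrightarrow> mem v y x \<longrightarrow> mem v y b"
proof -
  have "range (\<lambda>_. a) \<subseteq> D w" using w by auto
  from IKP_sem[OF _ w(1) this, of Union_ax]
  have "\<forall>v. le w v \<longrightarrow> (\<forall>d\<in>D v. \<exists>b\<in>D v. \<forall>u. le v u \<longrightarrow> (\<forall>x\<in>D u. mem u x d \<longrightarrow>
      (\<forall>t. le u t \<longrightarrow> (\<forall>y\<in>D t. mem t y x \<longrightarrow> mem t y b))))"
    unfolding IKP_def Union_ax_def by (auto simp: fun_upd_def)
  then obtain b where b: "b \<in> D w"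
    "\<forall>v. le w v \<longrightarrow> (\<forall>x\<in>D v. mem v x a \<longrightarrow> (\<forall>u. le v u \<longrightarrow> (\<forall>y\<in>D u. mem u y x \<longrightarrow> mem u y b)))"
    using w by blast
  have "mem v y b" if "le w v" "x \<in> D v" "y \<in> D v" "mem v x a" "mem v y x" for v x y
    using b(2) that le_refl[OF that(1)] by blast
  thus ?thesis using b(1) by blast
qed

lemma set_induction:
  assumes w: "le w w" "range \<rho> \<subseteq> D w"
    and step: "\<And>v d. le w v \<Longrightarrow> d \<in> D v \<Longrightarrow>
      (\<And>u e. le v u \<Longrightarrow> e \<in> D u \<Longrightarrow> mem u e d \<Longrightarrow> sem u (\<rho>(a := e)) A) \<Longrightarrow> sem v (\<rho>(a := d)) A"
    and d: "d \<in> D w"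
  shows "sem w (\<rho>(a := d)) A"
proof -
  obtain x where x: "x \<notin> insert a (vars A)"
    using fresh_var[of "insert a (vars A)"] by (auto simp: finite_vars)
  have sub: "substitutable x a A" by (rule substitutable_fresh) (use x in auto)
  have "Imp (All a (Imp (BAll x a (subst A a x)) A)) (All a A) \<in> IKP"
    by (rule Set_Ind_IKP) (use x nonvar_nonfree[of x A] sub in auto)
  note i = sem_mp[OF IKP_sem[OF this w] w(1)]
  have "sem w \<rho> (All a (Imp (BAll x a (subst A a x)) A))"
    unfolding sem.simps(6,7)
  proof (intro HOL.allI impI ballI)
    fix v d u assume h: "le w v" "d \<in> D v" "le v u" "sem u (\<rho>(a := d)) (BAll x a (subst A a x))"
    show "sem u (\<rho>(a := d)) A"
    proof (rule step)
      show "le w u" using h le_trans by blast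
      show "d \<in> D u" using h D_mono by blast
      fix t e assume t: "le u t" "e \<in> D t" "mem t e d"
      have "sem t (\<rho>(a := d, x := e)) (subst A a x)" using h(4) t x by auto
      hence "sem t (\<rho>(a := d, x := e, a := e)) A" using sem_subst[OF sub] by (metis fun_upd_same)
      thus "sem t (\<rho>(a := e)) A"
        using sem_cong[of A "\<rho>(a := d, x := e, a := e)" "\<rho>(a := e)" t] x nonvar_nonfree[of x A] by auto
    qed
  qed
  from i[OF this] show ?thesis using w d by simp
qed

section \<open>Inclusion and upper bounds for stages\<close>

definition sub :: "'a \<Rightarrow> 'b \<Rightarrow> 'b \<Rightarrow> bool" where
  "sub w p q \<longleftrightarrow> (\<forall>v x. le w v \<longrightarrow> x \<in> D v \<longrightarrow> mem v x p \<longrightarrow> mem v x q)"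

lemma sub_refl: "sub w p p"
  by (simp add: sub_def)

lemma sub_trans: "sub w p q \<Longrightarrow> sub w q r \<Longrightarrow> sub w p r"
  by (simp add: sub_def)

lemma sub_mono: "sub w p q \<Longrightarrow> le w v \<Longrightarrow> sub v p q"
  unfolding sub_def using le_trans by blast

lemma subD: "sub w p q \<Longrightarrow> le w v \<Longrightarrow> x \<in> D v \<Longrightarrow> mem v x p \<Longrightarrow> mem v x q"
  by (simp add: sub_def)

text \<open>Collection delivers stages only as unspecified members of a set; the union of that set
  lies above all of them.\<close>

lemma union_bound:
  assumes "le w w" "a \<in> D w"
  obtains b where "b \<in> D w" "\<And>v x. le w v \<Longrightarrow> x \<in> D v \<Longrightarrow> mem v x a \<Longrightarrow> sub v x b"
proof -
  from ex_union[OF assms] obtain b where b: "b \<in> D w"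
    "\<And>v x y. le w v \<Longrightarrow> x \<in> D v \<Longrightarrow> y \<in> D v \<Longrightarrow> mem v x a \<Longrightarrow> mem v y x \<Longrightarrow> mem v y b" by blast
  show ?thesis
  proof (rule that[OF b(1)])
    fix v x assume v: "le w v" "x \<in> D v" "mem v x a"
    show "sub v x b" unfolding sub_def
    proof (intro HOL.allI impI)
      fix u y assume u: "le v u" "y \<in> D u" "mem u y x"
      have "le w u" "x \<in> D u" "mem u x a" using v u le_trans D_mono mem_mono by blast+
      thus "mem u y b" using b(2) u by blast
    qed
  qed
qed

lemma upper_bound:
  assumes "le w w" "a \<in> D w" "b \<in> D w"
  obtains c where "c \<in> D w" "sub w a c" "sub w b c"
proof -
  obtain d where "d \<in> D w" "mem w a d" "mem w b d" using ex_pair[OF assms] by blast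
  thus ?thesis using that union_bound[OF assms(1), of d] assms by metis
qed

text \<open>Statements about a stage quantify over its members. To make the stage \<open>a\<close>
  itself visible to them, it has to be an element of a stage and not only a subset.\<close>

lemma inhabited_bound:
  assumes "le w w" "a \<in> D w"
  obtains c where "c \<in> D w" "sub w a c" "mem w a c"
proof -
  obtain d where d: "d \<in> D w" "mem w a d" using ex_pair[OF assms assms(2)] by blast
  obtain c where c: "c \<in> D w" "sub w a c" "sub w d c" using upper_bound[OF assms d(1)] by blast
  show ?thesis using that[OF c(1,2)] subD[OF c(3) assms(1,2) d(2)] by blast
qed

text \<open>One step towards a transitive closure: what is known at an unspecified member of
  \<open>a\<close> can be transported by monotonicity to the one stage \<open>c\<close>.\<close>

lemma transitive_bound:
  assumes w: "le w w" "a \<in> D w"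
  obtains c where "c \<in> D w" "sub w a c" "\<And>v x. le w v \<Longrightarrow> x \<in> D v \<Longrightarrow> mem v x a \<Longrightarrow> sub v x c"
proof -
  obtain b where b: "b \<in> D w" "\<And>v x. le w v \<Longrightarrow> x \<in> D v \<Longrightarrow> mem v x a \<Longrightarrow> sub v x b"
    using union_bound[OF w] by blast
  obtain c where c: "c \<in> D w" "sub w a c" "sub w b c" using upper_bound[OF w b(1)] by blast
  show ?thesis using that[OF c(1,2)] b(2) sub_trans sub_mono[OF c(3)] by blast
qed

text \<open>The premise is encoded as a set: \<open>s\<close> consists of the members of an
  inhabited \<open>s0\<close> for which \<open>A\<close> holds, where \<open>A\<close> does not
  mention the member. Belonging to \<open>s\<close> is belonging to \<open>s0\<close> together with
  \<open>A\<close>, so the implication becomes a bounded universal, and collection yields the bound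
  \<open>b\<close> before \<open>A\<close> is known.\<close>

lemma bounded_choice:
  assumes AB: "Delta0 A" "Delta0 B" and w: "le w w" "range \<rho> \<subseteq> D w"
    and h: "\<And>v. le w v \<Longrightarrow> sem v \<rho> A \<Longrightarrow> \<exists>e\<in>D v. sem v (\<rho>(y := e)) B"
  obtains b where "b \<in> D w" "\<And>v. le w v \<Longrightarrow> sem v \<rho> A \<Longrightarrow> \<exists>e\<in>D v. mem v e b \<and> sem v (\<rho>(y := e)) B"
proof -
  obtain m where m: "m \<in> D w" using D_ne w by blast
  obtain s0 where s0: "s0 \<in> D w" "mem w m s0" using ex_pair[OF w(1) m m] by blast
  obtain x where x: "x \<notin> insert y (vars A \<union> vars B)"
    using fresh_var[of "insert y (vars A \<union> vars B)"] by (auto simp: finite_vars)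
  obtain s where s: "s \<in> D w"
    "\<And>v d. le w v \<Longrightarrow> d \<in> D v \<Longrightarrow> mem v d s \<longleftrightarrow> mem v d s0 \<and> sem v (\<rho>(x := d)) A"
    using separation[OF AB(1) w s0(1)] by blast
  have A: "sem v (\<rho>(x := d)) A = sem v \<rho> A" for v d
    using x nonvar_nonfree[of x A] by (intro sem_cong) auto
  have B: "sem v (\<rho>(x := d, y := e)) B = sem v (\<rho>(y := e)) B" for v d e
    using x nonvar_nonfree[of x B] by (intro sem_cong) auto
  have xy: "x \<noteq> y" using x by auto
  have h': "\<exists>e\<in>D v. sem v (\<rho>(x := d, y := e)) B" if "le w v" "d \<in> D v" "mem v d s" for v d
    using h s(2) that A B by metis
  obtain b where b: "b \<in> D w" "\<And>v d. le w v \<Longrightarrow> d \<in> D v \<Longrightarrow> mem v d s \<Longrightarrow>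
      \<exists>e\<in>D v. mem v e b \<and> sem v (\<rho>(x := d, y := e)) B"
    using collection[OF AB(2) xy w s(1) h'] by blast
  show ?thesis
  proof (rule that[OF b(1)])
    fix v assume v: "le w v" "sem v \<rho> A"
    hence "m \<in> D v" "mem v m s" using s(2) A m s0 D_mono mem_mono by blast+
    thus "\<exists>e\<in>D v. mem v e b \<and> sem v (\<rho>(y := e)) B" using b(2)[OF v(1)] B by metis
  qed
qed

section \<open>Ordered pairs\<close>

definition upair :: "'a \<Rightarrow> 'b \<Rightarrow> 'b \<Rightarrow> 'b \<Rightarrow> bool" where
  "upair w t a b \<longleftrightarrow> mem w a t \<and> mem w b t \<and> (\<forall>v. le w v \<longrightarrow> (\<forall>x\<in>D v. mem v x t \<longrightarrow> eq v x a \<or> eq v x b))"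

lemma ex_upair:
  assumes w: "le w w" "a \<in> D w" "b \<in> D w"
  shows "\<exists>t\<in>D w. upair w t a b"
proof -
  obtain c where c: "c \<in> D w" "mem w a c" "mem w b c" using ex_pair[OF w] by blast
  define \<rho> where "\<rho> = (\<lambda>i::nat. if i = 1 then a else b)"
  have "range \<rho> \<subseteq> D w" using w by (auto simp: \<rho>_def)
  moreover have "Delta0 (Disj (Eq 0 1) (Eq 0 2))" by (intro Delta0.intros)
  ultimately obtain t where t: "t \<in> D w" "\<And>v d. le w v \<Longrightarrow> d \<in> D v \<Longrightarrow> mem v d t \<longleftrightarrow> mem v d c \<and>
      sem v (\<rho>(0 := d)) (Disj (Eq 0 1) (Eq 0 2))"
    using separation[OF _ w(1) _ c(1)] by metis
  have "mem v d t \<longleftrightarrow> mem v d c \<and> (eq v d a \<or> eq v d b)" if "le w v" "d \<in> D v" for v d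
    using t(2)[OF that] by (simp add: \<rho>_def)
  thus ?thesis using t(1) w c eq_refl[OF w(1)] unfolding upair_def by blast
qed

text \<open>Kuratowski's pair: \<open>s\<close> is the singleton of \<open>a\<close>,
  \<open>t\<close> the unordered pair of \<open>a\<close> and \<open>b\<close>.\<close>

definition opair :: "'a \<Rightarrow> 'b \<Rightarrow> 'b \<Rightarrow> 'b \<Rightarrow> bool" where
  "opair w u a b \<longleftrightarrow> (\<exists>s\<in>D w. \<exists>t\<in>D w. upair w u s t \<and> upair w s a a \<and> upair w t a b)"

lemma upair_mono: "upair w t a b \<Longrightarrow> le w v \<Longrightarrow> upair v t a b"
  unfolding upair_def using mem_mono le_trans by blast

lemma opair_mono: "opair w t a b \<Longrightarrow> le w v \<Longrightarrow> opair v t a b"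
  unfolding opair_def using upair_mono D_mono by blast

lemma ex_opair:
  assumes w: "le w w" "a \<in> D w" "b \<in> D w"
  shows "\<exists>u\<in>D w. opair w u a b"
proof -
  obtain s where s: "s \<in> D w" "upair w s a a" using ex_upair[OF w(1,2,2)] by blast
  obtain t where t: "t \<in> D w" "upair w t a b" using ex_upair[OF w] by blast
  obtain u where "u \<in> D w" "upair w u s t" using ex_upair[OF w(1) s(1) t(1)] by blast
  thus ?thesis unfolding opair_def using s t by blast
qed

lemma opair_inj_aux:
  assumes w: "le w w" and D: "u \<in> D w" "a \<in> D w" "b \<in> D w" "a' \<in> D w" "b' \<in> D w"
    and o: "opair w u a b" "opair w u a' b'"
  shows "eq w a a' \<and> (eq w b' a \<or> eq w b' b)"
proof -
  obtain s t where st: "s \<in> D w" "t \<in> D w" "upair w u s t" "upair w s a a" "upair w t a b"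
    using o(1) unfolding opair_def by blast
  obtain s' t' where st': "s' \<in> D w" "t' \<in> D w" "upair w u s' t'" "upair w s' a' a'" "upair w t' a' b'"
    using o(2) unfolding opair_def by blast
  have e: "mem w x y'" if "mem w x y" "eq w y' y" "x \<in> D w" "y \<in> D w" "y' \<in> D w" for x y y'
    using eq_mem2[OF eq_sym[OF that(2) w that(5,4)] that(1) w that(4,5,3)] .
  have p: "mem w x t" "mem w y t" "\<And>z. z \<in> D w \<Longrightarrow> mem w z t \<Longrightarrow> eq w z x \<or> eq w z y" if "upair w t x y" for t x y
    using that w unfolding upair_def by blast+
  have "eq w s' s \<or> eq w s' t" using p(3)[OF st(3) st'(1) p(1)[OF st'(3)]] .
  hence 1: "eq w a a'"
  proof
    assume "eq w s' s"
    hence "mem w a s'" using e[OF p(1)[OF st(4)]] D st st' by blast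
    thus ?thesis using p(3)[OF st'(4)] D by blast
  next
    assume "eq w s' t"
    hence "mem w a s'" using e[OF p(1)[OF st(5)]] D st st' by blast
    thus ?thesis using p(3)[OF st'(4)] D by blast
  qed
  have "eq w t' s \<or> eq w t' t" using p(3)[OF st(3) st'(2) p(2)[OF st'(3)]] .
  hence "eq w b' a \<or> eq w b' b"
  proof
    assume "eq w t' s"
    hence "mem w b' s" using e[OF p(2)[OF st'(5)] eq_sym] D st st' w by blast
    thus ?thesis using p(3)[OF st(4)] D by blast
  next
    assume "eq w t' t"
    hence "mem w b' t" using e[OF p(2)[OF st'(5)] eq_sym] D st st' w by blast
    thus ?thesis using p(3)[OF st(5)] D by blast
  qed
  with 1 show ?thesis by blast
qed

lemma opair_inj:
  assumes w: "le w w" and D: "u \<in> D w" "a \<in> D w" "b \<in> D w" "a' \<in> D w" "b' \<in> D w"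
    and o: "opair w u a b" "opair w u a' b'"
  shows "eq w a a'" "eq w b b'"
proof -
  note 1 = opair_inj_aux[OF w D o] and 2 = opair_inj_aux[OF w D(1,4,5,2,3) o(2,1)]
  show "eq w a a'" using 1 by blast
  consider "eq w b' b" | "eq w b b'" | "eq w b' a" "eq w b a'" using 1 2 by blast
  thus "eq w b b'"
  proof cases
    case 3
    have "eq w a b'" by (rule eq_sym[OF 3(1) w D(5,2)])
    moreover have "eq w b a" by (rule eq_trans[OF 3(2) _ w D(3,4,2)]) (use 2 in blast)
    ultimately show ?thesis using eq_trans w D by blast
  qed (use eq_sym w D in blast)+
qed

section \<open>Coding of parameters and universal bounded formulas\<close>

definition upairF :: "nat \<Rightarrow> nat \<Rightarrow> nat \<Rightarrow> nat \<Rightarrow> fm" where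
  "upairF x t a b = Conj (Mem a t) (Conj (Mem b t) (BAll x t (Disj (Eq x a) (Eq x b))))"

lemma sem_upairF: "x \<notin> {t, a, b} \<Longrightarrow> sem w \<rho> (upairF x t a b) \<longleftrightarrow> upair w (\<rho> t) (\<rho> a) (\<rho> b)"
  unfolding upairF_def upair_def by auto

text \<open>The components of a Kuratowski pair are members of members of \<open>u\<close>, so
  \<open>u\<close> can be decoded by bounded quantifiers alone and \<open>\<theta>'\<close> stays
  bounded.\<close>

lemma pair_elimination:
  assumes \<theta>: "Delta0 \<theta>" and ab: "a \<noteq> b" "u \<notin> insert a (insert b (vars \<theta>))"
  obtains \<theta>' where "Delta0 \<theta>'" "fv \<theta>' \<subseteq> insert u (fv \<theta> - {a, b})"
    "\<And>v \<rho>. le v v \<Longrightarrow> range \<rho> \<subseteq> D v \<Longrightarrow> opair v (\<rho> u) (\<rho> a) (\<rho> b) \<Longrightarrow> sem v \<rho> \<theta>' \<longleftrightarrow> sem v \<rho> \<theta>"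
proof -
  let ?V = "insert u (insert a (insert b (vars \<theta>)))"
  obtain s where s: "s \<notin> ?V"
    using fresh_var[of "?V"] by (auto simp: finite_vars)
  obtain t where t: "t \<notin> insert s ?V"
    using fresh_var[of "insert s ?V"] by (auto simp: finite_vars)
  obtain x where x: "x \<notin> insert t (insert s ?V)"
    using fresh_var[of "insert t (insert s ?V)"] by (auto simp: finite_vars)
  define M where "M = Conj (upairF x u s t) (Conj (upairF x s a a) (upairF x t a b))"
  define \<theta>' where "\<theta>' = BEx s u (BEx t u (BEx a s (BEx b t (Conj M \<theta>))))"
  show ?thesis
  proof (rule that[of \<theta>'])
    show "Delta0 \<theta>'" unfolding \<theta>'_def M_def upairF_def using \<theta> s t x by (intro Delta0.intros) auto
    show "fv \<theta>' \<subseteq> insert u (fv \<theta> - {a, b})" using s t x by (auto simp: \<theta>'_def M_def upairF_def)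
    fix v \<rho> assume v: "le v v" "range \<rho> \<subseteq> D v" and o: "opair v (\<rho> u) (\<rho> a) (\<rho> b)"
    have M: "sem v (\<rho>(s := s', t := t', a := a', b := b')) M \<longleftrightarrow>
        upair v (\<rho> u) s' t' \<and> upair v s' a' a' \<and> upair v t' a' b'" for s' t' a' b'
      unfolding M_def sem.simps using s t x ab by (subst sem_upairF, simp)+ auto
    have \<theta>c: "sem v (\<rho>(s := s', t := t', a := a', b := b')) \<theta> \<longleftrightarrow> sem v (\<rho>(a := a', b := b')) \<theta>" for s' t' a' b'
      using s t nonvar_nonfree[of _ \<theta>] by (intro sem_cong) auto
    have D: "\<rho> z \<in> D v" for z using v by auto
    show "sem v \<rho> \<theta>' \<longleftrightarrow> sem v \<rho> \<theta>"
    proof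
      assume "sem v \<rho> \<theta>'"
      then obtain s' t' a' b' where h: "s' \<in> D v" "t' \<in> D v" "a' \<in> D v" "b' \<in> D v"
        "sem v (\<rho>(s := s', t := t', a := a', b := b')) M"
        "sem v (\<rho>(s := s', t := t', a := a', b := b')) \<theta>"
        unfolding \<theta>'_def sem.simps by blast
      have "opair v (\<rho> u) a' b'" using h M unfolding opair_def by blast
      hence "eq v (\<rho> a) a'" "eq v (\<rho> b) b'" using opair_inj[OF v(1) D D D h(3,4) o] by blast+
      hence "env_eq v \<rho> (\<rho>(a := a', b := b'))"
        using v h(3,4) D eq_refl[OF v(1)] by (auto simp: env_eq_def)
      thus "sem v \<rho> \<theta>" using h(6) \<theta>c sem_eq_cong by blast
    next
      assume \<theta>v: "sem v \<rho> \<theta>"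
      obtain s' t' where h: "s' \<in> D v" "t' \<in> D v" "upair v (\<rho> u) s' t'" "upair v s' (\<rho> a) (\<rho> a)"
        "upair v t' (\<rho> a) (\<rho> b)" using o unfolding opair_def by blast
      have "sem v (\<rho>(s := s', t := t', a := \<rho> a, b := \<rho> b)) (Conj M \<theta>)"
        unfolding sem.simps M \<theta>c using h \<theta>v by simp
      moreover have "mem v s' (\<rho> u)" "mem v t' (\<rho> u)" "mem v (\<rho> a) s'" "mem v (\<rho> b) t'"
        using h unfolding upair_def by blast+
      ultimately have "sem v (\<rho>(s := s', t := t', a := \<rho> a)) (BEx b t (Conj M \<theta>))"
        using D s t ab unfolding sem.simps(10) by (intro bexI[of _ "\<rho> b"]) auto
      hence "sem v (\<rho>(s := s', t := t')) (BEx a s (BEx b t (Conj M \<theta>)))"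
        using D s t ab \<open>mem v (\<rho> a) s'\<close> unfolding sem.simps(10)[of _ _ a] by (intro bexI[of _ "\<rho> a"]) auto
      hence "sem v (\<rho>(s := s')) (BEx t u (BEx a s (BEx b t (Conj M \<theta>))))"
        using h(2) s t \<open>mem v t' (\<rho> u)\<close> unfolding sem.simps(10)[of _ _ t] by (intro bexI[of _ t']) auto
      thus "sem v \<rho> \<theta>'"
        using h(1) s \<open>mem v s' (\<rho> u)\<close> unfolding \<theta>'_def sem.simps(10)[of _ _ s] by (intro bexI[of _ s']) auto
    qed
  qed
qed

text \<open>Two parameters at a time are replaced by their pair until at most one is left. The
  variable \<open>y\<close> is kept apart because it will range over stages.\<close>

lemma single_parameter:
  assumes "Delta0 \<theta>" "fv \<theta> \<subseteq> insert y (set xs)" "y \<notin> set xs" "distinct xs"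
  shows "\<exists>\<theta>' u. Delta0 \<theta>' \<and> u \<noteq> y \<and> fv \<theta>' \<subseteq> {u, y} \<and>
    (\<forall>w \<rho>. le w w \<longrightarrow> range \<rho> \<subseteq> D w \<longrightarrow>
      (\<exists>d\<in>D w. \<forall>v. le w v \<longrightarrow> (\<forall>e\<in>D v. sem v (\<rho>(y := e)) \<theta> \<longleftrightarrow> sem v (\<rho>(u := d, y := e)) \<theta>')))"
  using assms
proof (induction "length xs" arbitrary: xs \<theta> rule: less_induct)
  case less
  show ?case
  proof (cases "length xs \<le> 1")
    case True
    then obtain u where u: "u \<noteq> y" "set xs \<subseteq> {u}"
    proof (cases xs)
      case Nil
      obtain u where "u \<noteq> y" using fresh_var[of "{y}"] by auto
      thus ?thesis using that Nil by auto
    next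
      case (Cons u xs')
      thus ?thesis using that[of u] True less.prems(3) by auto
    qed
    have "\<exists>d\<in>D w. \<forall>v. le w v \<longrightarrow> (\<forall>e\<in>D v. sem v (\<rho>(y := e)) \<theta> \<longleftrightarrow> sem v (\<rho>(u := d, y := e)) \<theta>)"
      if "range \<rho> \<subseteq> D w" for w \<rho>
      using that by (intro bexI[of _ "\<rho> u"]) auto
    thus ?thesis using less.prems u by (intro exI[of _ \<theta>] exI[of _ u]) auto
  next
    case False
    then obtain a b rest where xs: "xs = a # b # rest" by (cases xs; cases "tl xs") auto
    obtain u where u: "u \<notin> insert y (insert a (insert b (vars \<theta>))) \<union> set rest"
      using fresh_var[of "insert y (insert a (insert b (vars \<theta>))) \<union> set rest"] finite_vars by auto
    have ab: "a \<noteq> b" "y \<noteq> a" "y \<noteq> b" using less.prems xs by auto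
    have "u \<notin> insert a (insert b (vars \<theta>))" using u by auto
    then obtain \<theta>1 where \<theta>1: "Delta0 \<theta>1" "fv \<theta>1 \<subseteq> insert u (fv \<theta> - {a, b})"
      "\<And>v \<rho>. le v v \<Longrightarrow> range \<rho> \<subseteq> D v \<Longrightarrow> opair v (\<rho> u) (\<rho> a) (\<rho> b) \<Longrightarrow> sem v \<rho> \<theta>1 \<longleftrightarrow> sem v \<rho> \<theta>"
      using pair_elimination[OF less.prems(1) ab(1)] by blast
    have "\<exists>\<theta>' u'. Delta0 \<theta>' \<and> u' \<noteq> y \<and> fv \<theta>' \<subseteq> {u', y} \<and>
      (\<forall>w \<rho>. le w w \<longrightarrow> range \<rho> \<subseteq> D w \<longrightarrow>
        (\<exists>d\<in>D w. \<forall>v. le w v \<longrightarrow> (\<forall>e\<in>D v. sem v (\<rho>(y := e)) \<theta>1 \<longleftrightarrow> sem v (\<rho>(u' := d, y := e)) \<theta>')))"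
      by (rule less.hyps[of "u # rest"]) (use less.prems xs u \<theta>1 in auto)
    then obtain \<theta>' u' where IH: "Delta0 \<theta>'" "u' \<noteq> y" "fv \<theta>' \<subseteq> {u', y}"
      "\<And>w \<rho>. le w w \<Longrightarrow> range \<rho> \<subseteq> D w \<Longrightarrow>
        \<exists>d\<in>D w. \<forall>v. le w v \<longrightarrow> (\<forall>e\<in>D v. sem v (\<rho>(y := e)) \<theta>1 \<longleftrightarrow> sem v (\<rho>(u' := d, y := e)) \<theta>')"
      by blast
    have "\<exists>d\<in>D w. \<forall>v. le w v \<longrightarrow> (\<forall>e\<in>D v. sem v (\<rho>(y := e)) \<theta> \<longleftrightarrow> sem v (\<rho>(u' := d, y := e)) \<theta>')"
      if w: "le w w" "range \<rho> \<subseteq> D w" for w \<rho>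
    proof -
      obtain c where c: "c \<in> D w" "opair w c (\<rho> a) (\<rho> b)" using ex_opair[OF w(1)] w(2) by blast
      obtain d where d: "d \<in> D w" "\<And>v e. le w v \<Longrightarrow> e \<in> D v \<Longrightarrow>
          sem v (\<rho>(u := c, y := e)) \<theta>1 \<longleftrightarrow> sem v (\<rho>(u := c, u' := d, y := e)) \<theta>'"
        using IH(4)[OF w(1) env_upd[OF w(2) c(1)], of u] by blast
      have "sem v (\<rho>(y := e)) \<theta> \<longleftrightarrow> sem v (\<rho>(u' := d, y := e)) \<theta>'" if v: "le w v" "e \<in> D v" for v e
      proof -
        have "sem v (\<rho>(u := c, u' := d, y := e)) \<theta>' \<longleftrightarrow> sem v (\<rho>(u' := d, y := e)) \<theta>'"
          using IH(3) by (intro sem_cong) auto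
        moreover have "sem v (\<rho>(u := c, y := e)) \<theta>1 \<longleftrightarrow> sem v (\<rho>(u := c, y := e)) \<theta>"
        proof (rule \<theta>1(3))
          show "le v v" using v le_refl by blast
          have "c \<in> D v" using c D_mono v by blast
          thus "range (\<rho>(u := c, y := e)) \<subseteq> D v" by (intro env_upd env_mono[OF w(2)] v)
          show "opair v ((\<rho>(u := c, y := e)) u) ((\<rho>(u := c, y := e)) a) ((\<rho>(u := c, y := e)) b)"
            using opair_mono[OF c(2) v(1)] u ab by simp
        qed
        moreover have "sem v (\<rho>(u := c, y := e)) \<theta> \<longleftrightarrow> sem v (\<rho>(y := e)) \<theta>"
          using u nonvar_nonfree[of u \<theta>] by (intro sem_cong) auto
        ultimately show ?thesis using d(2)[OF v] by blast
      qed
      thus ?thesis using d(1) by blast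
    qed
    thus ?thesis using IH by blast
  qed
qed

text \<open>Through its parameter \<open>u\<close> the formula \<open>U\<close> enumerates the
  classes of \<open>y\<close> that members of \<open>\<Theta>\<close> define. The index
  \<open>d\<close> absorbs the choice of the formula together with its other parameters; it is fixed
  at \<open>w\<close> and works at every later world.\<close>

definition universal_for :: "fm \<Rightarrow> nat \<Rightarrow> nat \<Rightarrow> fm set \<Rightarrow> bool" where
  "universal_for U u y \<Theta> \<longleftrightarrow> Delta0 U \<and> u \<noteq> y \<and> fv U \<subseteq> {u, y} \<and> (\<forall>\<theta>\<in>\<Theta>. \<forall>w \<rho>. le w w \<longrightarrow> range \<rho> \<subseteq> D w \<longrightarrow>
    (\<exists>d\<in>D w. \<forall>v. le w v \<longrightarrow> (\<forall>e\<in>D v. sem v (\<rho>(y := e)) \<theta> \<longleftrightarrow> sem v (\<rho>(u := d, y := e)) U)))"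

lemma universal_forE:
  assumes "universal_for U u y \<Theta>" "\<theta> \<in> \<Theta>" "le w w" "range \<rho> \<subseteq> D w"
  obtains d where "d \<in> D w"
    "\<And>v e. le w v \<Longrightarrow> e \<in> D v \<Longrightarrow> sem v (\<rho>(y := e)) \<theta> \<longleftrightarrow> sem v (\<rho>(u := d, y := e)) U"
  using assms unfolding universal_for_def by meson

lemma universal_rename:
  assumes "universal_for U u y \<Theta>" "u' \<noteq> y"
  obtains U' where "universal_for U' u' y \<Theta>"
proof -
  have U: "Delta0 U" "u \<noteq> y" "fv U \<subseteq> {u, y}" using assms(1) by (auto simp: universal_for_def)
  obtain U' where U': "Delta0 U \<Longrightarrow> Delta0 U'" "fv U' = (id(u := u')) ` fv U"
    "\<And>w \<rho>. sem w \<rho> U' = sem w (\<rho> \<circ> id(u := u')) U" using ex_rename by blast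
  have "sem v (\<rho>(u' := d, y := e)) U' = sem v (\<rho>(u := d, y := e)) U" for v \<rho> d e
    unfolding U'(3) using U assms(2) by (intro sem_cong) auto
  moreover have "fv U' \<subseteq> {u', y}" using U'(2) U(2,3) by auto
  ultimately show ?thesis using that[of U'] assms U'(1) unfolding universal_for_def by simp
qed

lemma ex_universal:
  assumes "finite \<Theta>" "\<forall>\<theta>\<in>\<Theta>. Delta0 \<theta>"
  shows "\<exists>U u. universal_for U u y \<Theta>"
  using assms
proof (induction rule: finite_induct)
  case empty
  have "universal_for Bot (Suc y) y {}" by (auto simp: universal_for_def intro: Delta0.intros)
  thus ?case by blast
next
  case (insert \<theta> \<Theta>)
  obtain xs where xs: "set xs = fv \<theta> - {y}" "distinct xs"
    using finite_fv finite_distinct_list by (metis finite_Diff)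
  have "\<exists>U u. universal_for U u y {\<theta>}"
    unfolding universal_for_def Ball_def[of "{\<theta>}"] singleton_iff simp_thms
    by (rule single_parameter[of _ _ xs]) (use insert.prems xs in auto)
  then obtain U0 u0 where "universal_for U0 u0 y {\<theta>}" by blast
  then obtain U1 where U1: "universal_for U1 (y + 1) y {\<theta>}" using universal_rename[of U0 u0 y _ "y + 1"] by auto
  obtain V0 v0 where "universal_for V0 v0 y \<Theta>" using insert by auto
  then obtain U2 where U2: "universal_for U2 (y + 2) y \<Theta>" using universal_rename[of V0 v0 y _ "y + 2"] by auto
  have fv: "Delta0 U1" "fv U1 \<subseteq> {y + 1, y}" "Delta0 U2" "fv U2 \<subseteq> {y + 2, y}"
    using U1 U2 by (auto simp: universal_for_def)
  \<comment> \<open>The variables \<open>y + 1\<close> and \<open>y + 2\<close> hold indices for the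
    two parts, \<open>y + 3\<close> and \<open>y + 4\<close> are switches: since
    \<open>y + 5\<close> is not free in \<open>U1\<close> or \<open>U2\<close>, a disjunct counts
    exactly when its switch is inhabited.\<close>
  define C where "C = Disj (BEx (y + 5) (y + 3) U1) (BEx (y + 5) (y + 4) U2)"
  have "\<exists>W w. Delta0 W \<and> w \<noteq> y \<and> fv W \<subseteq> {w, y} \<and>
    (\<forall>x \<rho>. le x x \<longrightarrow> range \<rho> \<subseteq> D x \<longrightarrow>
      (\<exists>d\<in>D x. \<forall>v. le x v \<longrightarrow> (\<forall>e\<in>D v. sem v (\<rho>(y := e)) C \<longleftrightarrow> sem v (\<rho>(w := d, y := e)) W)))"
    by (rule single_parameter[of _ _ "[y + 1, y + 2, y + 3, y + 4]"])
      (use fv in \<open>auto simp: C_def intro!: Delta0.intros\<close>)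
  then obtain W w where W: "Delta0 W" "w \<noteq> y" "fv W \<subseteq> {w, y}"
    "\<And>x \<rho>. le x x \<Longrightarrow> range \<rho> \<subseteq> D x \<Longrightarrow>
      \<exists>d\<in>D x. \<forall>v. le x v \<longrightarrow> (\<forall>e\<in>D v. sem v (\<rho>(y := e)) C \<longleftrightarrow> sem v (\<rho>(w := d, y := e)) W)"
    by blast
  have "\<exists>d\<in>D x. \<forall>v. le x v \<longrightarrow> (\<forall>e\<in>D v. sem v (\<rho>(y := e)) \<psi> \<longleftrightarrow> sem v (\<rho>(w := d, y := e)) W)"
    if \<psi>: "\<psi> \<in> insert \<theta> \<Theta>" and x: "le x x" "range \<rho> \<subseteq> D x" for \<psi> x \<rho>
  proof -
    obtain m where m: "m \<in> D x" using D_ne x by blast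
    obtain s where s: "s \<in> D x" "mem x m s" using ex_pair[OF x(1) m m] by blast
    \<comment> \<open>The empty set \<open>z\<close> turns a disjunct off, the inhabited set
      \<open>s\<close> turns it on.\<close>
    obtain z where z: "z \<in> D x" "\<And>v d. le x v \<Longrightarrow> d \<in> D v \<Longrightarrow> \<not> mem v d z"
      using separation[OF Delta0.intros(3) x m] by (metis sem.simps(3))
    have "\<exists>c1\<in>D x. \<exists>c2\<in>D x. \<exists>t1\<in>D x. \<exists>t2\<in>D x. \<forall>v. le x v \<longrightarrow> (\<forall>e\<in>D v. sem v (\<rho>(y := e)) \<psi> \<longleftrightarrow>
       sem v (\<rho>(y+1 := c1, y+2 := c2, y+3 := t1, y+4 := t2, y := e)) C)"
    proof (cases "\<psi> = \<theta>")
      case True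
      then obtain c where c: "c \<in> D x" "\<And>v e. le x v \<Longrightarrow> e \<in> D v \<Longrightarrow>
          sem v (\<rho>(y := e)) \<psi> \<longleftrightarrow> sem v (\<rho>(y + 1 := c, y := e)) U1"
        using universal_forE[OF U1, of \<theta> x \<rho>] x by auto
      have "sem v (\<rho>(y + 1 := c, y := e)) U1 \<longleftrightarrow> sem v (\<rho>(y+1 := c, y+2 := m, y+3 := s, y+4 := z, y := e)) C"
        if v: "le x v" "e \<in> D v" for v e
      proof -
        have "sem v (\<rho>(y+1 := c, y+2 := m, y+3 := s, y+4 := z, y := e, y + 5 := d)) U1 \<longleftrightarrow>
          sem v (\<rho>(y + 1 := c, y := e)) U1" for d
          using fv by (intro sem_cong) auto
        moreover have "m \<in> D v" "mem v m s" using m s v D_mono mem_mono by blast+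
        ultimately show ?thesis unfolding C_def sem.simps using z(2)[OF v(1)] by auto
      qed
      thus ?thesis using c m s z(1)
        by (intro bexI[of _ c] bexI[of _ m] bexI[of _ s] bexI[of _ z]) simp_all
    next
      case False
      then obtain c where c: "c \<in> D x" "\<And>v e. le x v \<Longrightarrow> e \<in> D v \<Longrightarrow>
          sem v (\<rho>(y := e)) \<psi> \<longleftrightarrow> sem v (\<rho>(y + 2 := c, y := e)) U2"
        using universal_forE[OF U2, of \<psi> x \<rho>] x \<psi> by auto
      have "sem v (\<rho>(y + 2 := c, y := e)) U2 \<longleftrightarrow> sem v (\<rho>(y+1 := m, y+2 := c, y+3 := z, y+4 := s, y := e)) C"
        if v: "le x v" "e \<in> D v" for v e
      proof -
        have "sem v (\<rho>(y+1 := m, y+2 := c, y+3 := z, y+4 := s, y := e, y + 5 := d)) U2 \<longleftrightarrow>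
          sem v (\<rho>(y + 2 := c, y := e)) U2" for d
          using fv by (intro sem_cong) auto
        moreover have "m \<in> D v" "mem v m s" using m s v D_mono mem_mono by blast+
        ultimately show ?thesis unfolding C_def sem.simps using z(2)[OF v(1)] by auto
      qed
      thus ?thesis using c m s z(1)
        by (intro bexI[of _ m] bexI[of _ c] bexI[of _ z] bexI[of _ s]) simp_all
    qed
    then obtain c1 c2 t1 t2 where c: "c1 \<in> D x" "c2 \<in> D x" "t1 \<in> D x" "t2 \<in> D x"
      "\<And>v e. le x v \<Longrightarrow> e \<in> D v \<Longrightarrow> sem v (\<rho>(y := e)) \<psi> \<longleftrightarrow>
       sem v (\<rho>(y+1 := c1, y+2 := c2, y+3 := t1, y+4 := t2, y := e)) C" by blast
    have "range (\<rho>(y+1 := c1, y+2 := c2, y+3 := t1, y+4 := t2)) \<subseteq> D x" by (intro env_upd x c)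
    from W(4)[OF x(1) this] obtain d where d: "d \<in> D x" "\<And>v e. le x v \<Longrightarrow> e \<in> D v \<Longrightarrow>
       sem v (\<rho>(y+1 := c1, y+2 := c2, y+3 := t1, y+4 := t2, y := e)) C \<longleftrightarrow>
       sem v (\<rho>(y+1 := c1, y+2 := c2, y+3 := t1, y+4 := t2, w := d, y := e)) W" by blast
    have "sem v (\<rho>(y+1 := c1, y+2 := c2, y+3 := t1, y+4 := t2, w := d, y := e)) W \<longleftrightarrow>
      sem v (\<rho>(w := d, y := e)) W" for v e
      using W(3) by (intro sem_cong) auto
    thus ?thesis using c(5) d by blast
  qed
  thus ?case unfolding universal_for_def using W(1-3) by blast
qed

end

section \<open>Inversion for \<Sigma> and \<Pi> formulas\<close>

lemma SigmaF_Bot: "SigmaF Bot" and PiF_Bot: "PiF Bot"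
  by (intro SigmaF_PiF.intros Delta0.intros)+

lemma SigmaF_Delta0: "Delta0 A \<Longrightarrow> SigmaF A" and PiF_Delta0: "Delta0 A \<Longrightarrow> PiF A"
  by (rule SigmaF_PiF.intros(1), assumption) (rule SigmaF_PiF.intros(2), assumption)

lemma SigmaF_ConjD: "SigmaF (Conj A B) \<Longrightarrow> SigmaF A \<and> SigmaF B"
  by (erule SigmaF.cases) (auto simp: Neg_def elim!: Delta0_elims intro: SigmaF_Delta0)

lemma SigmaF_DisjD: "SigmaF (Disj A B) \<Longrightarrow> SigmaF A \<and> SigmaF B"
  by (erule SigmaF.cases) (auto simp: Neg_def elim!: Delta0_elims intro: SigmaF_Delta0)

lemma SigmaF_ImpD: "SigmaF (Imp A B) \<Longrightarrow> PiF A \<and> SigmaF B"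
  by (erule SigmaF.cases) (auto simp: Neg_def elim!: Delta0_elims intro: SigmaF_Delta0 PiF_Delta0 SigmaF_Bot)

lemma SigmaF_AllD: "\<not> SigmaF (All x A)"
  by (rule notI, erule SigmaF.cases) (auto simp: Neg_def elim!: Delta0_elims)

lemma SigmaF_ExD: "SigmaF (Ex x A) \<Longrightarrow> SigmaF A"
  by (erule SigmaF.cases) (auto simp: Neg_def elim!: Delta0_elims)

lemma SigmaF_BAllD: "SigmaF (BAll x s A) \<Longrightarrow> SigmaF A \<and> x \<noteq> s"
  by (erule SigmaF.cases) (auto simp: Neg_def elim!: Delta0_elims intro: SigmaF_Delta0)

lemma SigmaF_BExD: "SigmaF (BEx x s A) \<Longrightarrow> SigmaF A \<and> x \<noteq> s"
  by (erule SigmaF.cases) (auto simp: Neg_def elim!: Delta0_elims intro: SigmaF_Delta0)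

lemma PiF_ConjD: "PiF (Conj A B) \<Longrightarrow> PiF A \<and> PiF B"
  by (erule PiF.cases) (auto simp: Neg_def elim!: Delta0_elims intro: PiF_Delta0)

lemma PiF_DisjD: "PiF (Disj A B) \<Longrightarrow> PiF A \<and> PiF B"
  by (erule PiF.cases) (auto simp: Neg_def elim!: Delta0_elims intro: PiF_Delta0)

lemma PiF_ImpD: "PiF (Imp A B) \<Longrightarrow> SigmaF A \<and> PiF B"
  by (erule PiF.cases) (auto simp: Neg_def elim!: Delta0_elims intro: SigmaF_Delta0 PiF_Delta0 PiF_Bot)

lemma PiF_AllD: "PiF (All x A) \<Longrightarrow> PiF A"
  by (erule PiF.cases) (auto simp: Neg_def elim!: Delta0_elims)

lemma PiF_ExD: "\<not> PiF (Ex x A)"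
  by (rule notI, erule PiF.cases) (auto simp: Neg_def elim!: Delta0_elims)

lemma PiF_BAllD: "PiF (BAll x s A) \<Longrightarrow> PiF A \<and> x \<noteq> s"
  by (erule PiF.cases) (auto simp: Neg_def elim!: Delta0_elims intro: PiF_Delta0)

lemma PiF_BExD: "PiF (BEx x s A) \<Longrightarrow> PiF A \<and> x \<noteq> s"
  by (erule PiF.cases) (auto simp: Neg_def elim!: Delta0_elims intro: PiF_Delta0)

lemmas SigmaF_dests = SigmaF_ConjD SigmaF_DisjD SigmaF_ImpD SigmaF_ExD SigmaF_BAllD SigmaF_BExD
lemmas PiF_dests = PiF_ConjD PiF_DisjD PiF_ImpD PiF_AllD PiF_BAllD PiF_BExD

lemma Delta0_rel: "SigmaF A \<or> PiF A \<Longrightarrow> z \<notin> vars A \<Longrightarrow> Delta0 (rel z A)"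
proof (induction A)
qed (auto intro!: Delta0.intros simp: SigmaF_AllD PiF_ExD dest: SigmaF_dests PiF_dests)

lemma rel_Delta0: "Delta0 A \<Longrightarrow> rel z A = A"
  by (induction rule: Delta0.induct) auto

lemma fv_rel: "fv (rel z A) \<subseteq> insert z (fv A)"
  by (induction A) auto

section \<open>Semantics of relativized formulas\<close>

context kripke
begin

text \<open>This is A^z with the stage given as an element instead of the value of a variable, so
  that no fresh variable has to be named at each use. \<open>sem_rel\<close> returns to the formula
  \<open>rel k A\<close> when an axiom is to be applied to it.\<close>

fun R :: "'w \<Rightarrow> (nat \<Rightarrow> 'd) \<Rightarrow> 'd \<Rightarrow> fm \<Rightarrow> bool" where
  "R w \<rho> z (Mem x y) = mem w (\<rho> x) (\<rho> y)"
| "R w \<rho> z (Eq x y) = eq w (\<rho> x) (\<rho> y)"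
| "R w \<rho> z Bot = False"
| "R w \<rho> z (Conj A B) = (R w \<rho> z A \<and> R w \<rho> z B)"
| "R w \<rho> z (Disj A B) = (R w \<rho> z A \<or> R w \<rho> z B)"
| "R w \<rho> z (Imp A B) = (\<forall>v. le w v \<longrightarrow> R v \<rho> z A \<longrightarrow> R v \<rho> z B)"
| "R w \<rho> z (All x A) = (\<forall>v. le w v \<longrightarrow> (\<forall>d\<in>D v. mem v d z \<longrightarrow> R v (\<rho>(x := d)) z A))"
| "R w \<rho> z (Ex x A) = (\<exists>d\<in>D w. mem w d z \<and> R w (\<rho>(x := d)) z A)"
| "R w \<rho> z (BAll x s A) =
    (\<forall>v. le w v \<longrightarrow> (\<forall>d\<in>D v. mem v d ((\<rho>(x := d)) s) \<longrightarrow> R v (\<rho>(x := d)) z A))"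
| "R w \<rho> z (BEx x s A) = (\<exists>d\<in>D w. mem w d ((\<rho>(x := d)) s) \<and> R w (\<rho>(x := d)) z A)"

lemma sem_rel: "k \<notin> vars A \<Longrightarrow> sem w (\<rho>(k := z)) (rel k A) = R w \<rho> z A"
proof (induction A arbitrary: w \<rho>)
  case (All x A)
  have "sem v (\<rho>(k := z, x := d)) (rel k A) = R v (\<rho>(x := d)) z A" for v d
    using All.IH[of v "\<rho>(x := d)"] All.prems by (metis fun_upd_twist insertCI vars.simps(7))
  thus ?case using All.prems by (simp only: rel.simps sem.simps R.simps) simp
next
  case (Ex x A)
  have "sem v (\<rho>(k := z, x := d)) (rel k A) = R v (\<rho>(x := d)) z A" for v d
    using Ex.IH[of v "\<rho>(x := d)"] Ex.prems by (metis fun_upd_twist insertCI vars.simps(8))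
  thus ?case using Ex.prems by (simp only: rel.simps sem.simps R.simps) simp
next
  case (BAll x s A)
  have "sem v (\<rho>(k := z, x := d)) (rel k A) = R v (\<rho>(x := d)) z A" for v d
    using BAll.IH[of v "\<rho>(x := d)"] BAll.prems by (metis fun_upd_twist insertCI vars.simps(9))
  moreover have "(\<rho>(k := z, x := d)) s = (\<rho>(x := d)) s" for d using BAll.prems by simp
  ultimately show ?case by (simp only: rel.simps sem.simps R.simps)
next
  case (BEx x s A)
  have "sem v (\<rho>(k := z, x := d)) (rel k A) = R v (\<rho>(x := d)) z A" for v d
    using BEx.IH[of v "\<rho>(x := d)"] BEx.prems by (metis fun_upd_twist insertCI vars.simps(10))
  moreover have "(\<rho>(k := z, x := d)) s = (\<rho>(x := d)) s" for d using BEx.prems by simp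
  ultimately show ?case by (simp only: rel.simps sem.simps R.simps)
qed auto

lemma R_cong: assumes "\<forall>x\<in>fv A. \<rho> x = \<sigma> x" shows "R w \<rho> z A = R w \<sigma> z A"
proof -
  obtain k where k: "k \<notin> vars A" using fresh_var finite_vars by blast
  have "sem w (\<rho>(k := z)) (rel k A) = sem w (\<sigma>(k := z)) (rel k A)"
    using fv_rel[of k A] assms by (intro sem_cong) auto
  thus ?thesis using sem_rel[OF k] by simp
qed

lemma R_Delta0: assumes "Delta0 A" shows "R w \<rho> z A = sem w \<rho> A"
proof -
  obtain k where k: "k \<notin> vars A" using fresh_var finite_vars by blast
  have "sem w (\<rho>(k := z)) A = sem w \<rho> A"
    using nonvar_nonfree[OF k] by (intro sem_cong) auto
  thus ?thesis using sem_rel[OF k, of w \<rho> z] rel_Delta0[OF assms] by simp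
qed

lemma R_mono: assumes "R w \<rho> z A" "le w v" shows "R v \<rho> z A"
proof -
  obtain k where k: "k \<notin> vars A" using fresh_var finite_vars by blast
  show ?thesis using sem_mono[OF _ assms(2)] assms(1) sem_rel[OF k] by metis
qed

lemma R_sem: "le w w \<Longrightarrow> z \<in> D w \<Longrightarrow>
    (SigmaF A \<longrightarrow> R w \<rho> z A \<longrightarrow> sem w \<rho> A) \<and> (PiF A \<longrightarrow> sem w \<rho> A \<longrightarrow> R w \<rho> z A)"
proof (induction A arbitrary: w \<rho>)
  case (Conj A B) thus ?case using SigmaF_ConjD PiF_ConjD by (metis R.simps(4) sem.simps(4))
next
  case (Disj A B) thus ?case using SigmaF_DisjD PiF_DisjD by (metis R.simps(5) sem.simps(5))
next
  case (Imp A B)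
  have s: "le v v" "z \<in> D v" if "le w v" for v using D_mono le_refl Imp.prems that by blast+
  show ?case using Imp.IH[OF s] SigmaF_ImpD[of A B] PiF_ImpD[of A B] unfolding R.simps sem.simps by blast
next
  case (All x A)
  have s: "le v v" "z \<in> D v" if "le w v" for v using D_mono le_refl All.prems that by blast+
  show ?case using All.IH[OF s] SigmaF_AllD[of x A] PiF_AllD[of x A] unfolding R.simps sem.simps by blast
next
  case (Ex x A)
  show ?case using Ex.IH[OF Ex.prems] SigmaF_ExD[of x A] PiF_ExD[of x A] unfolding R.simps sem.simps by blast
next
  case (BAll x s A)
  have s: "le v v" "z \<in> D v" if "le w v" for v using D_mono le_refl BAll.prems that by blast+
  show ?case using BAll.IH[OF s] SigmaF_BAllD[of x s A] PiF_BAllD[of x s A] unfolding R.simps sem.simps by blast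
next
  case (BEx x s A)
  show ?case using BEx.IH[OF BEx.prems] SigmaF_BExD[of x s A] PiF_BExD[of x s A] unfolding R.simps sem.simps by blast
qed auto

end

context kripke_ikp
begin

text \<open>Both monotonicities are proved together because the two classes exchange roles in the
  antecedent of an implication.\<close>

lemma R_sub:
  "le w w \<Longrightarrow> sub w z z' \<Longrightarrow>
    (SigmaF A \<longrightarrow> R w \<rho> z A \<longrightarrow> R w \<rho> z' A) \<and> (PiF A \<longrightarrow> R w \<rho> z' A \<longrightarrow> R w \<rho> z A)"
proof (induction A arbitrary: w \<rho>)
  case (Conj A B) thus ?case using SigmaF_ConjD PiF_ConjD by (metis R.simps(4))
next
  case (Disj A B) thus ?case using SigmaF_DisjD PiF_DisjD by (metis R.simps(5))
next
  case (Imp A B)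
  have s: "le v v" "sub v z z'" if "le w v" for v using sub_mono le_refl Imp.prems that by blast+
  show ?case
  proof (intro conjI impI)
    assume S: "SigmaF (Imp A B)" and h: "R w \<rho> z (Imp A B)"
    show "R w \<rho> z' (Imp A B)" unfolding R.simps
      using h Imp.IH[OF s] SigmaF_ImpD[OF S] unfolding R.simps by blast
  next
    assume S: "PiF (Imp A B)" and h: "R w \<rho> z' (Imp A B)"
    show "R w \<rho> z (Imp A B)" unfolding R.simps
      using h Imp.IH[OF s] PiF_ImpD[OF S] unfolding R.simps by blast
  qed
next
  case (All x A)
  have s: "le v v" "sub v z z'" if "le w v" for v using sub_mono le_refl All.prems that by blast+
  have m: "mem v d z'" if "le w v" "d \<in> D v" "mem v d z" for v d using subD All.prems that by blast
  show ?case using All.IH[OF s] SigmaF_AllD[of x A] PiF_AllD[of x A] m unfolding R.simps by blast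
next
  case (Ex x A)
  have m: "mem w d z'" if "d \<in> D w" "mem w d z" for d using subD Ex.prems that by blast
  show ?case using Ex.IH[OF Ex.prems] SigmaF_ExD[of x A] PiF_ExD[of x A] m unfolding R.simps by blast
next
  case (BAll x s A)
  have s: "le v v" "sub v z z'" if "le w v" for v using sub_mono le_refl BAll.prems that by blast+
  show ?case using BAll.IH[OF s] SigmaF_BAllD[of x s A] PiF_BAllD[of x s A] unfolding R.simps by blast
next
  case (BEx x s A)
  show ?case using BEx.IH[OF BEx.prems] SigmaF_BExD[of x s A] PiF_BExD[of x s A] unfolding R.simps by blast
qed auto

lemma R_up: "SigmaF A \<Longrightarrow> le w w \<Longrightarrow> sub w z z' \<Longrightarrow> R w \<rho> z A \<Longrightarrow> R w \<rho> z' A"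
  and R_down: "PiF A \<Longrightarrow> le w w \<Longrightarrow> sub w z z' \<Longrightarrow> R w \<rho> z' A \<Longrightarrow> R w \<rho> z A"
  using R_sub by blast+

end

section \<open>Forcing \<Sigma> reflection\<close>

text \<open>The variable \<open>st\<close> stands for a varying stage, \<open>st'\<close> for a
  stage held fixed as a parameter, \<open>uu\<close> for a code; \<open>P\<close> and
  \<open>Z\<close> name a condition and a stage in the bounded formulas to which collection is
  applied. Relativizing to both \<open>st\<close> and \<open>st'\<close> brings the families A^y and
  the constant families A^z under one universal formula.\<close>

locale reflection = kripke_ikp +
  fixes L :: "fm set" and st st' uu P Z :: nat and U :: fm
  assumes distinct_vars: "distinct [st, st', uu, P, Z]"
    and fresh: "A \<in> L \<Longrightarrow> {st, st', uu, P, Z} \<inter> vars A = {}"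
    and L_atoms: "Mem 0 1 \<in> L" "Eq 0 1 \<in> L" "Bot \<in> L"
    and L_Conj: "Conj A B \<in> L \<Longrightarrow> A \<in> L \<and> B \<in> L"
    and L_Disj: "Disj A B \<in> L \<Longrightarrow> A \<in> L \<and> B \<in> L"
    and L_Imp: "Imp A B \<in> L \<Longrightarrow> A \<in> L \<and> B \<in> L"
    and L_All: "All x A \<in> L \<Longrightarrow> A \<in> L"
    and L_Ex: "Ex x A \<in> L \<Longrightarrow> A \<in> L"
    and L_BAll: "BAll x s A \<in> L \<Longrightarrow> A \<in> L"
    and L_BEx: "BEx x s A \<in> L \<Longrightarrow> A \<in> L"
    and universal: "universal_for U uu st
      ((\<lambda>(k, A). rel k A) ` ({st, st'} \<times> {A \<in> L. SigmaF A \<or> PiF A}))"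
begin

text \<open>Every bounded formula \<open>rel y A\<close> with \<open>A\<close> in \<open>L\<close> has codes \<open>c\<close>. A condition \<open>p\<close> is a set of codes,
  standing for the family \<open>\<Phi> p z\<close> of statements that decreases with the stage \<open>z\<close>; a goal is a single
  code, standing for a family that increases with the stage.\<close>

definition T :: "'a \<Rightarrow> 'b \<Rightarrow> 'b \<Rightarrow> bool" where
  "T w c y \<longleftrightarrow> sem w (\<lambda>i. if i = st then y else c) U"

text \<open>Evaluation at all members of the stage, rather than at the stage itself, makes this
  antitone in \<open>z\<close> for every element \<open>c\<close>, whatever it codes; the
  existential in \<open>\<Psi>\<close> has the dual effect. Thus no class of formulas has to be
  recognised inside the model.\<close>

definition \<Phi> :: "'a \<Rightarrow> 'b \<Rightarrow> 'b \<Rightarrow> bool" where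
  "\<Phi> w p z \<longleftrightarrow> (\<forall>v. le w v \<longrightarrow> (\<forall>c\<in>D v. \<forall>y\<in>D v. mem v c p \<longrightarrow> mem v y z \<longrightarrow> T v c y))"

definition \<Psi> :: "'a \<Rightarrow> 'b \<Rightarrow> 'b \<Rightarrow> bool" where
  "\<Psi> w c z \<longleftrightarrow> (\<exists>y\<in>D w. mem w y z \<and> T w c y)"

definition G :: "'a \<Rightarrow> 'b \<Rightarrow> 'b \<Rightarrow> bool" where
  "G w p c \<longleftrightarrow> (\<exists>z\<in>D w. \<forall>v. le w v \<longrightarrow> \<Phi> v p z \<longrightarrow> \<Psi> v c z)"

definition ple :: "'a \<times> 'b \<Rightarrow> 'a \<times> 'b \<Rightarrow> bool" where
  "ple a b \<longleftrightarrow> le (fst a) (fst b) \<and> snd a \<in> D (fst a) \<and> snd b \<in> D (fst b) \<and> sub (fst b) (snd a) (snd b)"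

lemma T_sem: "T w (\<rho> uu) (\<rho> st) \<longleftrightarrow> sem w \<rho> U"
  unfolding T_def using universal distinct_vars by (intro sem_cong) (auto simp: universal_for_def)

lemma ne: "st \<noteq> st'" "st \<noteq> uu" "st \<noteq> P" "st \<noteq> Z" "st' \<noteq> st" "st' \<noteq> uu" "st' \<noteq> P" "st' \<noteq> Z"
  "uu \<noteq> st" "uu \<noteq> st'" "uu \<noteq> P" "uu \<noteq> Z" "P \<noteq> st" "P \<noteq> st'" "P \<noteq> uu" "P \<noteq> Z"
  "Z \<noteq> st" "Z \<noteq> st'" "Z \<noteq> uu" "Z \<noteq> P"
  using distinct_vars by auto

lemma Delta0_U: "Delta0 U"
  using universal by (auto simp: universal_for_def)

lemma T_mono: "T w c y \<Longrightarrow> le w v \<Longrightarrow> T v c y"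
  unfolding T_def by (rule sem_mono)

lemma T_eq: assumes "eq w c c'" "le w w" "c \<in> D w" "c' \<in> D w" "y \<in> D w" shows "T w c y \<longleftrightarrow> T w c' y"
proof -
  have "env_eq w (\<lambda>i. if i = st then y else c) (\<lambda>i. if i = st then y else c')"
    using assms by (auto simp: env_eq_def eq_refl)
  thus ?thesis unfolding T_def by (rule sem_eq_cong)
qed

lemma \<Phi>_mono: "\<Phi> w p z \<Longrightarrow> le w v \<Longrightarrow> \<Phi> v p z"
  unfolding \<Phi>_def using le_trans by meson

lemma \<Phi>_anti: "\<Phi> w q z' \<Longrightarrow> sub w p q \<Longrightarrow> sub w z z' \<Longrightarrow> \<Phi> w p z"
  unfolding \<Phi>_def using subD by meson

lemma \<Psi>_mono: "\<Psi> w c z \<Longrightarrow> le w v \<Longrightarrow> \<Psi> v c z"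
  unfolding \<Psi>_def using D_mono mem_mono T_mono by (meson subsetD)

lemma \<Psi>_sub: "\<Psi> w c z \<Longrightarrow> le w w \<Longrightarrow> sub w z z' \<Longrightarrow> \<Psi> w c z'"
  unfolding \<Psi>_def using subD by meson

lemma ple_pair: "ple (w, p) (v, q) \<longleftrightarrow> le w v \<and> p \<in> D w \<and> q \<in> D v \<and> sub v p q"
  by (simp add: ple_def)

lemma ple_same: "le w v \<Longrightarrow> p \<in> D w \<Longrightarrow> ple (w, p) (v, p)"
  using D_mono sub_refl by (auto simp: ple_pair)

lemma ple_trans: "ple a b \<Longrightarrow> ple b c \<Longrightarrow> ple a c"
  unfolding ple_def using le_trans sub_trans sub_mono by meson

text \<open>A point of the forcing order is a world together with a condition living there. Every
  element of the domain counts as a goal.\<close>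

sublocale fc: goal_forcing ple "\<lambda>a. D (fst a)" "\<lambda>a. mem (fst a)" "\<lambda>a. eq (fst a)" "\<lambda>a. D (fst a)" "\<lambda>a. G (fst a) (snd a)"
proof
  fix a b c
  show "ple a b \<Longrightarrow> ple a a" "ple a b \<Longrightarrow> ple b b" unfolding ple_def using le_refl sub_refl by blast+
  show "ple a b \<Longrightarrow> ple b c \<Longrightarrow> ple a c" by (rule ple_trans)
  show "ple a b \<Longrightarrow> D (fst a) \<subseteq> D (fst b)" unfolding ple_def using D_mono by blast
next
  fix w v x y assume "ple w v"
  hence l: "le (fst w) (fst v)" by (simp add: ple_def)
  show "mem (fst w) x y \<Longrightarrow> mem (fst v) x y" by (rule mem_mono[OF l])
  show "eq (fst w) x y \<Longrightarrow> eq (fst v) x y" by (rule eq_mono[OF l])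
next
  fix w x assume "ple w w" "x \<in> D (fst w)"
  thus "eq (fst w) x x" by (simp add: ple_def eq_refl)
next
  fix w x y z assume "eq (fst w) x y" "ple w w" and D: "x \<in> D (fst w)" "y \<in> D (fst w)" "z \<in> D (fst w)"
  hence e: "eq (fst w) x y" and l: "le (fst w) (fst w)" by (simp_all add: ple_def)
  show "mem (fst w) x z \<Longrightarrow> mem (fst w) y z" using eq_mem1[OF e _ l D] .
  show "mem (fst w) z x \<Longrightarrow> mem (fst w) z y" using eq_mem2[OF e _ l D] .
  show "eq (fst w) x z \<Longrightarrow> eq (fst w) y z" using eq_eq[OF e _ l D] .
qed

lemma cl_pair: "fc.cl X (w, p) \<longleftrightarrow> (\<forall>v q. ple (w, p) (v, q) \<longrightarrow> (\<forall>c\<in>D v.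
    (\<forall>u r. ple (v, q) (u, r) \<longrightarrow> X (u, r) \<longrightarrow> G u r c) \<longrightarrow> G v q c))"
  unfolding fc.cl_def by (simp add: split_paired_All)

definition phiF :: fm where "phiF = BAll uu P (BAll st Z U)"
definition psiF :: fm where "psiF = BEx st Z U"

lemma Delta0_phiF: "Delta0 phiF" and Delta0_psiF: "Delta0 psiF"
  unfolding phiF_def psiF_def using distinct_vars by (auto intro!: Delta0.intros Delta0_U)

lemma sem_phiF: assumes "le w w" shows "sem w \<rho> phiF \<longleftrightarrow> \<Phi> w (\<rho> P) (\<rho> Z)"
proof -
  have U: "sem v (\<rho>(uu := c, st := y)) U = T v c y" for v c y
    using T_sem[of v "\<rho>(uu := c, st := y)"] ne by simp
  have "sem w \<rho> phiF \<longleftrightarrow> (\<forall>v. le w v \<longrightarrow> (\<forall>c\<in>D v. mem v c (\<rho> P) \<longrightarrow>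
      (\<forall>u. le v u \<longrightarrow> (\<forall>y\<in>D u. mem u y (\<rho> Z) \<longrightarrow> T u c y))))"
    unfolding phiF_def sem.simps U using ne by simp
  also have "\<dots> \<longleftrightarrow> \<Phi> w (\<rho> P) (\<rho> Z)"
    unfolding \<Phi>_def by (meson le_trans le_refl D_mono mem_mono subsetD)
  finally show ?thesis .
qed

lemma sem_psiF: "sem w \<rho> psiF \<longleftrightarrow> \<Psi> w (\<rho> uu) (\<rho> Z)"
proof -
  have U: "sem v (\<rho>(st := y)) U = T v (\<rho> uu) y" for v y
    using T_sem[of v "\<rho>(st := y)"] ne by simp
  show ?thesis unfolding psiF_def \<Psi>_def sem.simps U using ne by simp
qed

text \<open>Collection over a subset of a singleton commutes the unbounded witness past a bounded
  premise.\<close>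

lemma glue:
  assumes w: "le w w" "q \<in> D w" "c \<in> D w" "z \<in> D w"
    and h: "\<And>v. le w v \<Longrightarrow> \<Phi> v q z \<Longrightarrow> G v q c"
  shows "G w q c"
proof -
  define \<rho> where "\<rho> = (\<lambda>_. c)(P := q, Z := z)"
  have \<rho>: "range \<rho> \<subseteq> D w" using w unfolding \<rho>_def by (intro env_upd) auto
  have a: "Delta0 (Imp phiF psiF)" by (intro Delta0.intros Delta0_phiF Delta0_psiF)
  have val: "\<rho> P = q" "\<rho> Z = z" "(\<rho>(Z := e)) P = q" "(\<rho>(Z := e)) Z = e" "(\<rho>(Z := e)) uu = c" for e
    using ne by (auto simp: \<rho>_def)
  have s: "sem v (\<rho>(Z := e)) (Imp phiF psiF) \<longleftrightarrow> (\<forall>u. le v u \<longrightarrow> \<Phi> u q e \<longrightarrow> \<Psi> u c e)" for v e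
    unfolding sem.simps sem_psiF val using sem_phiF le_refl val by metis
  have "\<exists>e\<in>D v. sem v (\<rho>(Z := e)) (Imp phiF psiF)" if "le w v" "sem v \<rho> phiF" for v
    using h[OF that(1)] that(2) le_refl(2)[OF that(1)] unfolding s sem_phiF[OF le_refl(2)[OF that(1)]] val G_def by blast
  then obtain b where b: "b \<in> D w" "\<And>v. le w v \<Longrightarrow> sem v \<rho> phiF \<Longrightarrow>
      \<exists>e\<in>D v. mem v e b \<and> sem v (\<rho>(Z := e)) (Imp phiF psiF)"
    using bounded_choice[OF Delta0_phiF a w(1) \<rho>, of Z] by blast
  obtain t where t: "t \<in> D w" "\<And>v e. le w v \<Longrightarrow> e \<in> D v \<Longrightarrow> mem v e b \<Longrightarrow> sub v e t"
    using union_bound[OF w(1) b(1)] by blast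
  obtain z' where z': "z' \<in> D w" "sub w z z'" "sub w t z'" using upper_bound[OF w(1,4) t(1)] by blast
  have "\<Psi> v c z'" if v: "le w v" "\<Phi> v q z'" for v
  proof -
    have vv: "le v v" using le_refl v by blast
    have "\<Phi> v q z" using \<Phi>_anti[OF v(2) sub_refl sub_mono[OF z'(2) v(1)]] .
    then obtain e where e: "e \<in> D v" "mem v e b" "\<And>u. le v u \<Longrightarrow> \<Phi> u q e \<Longrightarrow> \<Psi> u c e"
      using b(2)[OF v(1)] unfolding s sem_phiF[OF vv] val by blast
    have ez: "sub v e z'" using sub_trans[OF t(2)[OF v(1) e(1,2)] sub_mono[OF z'(3) v(1)]] .
    have "\<Phi> v q e" using \<Phi>_anti[OF v(2) sub_refl ez] .
    thus ?thesis using \<Psi>_sub[OF e(3)[OF vv] vv ez] by blast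
  qed
  thus ?thesis unfolding G_def using z'(1) by blast
qed

text \<open>\<open>glue\<close> discharges a bounded assumption in front of a goal, and closure
  under the goals carries this over to every formula.\<close>

lemma glue_frc:
  assumes w: "le w w" "q \<in> D w" "z \<in> D w"
    and h: "\<And>v. le w v \<Longrightarrow> \<Phi> v q z \<Longrightarrow> fc.frc (v, q) \<rho> A"
  shows "fc.frc (w, q) \<rho> A"
proof (rule fc.frc_closed)
  show "ple (w, q) (w, q)" using ple_same w by blast
  show "fc.cl (\<lambda>b. fc.frc b \<rho> A) (w, q)"
    unfolding cl_pair
  proof (intro HOL.allI impI ballI)
    fix v r c
    assume v: "ple (w, q) (v, r)" "c \<in> D v"
      and g: "\<forall>u s. ple (v, r) (u, s) \<longrightarrow> fc.frc (u, s) \<rho> A \<longrightarrow> G u s c"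
    have v': "le w v" "r \<in> D v" "sub v q r" "le v v" using v le_refl by (auto simp: ple_pair)
    show "G v r c"
    proof (rule glue[OF v'(4,2) v(2), of z])
      show "z \<in> D v" using w v' D_mono by blast
      fix u assume u: "le v u" "\<Phi> u r z"
      have "le w u" "\<Phi> u q z" using le_trans[OF v'(1) u(1)] \<Phi>_anti[OF u(2) sub_mono[OF v'(3) u(1)] sub_refl] by auto
      hence "fc.frc (u, q) \<rho> A" by (rule h)
      moreover have "ple (u, q) (u, r)"
        using u v' w \<open>le w u\<close> D_mono le_refl by (auto simp: ple_pair intro: sub_mono)
      ultimately have "fc.frc (u, r) \<rho> A" using fc.frc_mono by blast
      thus "G u r c" using g ple_same u(1) v'(2) by blast
    qed
  qed
qed

text \<open>The exact union of \<open>p\<close> and the singleton of \<open>u\<close> is separated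
  from an upper bound of both. A larger set would not do, since \<open>\<Phi>\<close> for
  \<open>q\<close> may assume nothing beyond \<open>p\<close> and \<open>u\<close>.\<close>

lemma extend_condition:
  assumes w: "le w w" "p \<in> D w" "u \<in> D w"
  obtains q where "q \<in> D w" "sub w p q"
    "\<And>v y z. le w v \<Longrightarrow> \<Phi> v q z \<Longrightarrow> y \<in> D v \<Longrightarrow> mem v y z \<Longrightarrow> T v u y"
    "\<And>v z. le w v \<Longrightarrow> \<Phi> v p z \<Longrightarrow> (\<And>v' y. le v v' \<Longrightarrow> y \<in> D v' \<Longrightarrow> mem v' y z \<Longrightarrow> T v' u y) \<Longrightarrow> \<Phi> v q z"
proof -
  obtain s where s: "s \<in> D w" "mem w u s" using ex_pair[OF w(1,3,3)] by blast
  obtain c where c: "c \<in> D w" "sub w p c" "sub w s c" using upper_bound[OF w(1,2) s(1)] by blast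
  define \<rho> where "\<rho> = (\<lambda>i::nat. if i = 1 then p else u)"
  have \<rho>: "range \<rho> \<subseteq> D w" using w by (auto simp: \<rho>_def)
  have "Delta0 (Disj (Mem 0 1) (Eq 0 2))" by (intro Delta0.intros)
  then obtain q where q: "q \<in> D w" "\<And>v d. le w v \<Longrightarrow> d \<in> D v \<Longrightarrow> mem v d q \<longleftrightarrow> mem v d c \<and>
      sem v (\<rho>(0 := d)) (Disj (Mem 0 1) (Eq 0 2))"
    using separation[OF _ w(1) \<rho> c(1)] by blast
  have q': "mem v d q \<longleftrightarrow> mem v d c \<and> (mem v d p \<or> eq v d u)" if "le w v" "d \<in> D v" for v d
    using q(2)[OF that] by (simp add: \<rho>_def)
  have u: "mem w u q" using q'[OF w(1,3)] subD[OF c(3) w(1,3) s(2)] eq_refl[OF w(1,3)] by blast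
  show ?thesis
  proof (rule that[OF q(1)])
    show "sub w p q" unfolding sub_def using q' subD[OF c(2)] by blast
  next
    fix v y z assume h: "le w v" "\<Phi> v q z" "y \<in> D v" "mem v y z"
    have "u \<in> D v" "mem v u q" "le v v" using u w(3) h(1) D_mono mem_mono le_refl by blast+
    thus "T v u y" using h unfolding \<Phi>_def by blast
  next
    fix v z assume h: "le w v" "\<Phi> v p z" and t: "\<And>v' y. le v v' \<Longrightarrow> y \<in> D v' \<Longrightarrow> mem v' y z \<Longrightarrow> T v' u y"
    show "\<Phi> v q z" unfolding \<Phi>_def
    proof (intro HOL.allI impI ballI)
      fix v' d y assume v': "le v v'" "d \<in> D v'" "y \<in> D v'" "mem v' d q" "mem v' y z"
      have wv: "le w v'" using le_trans[OF h(1) v'(1)] .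
      have "mem v' d p \<or> eq v' d u" using q'[OF wv v'(2)] v'(4) by blast
      thus "T v' d y"
      proof
        assume "mem v' d p" thus ?thesis using h(2) v' unfolding \<Phi>_def by blast
      next
        assume "eq v' d u"
        moreover have "le v' v'" "u \<in> D v'" using w(3) D_mono[OF wv] le_refl(2)[OF wv] by blast+
        ultimately show ?thesis using T_eq v'(2,3) t[OF v'(1,3,5)] by blast
      qed
    qed
  qed
qed

text \<open>The first part codes the family A^y indexed by the stage, for \<Sigma> goals and \<Pi>
  assumptions. The second codes the constant family A^z, for places where the stage is prescribed:
  \<Pi> goals and the antecedents of \<Pi> implications.\<close>

definition coded :: "fm \<Rightarrow> bool" where
  "coded A \<longleftrightarrow> (\<forall>w \<rho>. le w w \<longrightarrow> range \<rho> \<subseteq> D w \<longrightarrow>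
    (\<exists>c\<in>D w. \<forall>v y. le w v \<longrightarrow> y \<in> D v \<longrightarrow> (T v c y \<longleftrightarrow> R v \<rho> y A)) \<and>
    (\<forall>z\<in>D w. \<exists>c\<in>D w. \<forall>v y. le w v \<longrightarrow> y \<in> D v \<longrightarrow> (T v c y \<longleftrightarrow> R v \<rho> z A)))"

lemma codedE:
  assumes "coded A" "le w w" "range \<rho> \<subseteq> D w"
  obtains c where "c \<in> D w" "\<And>v y. le w v \<Longrightarrow> y \<in> D v \<Longrightarrow> T v c y \<longleftrightarrow> R v \<rho> y A"
proof -
  have "\<exists>c\<in>D w. \<forall>v y. le w v \<longrightarrow> y \<in> D v \<longrightarrow> (T v c y \<longleftrightarrow> R v \<rho> y A)"
    using assms unfolding coded_def by simp
  thus ?thesis using that by blast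
qed

lemma coded_constE:
  assumes "coded A" "le w w" "range \<rho> \<subseteq> D w" "z \<in> D w"
  obtains c where "c \<in> D w" "\<And>v y. le w v \<Longrightarrow> y \<in> D v \<Longrightarrow> T v c y \<longleftrightarrow> R v \<rho> z A"
proof -
  have "\<exists>c\<in>D w. \<forall>v y. le w v \<longrightarrow> y \<in> D v \<longrightarrow> (T v c y \<longleftrightarrow> R v \<rho> z A)"
    using assms unfolding coded_def by simp
  thus ?thesis using that by blast
qed

lemma coded_L:
  assumes A: "A \<in> L" "SigmaF A \<or> PiF A"
  shows "coded A"
  unfolding coded_def
proof (intro HOL.allI impI conjI ballI)
  fix w and \<rho> :: "nat \<Rightarrow> 'b" assume w: "le w w" "range \<rho> \<subseteq> D w"
  have k: "st \<notin> vars A" "st' \<notin> vars A" using fresh[OF A(1)] by auto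
  have mem: "rel k A \<in> (\<lambda>(k, A). rel k A) ` ({st, st'} \<times> {A \<in> L. SigmaF A \<or> PiF A})" if "k \<in> {st, st'}" for k
    using A that by force
  have T: "sem v (\<rho>(uu := c, st := y)) U \<longleftrightarrow> T v c y" for v c y and \<rho> :: "nat \<Rightarrow> 'b"
    using T_sem[of v "\<rho>(uu := c, st := y)"] ne by simp
  show "\<exists>c\<in>D w. \<forall>v y. le w v \<longrightarrow> y \<in> D v \<longrightarrow> (T v c y \<longleftrightarrow> R v \<rho> y A)"
  proof -
    obtain c where "c \<in> D w" "\<And>v y. le w v \<Longrightarrow> y \<in> D v \<Longrightarrow> R v \<rho> y A \<longleftrightarrow> T v c y"
      using universal_forE[OF universal mem w, of st] unfolding sem_rel[OF k(1)] T by auto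
    thus ?thesis by (intro bexI[of _ c]) auto
  qed
  fix z assume z: "z \<in> D w"
  have s: "sem v (\<rho>(st' := z, st := y)) (rel st' A) \<longleftrightarrow> R v \<rho> z A" for v y
    using sem_rel[OF k(2), of v "\<rho>(st := y)" z] R_cong[of A "\<rho>(st := y)" \<rho> v z] nonvar_nonfree[OF k(1)]
      fun_upd_twist[of st' st \<rho> z y] ne by auto
  show "\<exists>c\<in>D w. \<forall>v y. le w v \<longrightarrow> y \<in> D v \<longrightarrow> (T v c y \<longleftrightarrow> R v \<rho> z A)"
  proof -
    obtain c where "c \<in> D w" "\<And>v y. le w v \<Longrightarrow> y \<in> D v \<Longrightarrow> R v \<rho> z A \<longleftrightarrow> T v c y"
      using universal_forE[OF universal mem w(1) env_upd[OF w(2) z], of st' st'] unfolding s T by auto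
    thus ?thesis by (intro bexI[of _ c]) auto
  qed
qed

text \<open>Atomic formulas have codes whatever their variables, since parameters can be plugged into the
  atoms of \<open>L\<close>.\<close>

lemma coded_atom:
  assumes "A = Bot \<or> (\<exists>x y. A = Mem x y) \<or> (\<exists>x y. A = Eq x y)"
  shows "coded A"
proof -
  have *: "coded (B x y)" if "coded (B 0 1)"
    and s: "\<And>v \<rho> z x y. R v \<rho> z (B x y) \<longleftrightarrow> R v ((\<lambda>i. if i = 0 then \<rho> x else \<rho> y)) z (B 0 1)" for B x y
    unfolding coded_def
  proof (intro HOL.allI impI)
    fix w and \<rho> :: "nat \<Rightarrow> 'b" assume w: "le w w" "range \<rho> \<subseteq> D w"
    let ?r = "\<lambda>i::nat. if i = 0 then \<rho> x else \<rho> y"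
    have "range ?r \<subseteq> D w" using w by auto
    thus "(\<exists>c\<in>D w. \<forall>v y'. le w v \<longrightarrow> y' \<in> D v \<longrightarrow> (T v c y' \<longleftrightarrow> R v \<rho> y' (B x y))) \<and>
      (\<forall>z\<in>D w. \<exists>c\<in>D w. \<forall>v y'. le w v \<longrightarrow> y' \<in> D v \<longrightarrow> (T v c y' \<longleftrightarrow> R v \<rho> z (B x y)))"
      using \<open>coded (B 0 1)\<close> w(1) unfolding coded_def s[of _ \<rho> _ x y] by blast
  qed
  have "coded (Mem 0 1)" "coded (Eq 0 1)" "coded Bot"
    by (intro coded_L L_atoms disjI1 SigmaF_Delta0 Delta0.intros)+
  thus ?thesis using assms *[of Mem] *[of Eq] by auto
qed

section \<open>Descriptions of forcing by stages\<close>

definition at_stage :: "'a \<Rightarrow> 'b \<Rightarrow> (nat \<Rightarrow> 'b) \<Rightarrow> fm \<Rightarrow> bool" where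
  "at_stage w p \<rho> A \<longleftrightarrow> (\<exists>z\<in>D w. \<forall>v. le w v \<longrightarrow> \<Phi> v p z \<longrightarrow> R v \<rho> z A)"

definition at_stages :: "'a \<Rightarrow> 'b \<Rightarrow> (nat \<Rightarrow> 'b) \<Rightarrow> fm \<Rightarrow> bool" where
  "at_stages w p \<rho> A \<longleftrightarrow> (\<forall>v. le w v \<longrightarrow> (\<forall>z\<in>D v. \<exists>z'\<in>D v. \<forall>u. le v u \<longrightarrow> \<Phi> u p z' \<longrightarrow> R u \<rho> z A))"

definition sigma_char :: "fm \<Rightarrow> bool" where
  "sigma_char A \<longleftrightarrow> (\<forall>w p \<rho>. le w w \<longrightarrow> p \<in> D w \<longrightarrow> range \<rho> \<subseteq> D w \<longrightarrow> (fc.frc (w, p) \<rho> A \<longleftrightarrow> at_stage w p \<rho> A))"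

definition pi_char :: "fm \<Rightarrow> bool" where
  "pi_char A \<longleftrightarrow> (\<forall>w p \<rho>. le w w \<longrightarrow> p \<in> D w \<longrightarrow> range \<rho> \<subseteq> D w \<longrightarrow> (fc.frc (w, p) \<rho> A \<longleftrightarrow> at_stages w p \<rho> A))"

lemma sigma_charD: "sigma_char A \<Longrightarrow> le w w \<Longrightarrow> p \<in> D w \<Longrightarrow> range \<rho> \<subseteq> D w \<Longrightarrow> fc.frc (w, p) \<rho> A \<longleftrightarrow> at_stage w p \<rho> A"
  by (simp add: sigma_char_def)

lemma pi_charD: "pi_char A \<Longrightarrow> le w w \<Longrightarrow> p \<in> D w \<Longrightarrow> range \<rho> \<subseteq> D w \<Longrightarrow> fc.frc (w, p) \<rho> A \<longleftrightarrow> at_stages w p \<rho> A"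
  by (simp add: pi_char_def)

lemma at_stageI: "z \<in> D w \<Longrightarrow> (\<And>v. le w v \<Longrightarrow> \<Phi> v p z \<Longrightarrow> R v \<rho> z A) \<Longrightarrow> at_stage w p \<rho> A"
  unfolding at_stage_def by blast

lemma at_stageE:
  assumes "at_stage w p \<rho> A"
  obtains z where "z \<in> D w" "\<And>v. le w v \<Longrightarrow> \<Phi> v p z \<Longrightarrow> R v \<rho> z A"
  using assms unfolding at_stage_def by blast

lemma at_stagesI:
  "(\<And>v z. le w v \<Longrightarrow> z \<in> D v \<Longrightarrow> \<exists>z'\<in>D v. \<forall>u. le v u \<longrightarrow> \<Phi> u p z' \<longrightarrow> R u \<rho> z A) \<Longrightarrow> at_stages w p \<rho> A"
  unfolding at_stages_def by blast

lemma at_stagesE: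
  assumes "at_stages w p \<rho> A" "le w v" "z \<in> D v"
  obtains z' where "z' \<in> D v" "\<And>u. le v u \<Longrightarrow> \<Phi> u p z' \<Longrightarrow> R u \<rho> z A"
  using assms unfolding at_stages_def by blast

text \<open>In the two elimination lemmas the formula itself is used as a goal.\<close>

lemma cl_sigma_elim:
  assumes w: "le w w" "p \<in> D w" "range \<rho> \<subseteq> D w" and A: "coded A" "SigmaF A"
    and cl: "fc.cl X (w, p)" and X: "\<And>v q. ple (w, p) (v, q) \<Longrightarrow> X (v, q) \<Longrightarrow> at_stage v q \<rho> A"
  shows "at_stage w p \<rho> A"
proof -
  obtain c where c: "c \<in> D w" "\<And>v y. le w v \<Longrightarrow> y \<in> D v \<Longrightarrow> T v c y \<longleftrightarrow> R v \<rho> y A"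
    using codedE[OF A(1) w(1,3)] by blast
  have "G v q c" if h: "ple (w, p) (v, q)" "X (v, q)" for v q
  proof -
    have v: "le w v" "le v v" using h le_refl by (auto simp: ple_pair)
    obtain z where z: "z \<in> D v" "\<And>u. le v u \<Longrightarrow> \<Phi> u q z \<Longrightarrow> R u \<rho> z A"
      using X[OF h] by (rule at_stageE) blast
    \<comment> \<open>\<open>\<Psi>\<close> asks for a member of the stage at which the formula
      holds, so \<open>z\<close> has to be a member of \<open>t\<close>; being also a subset, it
      inherits \<open>\<Phi>\<close> from \<open>t\<close>.\<close>
    obtain t where t: "t \<in> D v" "sub v z t" "mem v z t" using inhabited_bound[OF v(2) z(1)] by blast
    have "\<Psi> u c t" if u: "le v u" "\<Phi> u q t" for u
    proof -
      have "\<Phi> u q z" using \<Phi>_anti[OF u(2) sub_refl sub_mono[OF t(2) u(1)]] .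
      hence "R u \<rho> z A" using z(2) u by blast
      moreover have "z \<in> D u" "mem u z t" using z(1) t(3) u D_mono mem_mono by blast+
      ultimately show ?thesis unfolding \<Psi>_def using c(2) le_trans[OF v(1) u(1)] by blast
    qed
    thus ?thesis unfolding G_def using t(1) by blast
  qed
  hence "G w p c" using cl ple_same[OF w(1,2)] c(1) unfolding cl_pair by blast
  then obtain z where z: "z \<in> D w" "\<And>v. le w v \<Longrightarrow> \<Phi> v p z \<Longrightarrow> \<Psi> v c z" unfolding G_def by blast
  \<comment> \<open>The goal yields the formula only at some member of \<open>z\<close>. All these
    members lie below \<open>t\<close>, and a \<Sigma> formula moves up to it.\<close>
  obtain t where t: "t \<in> D w" "sub w z t" "\<And>v y. le w v \<Longrightarrow> y \<in> D v \<Longrightarrow> mem v y z \<Longrightarrow> sub v y t"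
    using transitive_bound[OF w(1) z(1)] by blast
  show ?thesis
  proof (rule at_stageI[OF t(1)])
    fix v assume v: "le w v" "\<Phi> v p t"
    have "\<Phi> v p z" using \<Phi>_anti[OF v(2) sub_refl sub_mono[OF t(2) v(1)]] .
    then obtain y where y: "y \<in> D v" "mem v y z" "T v c y" using z(2) v unfolding \<Psi>_def by blast
    hence "R v \<rho> y A" using c(2) v by blast
    thus "R v \<rho> t A" using R_up[OF A(2) le_refl(2)[OF v(1)] t(3)[OF v(1) y(1,2)]] by blast
  qed
qed

lemma cl_pi_elim:
  assumes w: "le w w" "p \<in> D w" "range \<rho> \<subseteq> D w" and A: "coded A"
    and cl: "fc.cl X (w, p)" and X: "\<And>v q. ple (w, p) (v, q) \<Longrightarrow> X (v, q) \<Longrightarrow> at_stages v q \<rho> A"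
  shows "at_stages w p \<rho> A"
proof (rule at_stagesI)
  fix v z assume v: "le w v" and z: "z \<in> D v"
  have vv: "le v v" and pv: "p \<in> D v" "ple (w, p) (v, p)"
    using le_refl(2)[OF v] D_mono[OF v] ple_same[OF v w(2)] w(2) by auto
  obtain c where c: "c \<in> D v" "\<And>u y. le v u \<Longrightarrow> y \<in> D u \<Longrightarrow> T u c y \<longleftrightarrow> R u \<rho> z A"
    using coded_constE[OF A vv env_mono[OF w(3) v] z] by blast
  have "G u q c" if h: "ple (v, p) (u, q)" "X (u, q)" for u q
  proof -
    have wu: "ple (w, p) (u, q)" using ple_trans[OF pv(2) h(1)] .
    have u: "le v u" "le u u" using h le_refl by (auto simp: ple_pair)
    have "z \<in> D u" using z D_mono[OF u(1)] by blast
    then obtain z' where z': "z' \<in> D u" "\<And>t. le u t \<Longrightarrow> \<Phi> t q z' \<Longrightarrow> R t \<rho> z A"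
      using at_stagesE[OF X[OF wu h(2)] u(2)] by blast
    \<comment> \<open>This goal does not depend on the member picked from the stage;
      \<open>z'\<close> is made a member of \<open>t\<close> so that there is one.\<close>
    obtain t where t: "t \<in> D u" "sub u z' t" "mem u z' t" using inhabited_bound[OF u(2) z'(1)] by blast
    have "\<Psi> x c t" if x: "le u x" "\<Phi> x q t" for x
    proof -
      have "\<Phi> x q z'" using \<Phi>_anti[OF x(2) sub_refl sub_mono[OF t(2) x(1)]] .
      hence "R x \<rho> z A" using z'(2) x by blast
      moreover have "z' \<in> D x" "mem x z' t" using z'(1) t(3) x D_mono mem_mono by blast+
      ultimately show ?thesis unfolding \<Psi>_def using c(2) le_trans[OF u(1) x(1)] by blast
    qed
    thus ?thesis unfolding G_def using t(1) by blast
  qed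
  hence "G v p c" using cl pv(2) c(1) unfolding cl_pair by blast
  then obtain z' where z': "z' \<in> D v" "\<And>u. le v u \<Longrightarrow> \<Phi> u p z' \<Longrightarrow> \<Psi> u c z'" unfolding G_def by blast
  have "R u \<rho> z A" if u: "le v u" "\<Phi> u p z'" for u
  proof -
    obtain y where "y \<in> D u" "T u c y" using z'(2)[OF u] unfolding \<Psi>_def by blast
    thus ?thesis using c(2)[OF u(1)] by simp
  qed
  thus "\<exists>z'\<in>D v. \<forall>u. le v u \<longrightarrow> \<Phi> u p z' \<longrightarrow> R u \<rho> z A"
    using z'(1) by blast
qed

text \<open>Under the bounded assumption \<open>\<Phi>\<close> at the stage \<open>z\<close>, the
  relativized formula is true, hence so are \<open>X\<close> and every goal that \<open>X\<close>
  implies. \<open>glue\<close> removes the assumption.\<close>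

lemma cl_sigma_intro:
  assumes w: "le w w" "p \<in> D w" "range \<rho> \<subseteq> D w" and ch: "at_stage w p \<rho> A"
    and X: "\<And>v q z. ple (w, p) (v, q) \<Longrightarrow> z \<in> D v \<Longrightarrow> R v \<rho> z A \<Longrightarrow> X (v, q)"
  shows "fc.cl X (w, p)"
  unfolding cl_pair
proof (intro HOL.allI impI ballI)
  fix v q c
  assume v: "ple (w, p) (v, q)" "c \<in> D v" and g: "\<forall>u r. ple (v, q) (u, r) \<longrightarrow> X (u, r) \<longrightarrow> G u r c"
  obtain z where z: "z \<in> D w" "\<And>v. le w v \<Longrightarrow> \<Phi> v p z \<Longrightarrow> R v \<rho> z A" using ch by (rule at_stageE) blast
  have v': "le w v" "q \<in> D v" "sub v p q" "le v v" using v le_refl by (auto simp: ple_pair)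
  show "G v q c"
  proof (rule glue[OF v'(4,2) v(2), of z])
    show "z \<in> D v" using z(1) D_mono[OF v'(1)] by blast
    fix u assume u: "le v u" "\<Phi> u q z"
    have wu: "le w u" using le_trans[OF v'(1) u(1)] .
    have "\<Phi> u p z" using \<Phi>_anti[OF u(2) sub_mono[OF v'(3) u(1)] sub_refl] .
    hence "R u \<rho> z A" using z(2) wu by blast
    moreover have "ple (v, q) (u, q)" using ple_same u v' by blast
    moreover have "z \<in> D u" using z(1) D_mono[OF wu] by blast
    ultimately have "X (u, q)" using X ple_trans[OF v(1)] by blast
    thus "G u q c" using g \<open>ple (v, q) (u, q)\<close> by blast
  qed
qed

end

section \<open>Forced \<Sigma> and \<Pi> formulas\<close>

context reflection
begin

lemma frc_Imp: "fc.frc (w, p) \<rho> (Imp A B) \<longleftrightarrow>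
    (\<forall>v q. ple (w, p) (v, q) \<longrightarrow> fc.frc (v, q) \<rho> A \<longrightarrow> fc.frc (v, q) \<rho> B)"
  by (simp add: split_paired_All)

lemma frc_All: "fc.frc (w, p) \<rho> (All x A) \<longleftrightarrow>
    (\<forall>v q. ple (w, p) (v, q) \<longrightarrow> (\<forall>d\<in>D v. fc.frc (v, q) (\<rho>(x := d)) A))"
  by (simp add: split_paired_All)

lemma frc_BAll: "fc.frc (w, p) \<rho> (BAll x s A) \<longleftrightarrow>
    (\<forall>v q. ple (w, p) (v, q) \<longrightarrow> (\<forall>d\<in>D v.
      fc.frc (v, q) (\<rho>(x := d)) (Mem x s) \<longrightarrow> fc.frc (v, q) (\<rho>(x := d)) A))"
  unfolding fc.frc.simps by (simp add: split_paired_All del: fun_upd_apply) simp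

lemma pleD: assumes "ple (w, p) (v, q)"
  shows "le w v" "le w w" "le v v" "p \<in> D w" "q \<in> D v" "sub v p q" "p \<in> D v"
  using assms le_refl[of w v] D_mono[of w v] unfolding ple_pair by (simp_all add: subset_iff)

lemma ple_env: "ple (w, p) (v, q) \<Longrightarrow> range \<rho> \<subseteq> D w \<Longrightarrow> range \<rho> \<subseteq> D v"
  by (rule env_mono[OF _ pleD(1)])

lemma at_stage_now: "z \<in> D v \<Longrightarrow> R v \<rho> z A \<Longrightarrow> at_stage v q \<rho> A"
  by (rule at_stageI) (auto intro: R_mono)

lemma \<Phi>_sub: "\<Phi> v p z' \<Longrightarrow> sub w z z' \<Longrightarrow> le w v \<Longrightarrow> \<Phi> v p z"
  by (rule \<Phi>_anti[OF _ sub_refl sub_mono])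

lemma \<Phi>_ple: "\<Phi> u q z \<Longrightarrow> ple (w, p) (v, q) \<Longrightarrow> le v u \<Longrightarrow> \<Phi> u p z"
  by (rule \<Phi>_anti[OF _ sub_mono[OF pleD(6)] sub_refl])

text \<open>Relativization does not change an atom, so holding at some stage and at all stages
  amount to the same, and the \<Pi> description is obtained from the \<Sigma> one.\<close>

lemma atom_char:
  assumes A: "coded A" "SigmaF A"
    and frc: "\<And>w p \<rho>. fc.frc (w, p) \<rho> A \<longleftrightarrow> fc.cl (X \<rho>) (w, p)"
    and X: "\<And>v q \<rho> z. X \<rho> (v, q) \<longleftrightarrow> R v \<rho> z A"
  shows "sigma_char A" "pi_char A"
proof -
  show S: "sigma_char A" unfolding sigma_char_def
  proof (intro HOL.allI impI iffI)
    fix w p and \<rho> :: "nat \<Rightarrow> 'b" assume w: "le w w" "p \<in> D w" "range \<rho> \<subseteq> D w"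
    show "at_stage w p \<rho> A" if "fc.frc (w, p) \<rho> A"
    proof (rule cl_sigma_elim[OF w A that[unfolded frc]])
      fix v q assume h: "ple (w, p) (v, q)" "X \<rho> (v, q)"
      show "at_stage v q \<rho> A" by (rule at_stage_now[OF pleD(5)[OF h(1)]]) (use h(2) X in blast)
    qed
    show "fc.frc (w, p) \<rho> A" if "at_stage w p \<rho> A"
      unfolding frc by (rule cl_sigma_intro[OF w that]) (use X in blast)
  qed
  show "pi_char A" unfolding pi_char_def
  proof (intro HOL.allI impI)
    fix w p and \<rho> :: "nat \<Rightarrow> 'b" assume w: "le w w" "p \<in> D w" "range \<rho> \<subseteq> D w"
    have "at_stage w p \<rho> A \<longleftrightarrow> at_stages w p \<rho> A"
    proof
      assume "at_stage w p \<rho> A"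
      then obtain z where z: "z \<in> D w" "\<And>v. le w v \<Longrightarrow> \<Phi> v p z \<Longrightarrow> R v \<rho> z A" by (rule at_stageE) blast
      show "at_stages w p \<rho> A"
      proof (rule at_stagesI)
        fix v z' assume "le w v" "z' \<in> D v"
        thus "\<exists>z''\<in>D v. \<forall>u. le v u \<longrightarrow> \<Phi> u p z'' \<longrightarrow> R u \<rho> z' A"
          using z X D_mono le_trans by (intro bexI[of _ z]) blast+
      qed
    next
      assume "at_stages w p \<rho> A"
      \<comment> \<open>Some stage has to be prescribed; an atom does not depend on it, and the
        element \<open>p\<close> is at hand.\<close>
      then obtain z where z: "z \<in> D w" "\<And>v. le w v \<Longrightarrow> \<Phi> v p z \<Longrightarrow> R v \<rho> p A"
        using w by (elim at_stagesE) auto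
      show "at_stage w p \<rho> A"
        by (rule at_stageI[OF z(1)]) (use z(2) X[of \<rho> _ p] in blast)
    qed
    thus "fc.frc (w, p) \<rho> A \<longleftrightarrow> at_stages w p \<rho> A" using sigma_charD[OF S w] by blast
  qed
qed

lemma char_Mem: "sigma_char (Mem x y)" "pi_char (Mem x y)"
  using atom_char[of "Mem x y" "\<lambda>\<rho> b. mem (fst b) (\<rho> x) (\<rho> y)"]
  by (simp_all add: coded_atom SigmaF_Delta0 Delta0.intros)

lemma char_Eq: "sigma_char (Eq x y)" "pi_char (Eq x y)"
  using atom_char[of "Eq x y" "\<lambda>\<rho> b. eq (fst b) (\<rho> x) (\<rho> y)"]
  by (simp_all add: coded_atom SigmaF_Delta0 Delta0.intros)

lemma char_Bot: "sigma_char Bot" "pi_char Bot"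
  using atom_char[of Bot "\<lambda>\<rho> b. False"]
  by (simp_all add: coded_atom SigmaF_Bot)

lemma frc_MemE:
  assumes "fc.frc (w, p) \<rho> (Mem x y)" "le w w" "p \<in> D w" "range \<rho> \<subseteq> D w"
  obtains z where "z \<in> D w" "\<And>v. le w v \<Longrightarrow> \<Phi> v p z \<Longrightarrow> mem v (\<rho> x) (\<rho> y)"
proof -
  have "at_stage w p \<rho> (Mem x y)" using sigma_charD[OF char_Mem(1) assms(2-4)] assms(1) by blast
  thus ?thesis using that by (auto elim!: at_stageE)
qed

lemma frc_MemI:
  assumes "mem w (\<rho> x) (\<rho> y)"
  shows "fc.frc (w, p) \<rho> (Mem x y)"
  unfolding fc.frc.simps by (rule fc.clI) (use assms mem_mono in \<open>auto simp: ple_def\<close>)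

lemma sigma_char_Conj:
  assumes ok: "sigma_char A" "sigma_char B" and S: "SigmaF A" "SigmaF B"
  shows "sigma_char (Conj A B)"
  unfolding sigma_char_def
proof (intro HOL.allI impI)
  fix w p and \<rho> :: "nat \<Rightarrow> 'b" assume w: "le w w" "p \<in> D w" "range \<rho> \<subseteq> D w"
  have "at_stage w p \<rho> A \<and> at_stage w p \<rho> B \<longleftrightarrow> at_stage w p \<rho> (Conj A B)"
  proof
    assume h: "at_stage w p \<rho> A \<and> at_stage w p \<rho> B"
    obtain z where z: "z \<in> D w" "\<And>v. le w v \<Longrightarrow> \<Phi> v p z \<Longrightarrow> R v \<rho> z A" using h at_stageE by blast
    obtain y where y: "y \<in> D w" "\<And>v. le w v \<Longrightarrow> \<Phi> v p y \<Longrightarrow> R v \<rho> y B" using h at_stageE by blast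
    obtain t where t: "t \<in> D w" "sub w z t" "sub w y t" using upper_bound[OF w(1) z(1) y(1)] by blast
    show "at_stage w p \<rho> (Conj A B)"
    proof (rule at_stageI[OF t(1)])
      fix v assume v: "le w v" "\<Phi> v p t"
      note vv = le_refl(2)[OF v(1)]
      have "R v \<rho> z A" "R v \<rho> y B" using z(2) y(2) v \<Phi>_sub t by blast+
      thus "R v \<rho> t (Conj A B)"
        using R_up[OF S(1) vv sub_mono[OF t(2) v(1)]] R_up[OF S(2) vv sub_mono[OF t(3) v(1)]] by simp
    qed
  qed (auto simp: at_stage_def)
  thus "fc.frc (w, p) \<rho> (Conj A B) \<longleftrightarrow> at_stage w p \<rho> (Conj A B)"
    using sigma_charD[OF ok(1) w] sigma_charD[OF ok(2) w] by simp
qed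

lemma pi_char_Conj:
  assumes ok: "pi_char A" "pi_char B"
  shows "pi_char (Conj A B)"
  unfolding pi_char_def
proof (intro HOL.allI impI)
  fix w p and \<rho> :: "nat \<Rightarrow> 'b" assume w: "le w w" "p \<in> D w" "range \<rho> \<subseteq> D w"
  have "at_stages w p \<rho> A \<and> at_stages w p \<rho> B \<longleftrightarrow> at_stages w p \<rho> (Conj A B)"
  proof
    assume h: "at_stages w p \<rho> A \<and> at_stages w p \<rho> B"
    show "at_stages w p \<rho> (Conj A B)"
    proof (rule at_stagesI)
      fix v z assume v: "le w v" "z \<in> D v"
      note vv = le_refl(2)[OF v(1)]
      obtain a where a: "a \<in> D v" "\<And>u. le v u \<Longrightarrow> \<Phi> u p a \<Longrightarrow> R u \<rho> z A" using h v at_stagesE by blast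
      obtain b where b: "b \<in> D v" "\<And>u. le v u \<Longrightarrow> \<Phi> u p b \<Longrightarrow> R u \<rho> z B" using h v at_stagesE by blast
      obtain t where t: "t \<in> D v" "sub v a t" "sub v b t" using upper_bound[OF vv a(1) b(1)] by blast
      have "R u \<rho> z (Conj A B)" if "le v u" "\<Phi> u p t" for u
        using a(2)[OF that(1) \<Phi>_sub[OF that(2) t(2) that(1)]] b(2)[OF that(1) \<Phi>_sub[OF that(2) t(3) that(1)]] by simp
      thus "\<exists>z'\<in>D v. \<forall>u. le v u \<longrightarrow> \<Phi> u p z' \<longrightarrow> R u \<rho> z (Conj A B)" using t(1) by blast
    qed
  qed (auto simp: at_stages_def; blast)
  thus "fc.frc (w, p) \<rho> (Conj A B) \<longleftrightarrow> at_stages w p \<rho> (Conj A B)"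
    using pi_charD[OF ok(1) w] pi_charD[OF ok(2) w] by simp
qed

lemma sigma_char_Disj:
  assumes ok: "sigma_char A" "sigma_char B" and S: "SigmaF (Disj A B)" and L: "Disj A B \<in> L"
  shows "sigma_char (Disj A B)"
  unfolding sigma_char_def
proof (intro HOL.allI impI iffI)
  fix w p and \<rho> :: "nat \<Rightarrow> 'b" assume w: "le w w" "p \<in> D w" "range \<rho> \<subseteq> D w"
  have c: "coded (Disj A B)" using coded_L L S by blast
  show "at_stage w p \<rho> (Disj A B)" if f: "fc.frc (w, p) \<rho> (Disj A B)"
  proof (rule cl_sigma_elim[OF w c S f[unfolded fc.frc.simps]])
    fix v q assume v: "ple (w, p) (v, q)" "fc.frc (v, q) \<rho> A \<or> fc.frc (v, q) \<rho> B"
    note vq = pleD(3,5)[OF v(1)] ple_env[OF v(1) w(3)]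
    have "at_stage v q \<rho> A \<or> at_stage v q \<rho> B" using v(2) sigma_charD[OF ok(1) vq] sigma_charD[OF ok(2) vq] by blast
    thus "at_stage v q \<rho> (Disj A B)" by (auto simp: at_stage_def)
  qed
  show "fc.frc (w, p) \<rho> (Disj A B)" if ch: "at_stage w p \<rho> (Disj A B)"
    unfolding fc.frc.simps
  proof (rule cl_sigma_intro[OF w ch])
    fix v q z assume v: "ple (w, p) (v, q)" "z \<in> D v" "R v \<rho> z (Disj A B)"
    note vq = pleD(3,5)[OF v(1)] ple_env[OF v(1) w(3)]
    show "fc.frc (v, q) \<rho> A \<or> fc.frc (v, q) \<rho> B"
      using v(3) at_stage_now[OF v(2)] sigma_charD[OF ok(1) vq] sigma_charD[OF ok(2) vq] by auto
  qed
qed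

lemma sigma_char_Ex:
  assumes ok: "sigma_char A" and S: "SigmaF (Ex x A)" and L: "Ex x A \<in> L"
  shows "sigma_char (Ex x A)"
  unfolding sigma_char_def
proof (intro HOL.allI impI iffI)
  fix w p and \<rho> :: "nat \<Rightarrow> 'b" assume w: "le w w" "p \<in> D w" "range \<rho> \<subseteq> D w"
  have c: "coded (Ex x A)" using coded_L L S by blast
  show "at_stage w p \<rho> (Ex x A)" if f: "fc.frc (w, p) \<rho> (Ex x A)"
  proof (rule cl_sigma_elim[OF w c S f[unfolded fc.frc.simps]])
    fix v q assume v: "ple (w, p) (v, q)" "\<exists>d\<in>D (fst (v, q)). fc.frc (v, q) (\<rho>(x := d)) A"
    then obtain d where d: "d \<in> D v" "fc.frc (v, q) (\<rho>(x := d)) A" by auto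
    note vq = pleD(3,5)[OF v(1)] env_upd[OF ple_env[OF v(1) w(3)] d(1), of x]
    have "at_stage v q (\<rho>(x := d)) A" using d(2) sigma_charD[OF ok vq] by blast
    then obtain z where z: "z \<in> D v" "\<And>u. le v u \<Longrightarrow> \<Phi> u q z \<Longrightarrow> R u (\<rho>(x := d)) z A" by (rule at_stageE) blast
    \<comment> \<open>The relativized quantifier ranges over the stage, so the stage
      \<open>t\<close> must contain the witness \<open>d\<close> besides lying above
      \<open>z\<close>.\<close>
    obtain s where s: "s \<in> D v" "mem v d s" using ex_pair[OF vq(1) d(1) d(1)] by blast
    obtain t where t: "t \<in> D v" "sub v z t" "sub v s t" using upper_bound[OF vq(1) z(1) s(1)] by blast
    have dt: "mem v d t" using subD[OF t(3) vq(1) d(1) s(2)] .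
    show "at_stage v q \<rho> (Ex x A)"
    proof (rule at_stageI[OF t(1)])
      fix u assume u: "le v u" "\<Phi> u q t"
      have "R u (\<rho>(x := d)) t A"
        using R_up[OF SigmaF_ExD[OF S] le_refl(2)[OF u(1)] sub_mono[OF t(2) u(1)]]
          z(2)[OF u(1) \<Phi>_sub[OF u(2) t(2) u(1)]] by blast
      moreover have "d \<in> D u" "mem u d t" using d(1) dt u(1) D_mono mem_mono by blast+
      ultimately show "R u \<rho> t (Ex x A)" by auto
    qed
  qed
  show "fc.frc (w, p) \<rho> (Ex x A)" if ch: "at_stage w p \<rho> (Ex x A)"
    unfolding fc.frc.simps
  proof (rule cl_sigma_intro[OF w ch])
    fix v q z assume v: "ple (w, p) (v, q)" "z \<in> D v" "R v \<rho> z (Ex x A)"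
    then obtain d where d: "d \<in> D v" "R v (\<rho>(x := d)) z A" by auto
    note vq = pleD(3,5)[OF v(1)] env_upd[OF ple_env[OF v(1) w(3)] d(1), of x]
    have "fc.frc (v, q) (\<rho>(x := d)) A" using at_stage_now[OF v(2) d(2)] sigma_charD[OF ok vq] by blast
    thus "\<exists>d\<in>D (fst (v, q)). fc.frc (v, q) (\<rho>(x := d)) A" using d(1) by auto
  qed
qed

lemma sigma_char_BEx:
  assumes ok: "sigma_char A" and S: "SigmaF (BEx x s A)" and L: "BEx x s A \<in> L"
  shows "sigma_char (BEx x s A)"
  unfolding sigma_char_def
proof (intro HOL.allI impI iffI)
  fix w p and \<rho> :: "nat \<Rightarrow> 'b" assume w: "le w w" "p \<in> D w" "range \<rho> \<subseteq> D w"
  have c: "coded (BEx x s A)" using coded_L L S by blast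
  have S': "SigmaF A" using SigmaF_BExD[OF S] by blast
  show "at_stage w p \<rho> (BEx x s A)" if f: "fc.frc (w, p) \<rho> (BEx x s A)"
  proof (rule cl_sigma_elim[OF w c S f[unfolded fc.frc.simps(10)]])
    fix v q assume v: "ple (w, p) (v, q)"
      "\<exists>d\<in>D (fst (v, q)). fc.cl (\<lambda>b. mem (fst b) d ((\<rho>(x := d)) s)) (v, q) \<and> fc.frc (v, q) (\<rho>(x := d)) A"
    then obtain d where d: "d \<in> D v" "fc.frc (v, q) (\<rho>(x := d)) (Mem x s)" "fc.frc (v, q) (\<rho>(x := d)) A"
      unfolding fc.frc.simps fst_conv fun_upd_same by blast
    note vq = pleD(3,5)[OF v(1)] env_upd[OF ple_env[OF v(1) w(3)] d(1), of x]
    have "at_stage v q (\<rho>(x := d)) A" using d(3) sigma_charD[OF ok vq] by blast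
    then obtain z where z: "z \<in> D v" "\<And>u. le v u \<Longrightarrow> \<Phi> u q z \<Longrightarrow> R u (\<rho>(x := d)) z A" by (rule at_stageE) blast
    obtain y where y: "y \<in> D v" "\<And>u. le v u \<Longrightarrow> \<Phi> u q y \<Longrightarrow> mem u ((\<rho>(x := d)) x) ((\<rho>(x := d)) s)"
      using frc_MemE[OF d(2) vq] by blast
    obtain t where t: "t \<in> D v" "sub v z t" "sub v y t" using upper_bound[OF vq(1) z(1) y(1)] by blast
    show "at_stage v q \<rho> (BEx x s A)"
    proof (rule at_stageI[OF t(1)])
      fix u assume u: "le v u" "\<Phi> u q t"
      have "R u (\<rho>(x := d)) t A"
        using R_up[OF S' le_refl(2)[OF u(1)] sub_mono[OF t(2) u(1)]]
          z(2)[OF u(1) \<Phi>_sub[OF u(2) t(2) u(1)]] by blast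
      moreover have "mem u d ((\<rho>(x := d)) s)" using y(2)[OF u(1) \<Phi>_sub[OF u(2) t(3) u(1)]] by simp
      moreover have "d \<in> D u" using d(1) u(1) D_mono by blast
      ultimately show "R u \<rho> t (BEx x s A)" unfolding R.simps by blast
    qed
  qed
  show "fc.frc (w, p) \<rho> (BEx x s A)" if ch: "at_stage w p \<rho> (BEx x s A)"
    unfolding fc.frc.simps(10)
  proof (rule cl_sigma_intro[OF w ch])
    fix v q z assume v: "ple (w, p) (v, q)" "z \<in> D v" "R v \<rho> z (BEx x s A)"
    then obtain d where d: "d \<in> D v" "mem v d ((\<rho>(x := d)) s)" "R v (\<rho>(x := d)) z A"
      unfolding R.simps by blast
    note vq = pleD(3,5)[OF v(1)] env_upd[OF ple_env[OF v(1) w(3)] d(1), of x]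
    have "fc.frc (v, q) (\<rho>(x := d)) A" using at_stage_now[OF v(2) d(3)] sigma_charD[OF ok vq] by blast
    moreover have "fc.frc (v, q) (\<rho>(x := d)) (Mem x s)" by (rule frc_MemI) (use d(2) in simp)
    ultimately show "\<exists>d\<in>D (fst (v, q)). fc.cl (\<lambda>b. mem (fst b) d ((\<rho>(x := d)) s)) (v, q) \<and>
        fc.frc (v, q) (\<rho>(x := d)) A"
      using d(1) unfolding fc.frc.simps(1) fst_conv fun_upd_same by blast
  qed
qed

lemma L_fresh: "A \<in> L \<Longrightarrow> v \<in> vars A \<Longrightarrow> v \<noteq> P \<and> v \<noteq> Z \<and> v \<noteq> uu \<and> v \<noteq> st \<and> v \<noteq> st'"
  using fresh by blast

lemma L_fresh': "A \<in> L \<Longrightarrow> P \<notin> vars A \<and> Z \<notin> vars A \<and> uu \<notin> vars A \<and> st \<notin> vars A \<and> st' \<notin> vars A"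
  using fresh by blast

text \<open>The stage depends on the member \<open>d\<close> of \<open>S\<close>. Being a suitable
  stage for \<open>d\<close> is expressed by the bounded formula \<open>Imp phiF (rel Z A)\<close>,
  so collection applies, and the union of the collected stages lies above a suitable one for each
  \<open>d\<close>.\<close>

lemma collect_stage:
  assumes A: "A \<in> L" "SigmaF A \<or> PiF A" and x: "x \<noteq> P" "x \<noteq> Z"
    and w: "le w w" "p \<in> D w" "range \<rho> \<subseteq> D w" "S \<in> D w"
    and h: "\<And>v d. le w v \<Longrightarrow> d \<in> D v \<Longrightarrow> mem v d S \<Longrightarrow>
      \<exists>z\<in>D v. \<forall>u. le v u \<longrightarrow> \<Phi> u p z \<longrightarrow> R u (\<rho>(x := d)) z A"
  obtains b where "b \<in> D w" "\<And>v d. le w v \<Longrightarrow> d \<in> D v \<Longrightarrow> mem v d S \<Longrightarrow>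
      \<exists>z\<in>D v. sub v z b \<and> (\<forall>u. le v u \<longrightarrow> \<Phi> u p z \<longrightarrow> R u (\<rho>(x := d)) z A)"
proof -
  define \<sigma> where "\<sigma> = \<rho>(P := p)"
  have \<sigma>: "range \<sigma> \<subseteq> D w" unfolding \<sigma>_def by (rule env_upd[OF w(3,2)])
  note f = L_fresh'[OF A(1)]
  have d: "Delta0 (Imp phiF (rel Z A))" using Delta0_rel[OF A(2)] f by (intro Delta0.intros Delta0_phiF) auto
  have R: "sem u (\<sigma>(x := d, Z := z)) (rel Z A) \<longleftrightarrow> R u (\<rho>(x := d)) z A" for u d z
    using sem_rel[of Z A u "\<sigma>(x := d)" z] f R_cong[of A "\<sigma>(x := d)" "\<rho>(x := d)" u z] nonvar_nonfree[of P A]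
    by (auto simp: \<sigma>_def)
  have v: "(\<sigma>(x := d, Z := z)) P = p" "(\<sigma>(x := d, Z := z)) Z = z" for d z
    using x ne by (auto simp: \<sigma>_def)
  have s: "sem v (\<sigma>(x := d, Z := z)) (Imp phiF (rel Z A)) \<longleftrightarrow>
      (\<forall>u. le v u \<longrightarrow> \<Phi> u p z \<longrightarrow> R u (\<rho>(x := d)) z A)" for v d z
    unfolding sem.simps R using sem_phiF[OF le_refl(2)] v by metis
  obtain b where b: "b \<in> D w" "\<And>v d. le w v \<Longrightarrow> d \<in> D v \<Longrightarrow> mem v d S \<Longrightarrow>
      \<exists>z\<in>D v. mem v z b \<and> (\<forall>u. le v u \<longrightarrow> \<Phi> u p z \<longrightarrow> R u (\<rho>(x := d)) z A)"
    using collection[OF d x(2) w(1) \<sigma> w(4)] h unfolding s by blast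
  obtain t where t: "t \<in> D w" "\<And>v z. le w v \<Longrightarrow> z \<in> D v \<Longrightarrow> mem v z b \<Longrightarrow> sub v z t"
    using union_bound[OF w(1) b(1)] by blast
  show ?thesis by (rule that[OF t(1)]) (use b(2) t(2) in blast)
qed

text \<open>Here the formula is relativized to the fixed stage held by \<open>st'\<close>, and only
  the stage of the condition is collected. As \<open>\<Phi>\<close> is antitone in it, the union
  \<open>b\<close> serves every \<open>d\<close>.\<close>

lemma collect_const:
  assumes A: "A \<in> L" "SigmaF A \<or> PiF A" and x: "x \<noteq> P" "x \<noteq> Z" "x \<noteq> st'"
    and w: "le w w" "p \<in> D w" "range \<rho> \<subseteq> D w" "S \<in> D w" "z \<in> D w"
    and h: "\<And>v d. le w v \<Longrightarrow> d \<in> D v \<Longrightarrow> mem v d S \<Longrightarrow>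
      \<exists>z'\<in>D v. \<forall>u. le v u \<longrightarrow> \<Phi> u p z' \<longrightarrow> R u (\<rho>(x := d)) z A"
  obtains b where "b \<in> D w" "\<And>v d. le w v \<Longrightarrow> d \<in> D v \<Longrightarrow> mem v d S \<Longrightarrow> \<Phi> v p b \<Longrightarrow> R v (\<rho>(x := d)) z A"
proof -
  define \<sigma> where "\<sigma> = \<rho>(P := p, st' := z)"
  have \<sigma>: "range \<sigma> \<subseteq> D w" unfolding \<sigma>_def by (intro env_upd w)
  note f = L_fresh'[OF A(1)]
  have d: "Delta0 (Imp phiF (rel st' A))" using Delta0_rel[OF A(2)] f by (intro Delta0.intros Delta0_phiF) auto
  have R: "sem u (\<sigma>(x := d, Z := z')) (rel st' A) \<longleftrightarrow> R u (\<rho>(x := d)) z A" for u d z'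
  proof -
    have "\<sigma>(x := d, Z := z') = (\<rho>(P := p, x := d, Z := z'))(st' := z)"
      using x ne by (auto simp: \<sigma>_def fun_eq_iff)
    moreover have "R u (\<rho>(P := p, x := d, Z := z')) z A = R u (\<rho>(x := d)) z A"
      using f nonvar_nonfree[of _ A] by (intro R_cong) auto
    ultimately show ?thesis using sem_rel[of st' A u "\<rho>(P := p, x := d, Z := z')" z] f by simp
  qed
  have v: "(\<sigma>(x := d, Z := z')) P = p" "(\<sigma>(x := d, Z := z')) Z = z'" for d z'
    using x ne by (auto simp: \<sigma>_def)
  have s: "sem v (\<sigma>(x := d, Z := z')) (Imp phiF (rel st' A)) \<longleftrightarrow>
      (\<forall>u. le v u \<longrightarrow> \<Phi> u p z' \<longrightarrow> R u (\<rho>(x := d)) z A)" for v d z'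
    unfolding sem.simps R using sem_phiF[OF le_refl(2)] v by metis
  obtain b where b: "b \<in> D w" "\<And>v d. le w v \<Longrightarrow> d \<in> D v \<Longrightarrow> mem v d S \<Longrightarrow>
      \<exists>z'\<in>D v. mem v z' b \<and> (\<forall>u. le v u \<longrightarrow> \<Phi> u p z' \<longrightarrow> R u (\<rho>(x := d)) z A)"
    using collection[OF d x(2) w(1) \<sigma> w(4)] h unfolding s by blast
  obtain t where t: "t \<in> D w" "\<And>v z. le w v \<Longrightarrow> z \<in> D v \<Longrightarrow> mem v z b \<Longrightarrow> sub v z t"
    using union_bound[OF w(1) b(1)] by blast
  show ?thesis
  proof (rule that[OF t(1)])
    fix v d assume v: "le w v" "d \<in> D v" "mem v d S" "\<Phi> v p t"
    obtain z' where z': "z' \<in> D v" "mem v z' b" "\<And>u. le v u \<Longrightarrow> \<Phi> u p z' \<Longrightarrow> R u (\<rho>(x := d)) z A"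
      using b(2)[OF v(1-3)] by blast
    have "\<Phi> v p z'" using \<Phi>_anti[OF v(4) sub_refl t(2)[OF v(1) z'(1,2)]] .
    thus "R v (\<rho>(x := d)) z A" using z'(3) le_refl(2)[OF v(1)] by blast
  qed
qed

lemma frc_bounded:
  assumes f: "fc.frc (w, p) \<rho> (BAll x s A)" and x: "x \<noteq> s"
    and w: "le w w" "p \<in> D w" and v: "le w v" "d \<in> D v" "mem v d (\<rho> s)"
  shows "fc.frc (v, p) (\<rho>(x := d)) A"
proof -
  have "ple (w, p) (v, p)" using ple_same v w by blast
  moreover have "fc.frc (v, p) (\<rho>(x := d)) (Mem x s)" by (rule frc_MemI) (use v x in simp)
  ultimately show ?thesis using f v(2) unfolding frc_BAll by blast
qed

lemma sigma_char_BAll: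
  assumes ok: "sigma_char A" and S: "SigmaF (BAll x s A)" and L: "BAll x s A \<in> L"
  shows "sigma_char (BAll x s A)"
  unfolding sigma_char_def
proof (intro HOL.allI impI iffI)
  fix w p and \<rho> :: "nat \<Rightarrow> 'b" assume w: "le w w" "p \<in> D w" "range \<rho> \<subseteq> D w"
  have S': "SigmaF A" "x \<noteq> s" using SigmaF_BAllD[OF S] by auto
  have e: "(\<rho>(x := d)) s = \<rho> s" for d using S' by simp
  have A: "A \<in> L" using L_BAll L by blast
  have x: "x \<noteq> P" "x \<noteq> Z" using L_fresh[OF L, of x] by auto
  show "at_stage w p \<rho> (BAll x s A)" if f: "fc.frc (w, p) \<rho> (BAll x s A)"
  proof -
    have "\<exists>z\<in>D v. \<forall>u. le v u \<longrightarrow> \<Phi> u p z \<longrightarrow> R u (\<rho>(x := d)) z A"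
      if v: "le w v" "d \<in> D v" "mem v d (\<rho> s)" for v d
    proof -
      have "fc.frc (v, p) (\<rho>(x := d)) A" by (rule frc_bounded[OF f S'(2) w(1,2) v])
      hence "at_stage v p (\<rho>(x := d)) A"
        using sigma_charD[OF ok le_refl(2)[OF v(1)] _ env_upd[OF env_mono[OF w(3) v(1)] v(2)]] w(2) D_mono[OF v(1)] by blast
      thus ?thesis unfolding at_stage_def .
    qed
    moreover have "\<rho> s \<in> D w" using w(3) by auto
    ultimately obtain b where b: "b \<in> D w" "\<And>v d. le w v \<Longrightarrow> d \<in> D v \<Longrightarrow> mem v d (\<rho> s) \<Longrightarrow>
      \<exists>z\<in>D v. sub v z b \<and> (\<forall>u. le v u \<longrightarrow> \<Phi> u p z \<longrightarrow> R u (\<rho>(x := d)) z A)"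
      using collect_stage[OF A disjI1[OF S'(1)] x w, of "\<rho> s"] by blast
    show ?thesis
    proof (rule at_stageI[OF b(1)])
      fix v assume v: "le w v" "\<Phi> v p b"
      show "R v \<rho> b (BAll x s A)" unfolding R.simps e
      proof (intro HOL.allI impI ballI)
        fix u d assume u: "le v u" "d \<in> D u" "mem u d (\<rho> s)"
        have wu: "le w u" using le_trans v u by blast
        obtain z where z: "z \<in> D u" "sub u z b" "\<And>t. le u t \<Longrightarrow> \<Phi> t p z \<Longrightarrow> R t (\<rho>(x := d)) z A"
          using b(2)[OF wu u(2,3)] by blast
        have uu: "le u u" using le_refl(2)[OF u(1)] .
        have "\<Phi> u p z" using \<Phi>_anti[OF \<Phi>_mono[OF v(2) u(1)] sub_refl z(2)] .
        thus "R u (\<rho>(x := d)) b A" using R_up[OF S'(1) uu z(2)] z(3)[OF uu] by blast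
      qed
    qed
  qed
  show "fc.frc (w, p) \<rho> (BAll x s A)" if ch: "at_stage w p \<rho> (BAll x s A)"
    unfolding frc_BAll
  proof (intro HOL.allI impI ballI)
    fix v q d assume v: "ple (w, p) (v, q)" "d \<in> D v" "fc.frc (v, q) (\<rho>(x := d)) (Mem x s)"
    note vq = pleD(3,5)[OF v(1)] env_upd[OF ple_env[OF v(1) w(3)] v(2), of x]
    have wv: "le w v" using pleD(1)[OF v(1)] .
    obtain z where z: "z \<in> D w" "\<And>v. le w v \<Longrightarrow> \<Phi> v p z \<Longrightarrow> R v \<rho> z (BAll x s A)" using ch at_stageE by blast
    obtain y where y: "y \<in> D v" "\<And>u. le v u \<Longrightarrow> \<Phi> u q y \<Longrightarrow> mem u ((\<rho>(x := d)) x) ((\<rho>(x := d)) s)"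
      using frc_MemE[OF v(3) vq] by blast
    have zv: "z \<in> D v" using z(1) D_mono[OF wv] by blast
    obtain t where t: "t \<in> D v" "sub v z t" "sub v y t" using upper_bound[OF vq(1) zv y(1)] by blast
    have "at_stage v q (\<rho>(x := d)) A"
    proof (rule at_stageI[OF t(1)])
      fix u assume u: "le v u" "\<Phi> u q t"
      have wu: "le w u" using le_trans[OF wv u(1)] .
      have uu: "le u u" using le_refl(2)[OF u(1)] .
      have "R u \<rho> z (BAll x s A)" using z(2)[OF wu \<Phi>_ple[OF \<Phi>_sub[OF u(2) t(2) u(1)] v(1) u(1)]] .
      moreover have "mem u d ((\<rho>(x := d)) s)" using y(2)[OF u(1) \<Phi>_sub[OF u(2) t(3) u(1)]] by simp
      moreover have "d \<in> D u" using v(2) D_mono[OF u(1)] by blast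
      ultimately have "R u (\<rho>(x := d)) z A" using uu unfolding R.simps by blast
      thus "R u (\<rho>(x := d)) t A" using R_up[OF S'(1) uu sub_mono[OF t(2) u(1)]] by blast
    qed
    thus "fc.frc (v, q) (\<rho>(x := d)) A" using sigma_charD[OF ok vq] by blast
  qed
qed

lemma pi_char_BAll:
  assumes ok: "pi_char A" and S: "PiF (BAll x s A)" and L: "BAll x s A \<in> L"
  shows "pi_char (BAll x s A)"
  unfolding pi_char_def
proof (intro HOL.allI impI iffI)
  fix w p and \<rho> :: "nat \<Rightarrow> 'b" assume w: "le w w" "p \<in> D w" "range \<rho> \<subseteq> D w"
  have S': "PiF A" "x \<noteq> s" using PiF_BAllD[OF S] by auto
  have e: "(\<rho>(x := d)) s = \<rho> s" for d using S' by simp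
  have A: "A \<in> L" using L_BAll L by blast
  have x: "x \<noteq> P" "x \<noteq> Z" "x \<noteq> st'" using L_fresh[OF L, of x] by auto
  show "at_stages w p \<rho> (BAll x s A)" if f: "fc.frc (w, p) \<rho> (BAll x s A)"
  proof (rule at_stagesI)
    fix v z assume v: "le w v" "z \<in> D v"
    have vp: "le v v" "p \<in> D v" "range \<rho> \<subseteq> D v" "\<rho> s \<in> D v"
      using le_refl(2)[OF v(1)] D_mono[OF v(1)] w by auto
    have "\<exists>z'\<in>D u. \<forall>t. le u t \<longrightarrow> \<Phi> t p z' \<longrightarrow> R t (\<rho>(x := d)) z A"
      if u: "le v u" "d \<in> D u" "mem u d (\<rho> s)" for u d
    proof -
      have "fc.frc (u, p) (\<rho>(x := d)) A" by (rule frc_bounded[OF f S'(2) w(1,2) le_trans[OF v(1) u(1)] u(2,3)])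
      hence "at_stages u p (\<rho>(x := d)) A"
        using pi_charD[OF ok le_refl(2)[OF u(1)] _ env_upd[OF env_mono[OF vp(3) u(1)] u(2)]] vp(2) D_mono[OF u(1)] by blast
      thus ?thesis unfolding at_stages_def using le_refl(2)[OF u(1)] v(2) D_mono[OF u(1)] by blast
    qed
    then obtain b where b: "b \<in> D v" "\<And>u d. le v u \<Longrightarrow> d \<in> D u \<Longrightarrow> mem u d (\<rho> s) \<Longrightarrow> \<Phi> u p b \<Longrightarrow> R u (\<rho>(x := d)) z A"
      using collect_const[OF A disjI2[OF S'(1)] x vp v(2)] by blast
    have "R u \<rho> z (BAll x s A)" if u: "le v u" "\<Phi> u p b" for u
      unfolding R.simps e
      using b(2) le_trans[OF u(1)] \<Phi>_mono[OF u(2)] by blast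
    thus "\<exists>z'\<in>D v. \<forall>u. le v u \<longrightarrow> \<Phi> u p z' \<longrightarrow> R u \<rho> z (BAll x s A)" using b(1) by blast
  qed
  show "fc.frc (w, p) \<rho> (BAll x s A)" if ch: "at_stages w p \<rho> (BAll x s A)"
    unfolding frc_BAll
  proof (intro HOL.allI impI ballI)
    fix v q d assume v: "ple (w, p) (v, q)" "d \<in> D v" "fc.frc (v, q) (\<rho>(x := d)) (Mem x s)"
    note vq = pleD(3,5)[OF v(1)] env_upd[OF ple_env[OF v(1) w(3)] v(2), of x]
    have wv: "le w v" using pleD(1)[OF v(1)] .
    obtain y where y: "y \<in> D v" "\<And>u. le v u \<Longrightarrow> \<Phi> u q y \<Longrightarrow> mem u ((\<rho>(x := d)) x) ((\<rho>(x := d)) s)"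
      using frc_MemE[OF v(3) vq] by blast
    have "at_stages v q (\<rho>(x := d)) A"
    proof (rule at_stagesI)
      fix u z assume u: "le v u" "z \<in> D u"
      have wu: "le w u" using le_trans[OF wv u(1)] .
      have uu: "le u u" using le_refl(2)[OF u(1)] .
      obtain z' where z': "z' \<in> D u" "\<And>t. le u t \<Longrightarrow> \<Phi> t p z' \<Longrightarrow> R t \<rho> z (BAll x s A)"
        using at_stagesE[OF ch wu u(2)] by blast
      have yu: "y \<in> D u" using y(1) D_mono[OF u(1)] by blast
      obtain b where b: "b \<in> D u" "sub u z' b" "sub u y b" using upper_bound[OF uu z'(1) yu] by blast
      have "R t (\<rho>(x := d)) z A" if t: "le u t" "\<Phi> t q b" for t
      proof -
        have vt: "le v t" using le_trans[OF u(1) t(1)] .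
        have "R t \<rho> z (BAll x s A)" using z'(2)[OF t(1) \<Phi>_ple[OF \<Phi>_sub[OF t(2) b(2) t(1)] v(1) vt]] .
        moreover have "mem t d ((\<rho>(x := d)) s)" using y(2)[OF vt \<Phi>_sub[OF t(2) b(3) t(1)]] by simp
        moreover have "d \<in> D t" using v(2) D_mono[OF vt] by blast
        ultimately show ?thesis using le_refl(2)[OF t(1)] unfolding R.simps by blast
      qed
      thus "\<exists>z'\<in>D u. \<forall>t. le u t \<longrightarrow> \<Phi> t q z' \<longrightarrow> R t (\<rho>(x := d)) z A" using b(1) by blast
    qed
    thus "fc.frc (v, q) (\<rho>(x := d)) A" using pi_charD[OF ok vq] by blast
  qed
qed

lemma pi_char_All:
  assumes ok: "pi_char A" and S: "PiF (All x A)" and L: "All x A \<in> L"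
  shows "pi_char (All x A)"
  unfolding pi_char_def
proof (intro HOL.allI impI iffI)
  fix w p and \<rho> :: "nat \<Rightarrow> 'b" assume w: "le w w" "p \<in> D w" "range \<rho> \<subseteq> D w"
  have S': "PiF A" using PiF_AllD[OF S] by auto
  have A: "A \<in> L" using L_All L by blast
  have x: "x \<noteq> P" "x \<noteq> Z" "x \<noteq> st'" using L_fresh[OF L, of x] by auto
  show "at_stages w p \<rho> (All x A)" if f: "fc.frc (w, p) \<rho> (All x A)"
  proof (rule at_stagesI)
    fix v z assume v: "le w v" "z \<in> D v"
    have vp: "le v v" "p \<in> D v" "range \<rho> \<subseteq> D v"
      using le_refl(2)[OF v(1)] D_mono[OF v(1)] w by auto
    have "\<exists>z'\<in>D u. \<forall>t. le u t \<longrightarrow> \<Phi> t p z' \<longrightarrow> R t (\<rho>(x := d)) z A"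
      if u: "le v u" "d \<in> D u" for u d
    proof -
      have "ple (w, p) (u, p)" using ple_same[OF le_trans[OF v(1) u(1)] w(2)] .
      hence "fc.frc (u, p) (\<rho>(x := d)) A" using f u(2) unfolding frc_All by blast
      hence "at_stages u p (\<rho>(x := d)) A"
        using pi_charD[OF ok le_refl(2)[OF u(1)] _ env_upd[OF env_mono[OF vp(3) u(1)] u(2)]] vp(2) D_mono[OF u(1)] by blast
      thus ?thesis unfolding at_stages_def using le_refl(2)[OF u(1)] v(2) D_mono[OF u(1)] by blast
    qed
    then obtain b where b: "b \<in> D v" "\<And>u d. le v u \<Longrightarrow> d \<in> D u \<Longrightarrow> mem u d z \<Longrightarrow> \<Phi> u p b \<Longrightarrow> R u (\<rho>(x := d)) z A"
      using collect_const[OF A disjI2[OF S'(1)] x vp v(2) v(2)] by blast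
    have "R u \<rho> z (All x A)" if u: "le v u" "\<Phi> u p b" for u
      unfolding R.simps
      using b(2) le_trans[OF u(1)] \<Phi>_mono[OF u(2)] by blast
    thus "\<exists>z'\<in>D v. \<forall>u. le v u \<longrightarrow> \<Phi> u p z' \<longrightarrow> R u \<rho> z (All x A)" using b(1) by blast
  qed
  show "fc.frc (w, p) \<rho> (All x A)" if ch: "at_stages w p \<rho> (All x A)"
    unfolding frc_All
  proof (intro HOL.allI impI ballI)
    fix v q d assume v: "ple (w, p) (v, q)" "d \<in> D v"
    note vq = pleD(3,5)[OF v(1)] env_upd[OF ple_env[OF v(1) w(3)] v(2), of x]
    have wv: "le w v" using pleD(1)[OF v(1)] .
    have "at_stages v q (\<rho>(x := d)) A"
    proof (rule at_stagesI)
      fix u z assume u: "le v u" "z \<in> D u"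
      have wu: "le w u" using le_trans[OF wv u(1)] .
      have uu: "le u u" using le_refl(2)[OF u(1)] .
      have du: "d \<in> D u" using v(2) D_mono[OF u(1)] by blast
      \<comment> \<open>At stage \<open>z\<close> the hypothesis would speak only about members of
        \<open>z\<close>. It is invoked at a larger stage \<open>y\<close> that contains
        \<open>d\<close>, and \<Pi> formulas come back down to \<open>z\<close>.\<close>
      obtain s where s: "s \<in> D u" "mem u d s" using ex_pair[OF uu du du] by blast
      obtain y where y: "y \<in> D u" "sub u z y" "sub u s y" using upper_bound[OF uu u(2) s(1)] by blast
      have dy: "mem u d y" using subD[OF y(3) uu du s(2)] .
      obtain z' where z': "z' \<in> D u" "\<And>t. le u t \<Longrightarrow> \<Phi> t p z' \<Longrightarrow> R t \<rho> y (All x A)"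
        using at_stagesE[OF ch wu y(1)] by blast
      have "R t (\<rho>(x := d)) z A" if t: "le u t" "\<Phi> t q z'" for t
      proof -
        have vt: "le v t" "le t t" using le_trans[OF u(1) t(1)] le_refl(2)[OF t(1)] .
        have "R t \<rho> y (All x A)" using z'(2)[OF t(1) \<Phi>_ple[OF t(2) v(1) vt(1)]] .
        moreover have "mem t d y" "d \<in> D t" using mem_mono[OF t(1) dy] D_mono[OF t(1)] du by auto
        ultimately have "R t (\<rho>(x := d)) y A" using vt(2) unfolding R.simps by blast
        thus ?thesis using R_down[OF S' vt(2) sub_mono[OF y(2) t(1)]] by blast
      qed
      thus "\<exists>z'\<in>D u. \<forall>t. le u t \<longrightarrow> \<Phi> t q z' \<longrightarrow> R t (\<rho>(x := d)) z A" using z'(1) by blast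
    qed
    thus "fc.frc (v, q) (\<rho>(x := d)) A" using pi_charD[OF ok vq] by blast
  qed
qed

text \<open>Joining a code of a \<Pi> formula to the condition forces the formula, and the last
  clause says that nothing else has been assumed. Inside, a prescribed stage \<open>z\<close> is
  made a member of the stage \<open>t\<close> of the condition, because \<open>\<Phi>\<close>
  evaluates codes at members.\<close>

lemma force_code:
  assumes ok: "pi_char A" and A: "coded A" and w: "le w w" "p \<in> D w" "range \<rho> \<subseteq> D w"
  obtains q where "ple (w, p) (w, q)" "fc.frc (w, q) \<rho> A"
    "\<And>v z. le w v \<Longrightarrow> \<Phi> v p z \<Longrightarrow> (\<And>u y. le v u \<Longrightarrow> y \<in> D u \<Longrightarrow> mem u y z \<Longrightarrow> R u \<rho> y A) \<Longrightarrow> \<Phi> v q z"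
proof -
  obtain c where c: "c \<in> D w" "\<And>v y. le w v \<Longrightarrow> y \<in> D v \<Longrightarrow> T v c y \<longleftrightarrow> R v \<rho> y A"
    using codedE[OF A w(1,3)] by blast
  obtain q where q: "q \<in> D w" "sub w p q"
    "\<And>v y z. le w v \<Longrightarrow> \<Phi> v q z \<Longrightarrow> y \<in> D v \<Longrightarrow> mem v y z \<Longrightarrow> T v c y"
    "\<And>v z. le w v \<Longrightarrow> \<Phi> v p z \<Longrightarrow> (\<And>v' y. le v v' \<Longrightarrow> y \<in> D v' \<Longrightarrow> mem v' y z \<Longrightarrow> T v' c y) \<Longrightarrow> \<Phi> v q z"
    using extend_condition[OF w(1,2) c(1)] by blast
  have "at_stages w q \<rho> A"
  proof (rule at_stagesI)
    fix v z assume v: "le w v" "z \<in> D v"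
    obtain t where t: "t \<in> D v" "sub v z t" "mem v z t"
      using inhabited_bound[OF le_refl(2)[OF v(1)] v(2)] by blast
    have "R u \<rho> z A" if u: "le v u" "\<Phi> u q t" for u
    proof -
      have "le w u" "z \<in> D u" "mem u z t" using le_trans[OF v(1) u(1)] D_mono[OF u(1)] v(2) mem_mono[OF u(1) t(3)] by auto
      thus ?thesis using q(3) u(2) c(2) by blast
    qed
    thus "\<exists>z'\<in>D v. \<forall>u. le v u \<longrightarrow> \<Phi> u q z' \<longrightarrow> R u \<rho> z A" using t(1) by blast
  qed
  hence f: "fc.frc (w, q) \<rho> A" using pi_charD[OF ok w(1) q(1) w(3)] by blast
  have "ple (w, p) (w, q)" using w q(1,2) by (simp add: ple_pair)
  moreover have "\<Phi> v q z"
    if "le w v" "\<Phi> v p z" "\<And>u y. le v u \<Longrightarrow> y \<in> D u \<Longrightarrow> mem u y z \<Longrightarrow> R u \<rho> y A" for v z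
    using q(4)[OF that(1,2)] c(2) le_trans[OF that(1)] that(3) by blast
  ultimately show ?thesis using that f by blast
qed

text \<open>The critical case. With the antecedent moved into the condition \<open>q\<close>, the
  consequent is reached at some \<open>z\<close>. Let \<open>t\<close> lie above \<open>z\<close>
  and above all members of \<open>z\<close>. Then A^t gives A^y for each member y of
  \<open>z\<close>, which is all that \<open>\<Phi>\<close> for \<open>q\<close> demands at
  \<open>z\<close> beyond \<open>p\<close>; so B^z and hence B^t follow.\<close>

lemma sigma_char_Imp:
  assumes ok: "pi_char A" "sigma_char B" and S: "PiF A" "SigmaF B" and A: "coded A"
  shows "sigma_char (Imp A B)"
  unfolding sigma_char_def
proof (intro HOL.allI impI iffI)
  fix w p and \<rho> :: "nat \<Rightarrow> 'b" assume w: "le w w" "p \<in> D w" "range \<rho> \<subseteq> D w"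
  show "at_stage w p \<rho> (Imp A B)" if f: "fc.frc (w, p) \<rho> (Imp A B)"
  proof -
    obtain q where q: "ple (w, p) (w, q)" "fc.frc (w, q) \<rho> A"
      "\<And>v z. le w v \<Longrightarrow> \<Phi> v p z \<Longrightarrow> (\<And>u y. le v u \<Longrightarrow> y \<in> D u \<Longrightarrow> mem u y z \<Longrightarrow> R u \<rho> y A) \<Longrightarrow> \<Phi> v q z"
      using force_code[OF ok(1) A w] by blast
    have "fc.frc (w, q) \<rho> B" using f q(1,2) unfolding frc_Imp by blast
    hence "at_stage w q \<rho> B" using sigma_charD[OF ok(2) w(1) pleD(5)[OF q(1)] w(3)] by blast
    then obtain z where z: "z \<in> D w" "\<And>v. le w v \<Longrightarrow> \<Phi> v q z \<Longrightarrow> R v \<rho> z B" by (rule at_stageE) blast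
    obtain t where t: "t \<in> D w" "sub w z t" "\<And>v y. le w v \<Longrightarrow> y \<in> D v \<Longrightarrow> mem v y z \<Longrightarrow> sub v y t"
      using transitive_bound[OF w(1) z(1)] by blast
    show ?thesis
    proof (rule at_stageI[OF t(1)])
      fix v assume v: "le w v" "\<Phi> v p t"
      show "R v \<rho> t (Imp A B)" unfolding R.simps
      proof (intro HOL.allI impI)
        fix x assume x: "le v x" "R x \<rho> t A"
        have wx: "le w x" using le_trans[OF v(1) x(1)] .
        have "\<Phi> x q z"
        proof (rule q(3)[OF wx])
          show "\<Phi> x p z" using \<Phi>_sub[OF \<Phi>_mono[OF v(2) x(1)] t(2) wx] .
          fix u y assume u: "le x u" "y \<in> D u" "mem u y z"
          have "sub u y t" using t(3)[OF le_trans[OF wx u(1)] u(2,3)] .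
          thus "R u \<rho> y A" using R_down[OF S(1) le_refl(2)[OF u(1)]] R_mono[OF x(2) u(1)] by blast
        qed
        hence "R x \<rho> z B" using z(2)[OF wx] by blast
        thus "R x \<rho> t B" using R_up[OF S(2) le_refl(2)[OF x(1)] sub_mono[OF t(2) wx]] by blast
      qed
    qed
  qed
  show "fc.frc (w, p) \<rho> (Imp A B)" if ch: "at_stage w p \<rho> (Imp A B)"
    unfolding frc_Imp
  proof (intro HOL.allI impI)
    fix v q assume v: "ple (w, p) (v, q)" "fc.frc (v, q) \<rho> A"
    note vq = pleD(3,5)[OF v(1)] ple_env[OF v(1) w(3)]
    have wv: "le w v" using pleD(1)[OF v(1)] .
    obtain z where z: "z \<in> D w" "\<And>v. le w v \<Longrightarrow> \<Phi> v p z \<Longrightarrow> R v \<rho> z (Imp A B)" using ch at_stageE by blast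
    have zv: "z \<in> D v" using z(1) D_mono[OF wv] by blast
    have "at_stages v q \<rho> A" using v(2) pi_charD[OF ok(1) vq] by blast
    then obtain z' where z': "z' \<in> D v" "\<And>x. le v x \<Longrightarrow> \<Phi> x q z' \<Longrightarrow> R x \<rho> z A"
      using at_stagesE[OF _ vq(1) zv] by blast
    obtain t where t: "t \<in> D v" "sub v z t" "sub v z' t" using upper_bound[OF vq(1) zv z'(1)] by blast
    have "at_stage v q \<rho> B"
    proof (rule at_stageI[OF t(1)])
      fix x assume x: "le v x" "\<Phi> x q t"
      have xx: "le x x" using le_refl(2)[OF x(1)] .
      have "R x \<rho> z (Imp A B)" using z(2)[OF le_trans[OF wv x(1)] \<Phi>_ple[OF \<Phi>_sub[OF x(2) t(2) x(1)] v(1) x(1)]] .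
      moreover have "R x \<rho> z A" using z'(2)[OF x(1) \<Phi>_sub[OF x(2) t(3) x(1)]] .
      ultimately have "R x \<rho> z B" using xx by simp
      thus "R x \<rho> t B" using R_up[OF S(2) xx sub_mono[OF t(2) x(1)]] by blast
    qed
    thus "fc.frc (v, q) \<rho> B" using sigma_charD[OF ok(2) vq] by blast
  qed
qed

text \<open>The stage \<open>z\<close> is prescribed, so the antecedent enters the condition as the
  constant family A^z; being \<Sigma>, it moves up from there to a stage of its own and is
  forced.\<close>

lemma pi_char_Imp:
  assumes ok: "sigma_char A" "pi_char B" and S: "SigmaF A" "PiF B" and A: "coded A"
  shows "pi_char (Imp A B)"
  unfolding pi_char_def
proof (intro HOL.allI impI iffI)
  fix w p and \<rho> :: "nat \<Rightarrow> 'b" assume w: "le w w" "p \<in> D w" "range \<rho> \<subseteq> D w"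
  show "at_stages w p \<rho> (Imp A B)" if f: "fc.frc (w, p) \<rho> (Imp A B)"
  proof (rule at_stagesI)
    fix v z assume v: "le w v" "z \<in> D v"
    have vp: "le v v" "p \<in> D v" "range \<rho> \<subseteq> D v"
      using le_refl(2)[OF v(1)] D_mono[OF v(1)] w by auto
    obtain c where c: "c \<in> D v" "\<And>u y. le v u \<Longrightarrow> y \<in> D u \<Longrightarrow> T u c y \<longleftrightarrow> R u \<rho> z A"
      using coded_constE[OF A vp(1,3) v(2)] by blast
    obtain q where q: "q \<in> D v" "sub v p q"
      "\<And>u y t. le v u \<Longrightarrow> \<Phi> u q t \<Longrightarrow> y \<in> D u \<Longrightarrow> mem u y t \<Longrightarrow> T u c y"
      "\<And>u t. le v u \<Longrightarrow> \<Phi> u p t \<Longrightarrow> (\<And>v' y. le u v' \<Longrightarrow> y \<in> D v' \<Longrightarrow> mem v' y t \<Longrightarrow> T v' c y) \<Longrightarrow> \<Phi> u q t"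
      using extend_condition[OF vp(1,2) c(1)] by blast
    obtain t where t: "t \<in> D v" "sub v z t" "mem v z t" using inhabited_bound[OF vp(1) v(2)] by blast
    have "at_stage v q \<rho> A"
    proof (rule at_stageI[OF t(1)])
      fix x assume x: "le v x" "\<Phi> x q t"
      have "z \<in> D x" "mem x z t" using D_mono[OF x(1)] v(2) mem_mono[OF x(1) t(3)] by auto
      hence "R x \<rho> z A" using q(3)[OF x] c(2)[OF x(1)] by blast
      thus "R x \<rho> t A" using R_up[OF S(1) le_refl(2)[OF x(1)] sub_mono[OF t(2) x(1)]] by blast
    qed
    hence "fc.frc (v, q) \<rho> A" using sigma_charD[OF ok(1) vp(1) q(1) vp(3)] by blast
    moreover have "ple (w, p) (v, q)" using v w q by (simp add: ple_pair)
    ultimately have "fc.frc (v, q) \<rho> B" using f unfolding frc_Imp by blast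
    hence "at_stages v q \<rho> B" using pi_charD[OF ok(2) vp(1) q(1) vp(3)] by blast
    then obtain z' where z': "z' \<in> D v" "\<And>x. le v x \<Longrightarrow> \<Phi> x q z' \<Longrightarrow> R x \<rho> z B"
      using at_stagesE[OF _ vp(1) v(2)] by blast
    have "R u \<rho> z (Imp A B)" if u: "le v u" "\<Phi> u p z'" for u
      unfolding R.simps
    proof (intro HOL.allI impI)
      fix x assume x: "le u x" "R x \<rho> z A"
      have vx: "le v x" using le_trans[OF u(1) x(1)] .
      have "\<Phi> x q z'"
        by (rule q(4)[OF vx \<Phi>_mono[OF u(2) x(1)]]) (use c(2) le_trans[OF vx] R_mono[OF x(2)] in blast)
      thus "R x \<rho> z B" by (rule z'(2)[OF vx])
    qed
    thus "\<exists>z'\<in>D v. \<forall>u. le v u \<longrightarrow> \<Phi> u p z' \<longrightarrow> R u \<rho> z (Imp A B)" using z'(1) by blast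
  qed
  show "fc.frc (w, p) \<rho> (Imp A B)" if ch: "at_stages w p \<rho> (Imp A B)"
    unfolding frc_Imp
  proof (intro HOL.allI impI)
    fix v q assume v: "ple (w, p) (v, q)" "fc.frc (v, q) \<rho> A"
    note vq = pleD(3,5)[OF v(1)] ple_env[OF v(1) w(3)]
    have wv: "le w v" using pleD(1)[OF v(1)] .
    have "at_stage v q \<rho> A" using v(2) sigma_charD[OF ok(1) vq] by blast
    then obtain z1 where z1: "z1 \<in> D v" "\<And>x. le v x \<Longrightarrow> \<Phi> x q z1 \<Longrightarrow> R x \<rho> z1 A" by (rule at_stageE) blast
    have "at_stages v q \<rho> B"
    proof (rule at_stagesI)
      fix x z assume x: "le v x" "z \<in> D x"
      have wx: "le w x" and xx: "le x x" using le_trans[OF wv x(1)] le_refl(2)[OF x(1)] .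
      have z1x: "z1 \<in> D x" using z1(1) D_mono[OF x(1)] by blast
      \<comment> \<open>The antecedent is known at \<open>z1\<close>, while the consequent is wanted
        at \<open>z\<close>. The implication is used at \<open>z0\<close> above both:
        \<open>A\<close> moves up to \<open>z0\<close> and \<open>B\<close> moves down from
        it.\<close>
      obtain z0 where z0: "z0 \<in> D x" "sub x z z0" "sub x z1 z0" using upper_bound[OF xx x(2) z1x] by blast
      obtain z' where z': "z' \<in> D x" "\<And>t. le x t \<Longrightarrow> \<Phi> t p z' \<Longrightarrow> R t \<rho> z0 (Imp A B)"
        using at_stagesE[OF ch wx z0(1)] by blast
      obtain b where b: "b \<in> D x" "sub x z' b" "sub x z1 b" using upper_bound[OF xx z'(1) z1x] by blast
      have "R t \<rho> z B" if t: "le x t" "\<Phi> t q b" for t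
      proof -
        have vt: "le v t" and tt: "le t t" using le_trans[OF x(1) t(1)] le_refl(2)[OF t(1)] .
        have "R t \<rho> z0 (Imp A B)" using z'(2)[OF t(1) \<Phi>_ple[OF \<Phi>_sub[OF t(2) b(2) t(1)] v(1) vt]] .
        moreover have "R t \<rho> z0 A"
          using R_up[OF S(1) tt sub_mono[OF z0(3) t(1)]] z1(2)[OF vt \<Phi>_sub[OF t(2) b(3) t(1)]] by blast
        ultimately have "R t \<rho> z0 B" using tt by simp
        thus ?thesis using R_down[OF S(2) tt sub_mono[OF z0(2) t(1)]] by blast
      qed
      thus "\<exists>z'\<in>D x. \<forall>u. le x u \<longrightarrow> \<Phi> u q z' \<longrightarrow> R u \<rho> z B" using b(1) by blast
    qed
    thus "fc.frc (v, q) \<rho> B" using pi_charD[OF ok(2) vq] by blast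
  qed
qed

text \<open>For \<open>\<Pi>\<close> disjunctions and bounded existentials the stages of the disjuncts need not be uniform;
  instead each disjunct is added to the condition as an assumption and the resulting proofs of the
  goal are merged.\<close>

lemma G_E:
  assumes "G w p c"
  obtains z where "z \<in> D w" "\<And>v. le w v \<Longrightarrow> \<Phi> v p z \<Longrightarrow> \<Psi> v c z"
  using assms unfolding G_def by blast

lemma pi_char_Disj:
  assumes ok: "pi_char A" "pi_char B" and S: "PiF (Disj A B)" and L: "Disj A B \<in> L"
  shows "pi_char (Disj A B)"
  unfolding pi_char_def
proof (intro HOL.allI impI iffI)
  fix w p and \<rho> :: "nat \<Rightarrow> 'b" assume w: "le w w" "p \<in> D w" "range \<rho> \<subseteq> D w"
  have S': "PiF A" "PiF B" using PiF_DisjD[OF S] by auto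
  have c: "coded (Disj A B)" "coded A" "coded B" using coded_L L L_Disj S S' by blast+
  show "at_stages w p \<rho> (Disj A B)" if f: "fc.frc (w, p) \<rho> (Disj A B)"
  proof (rule cl_pi_elim[OF w c(1) f[unfolded fc.frc.simps]])
    fix v q assume v: "ple (w, p) (v, q)" "fc.frc (v, q) \<rho> A \<or> fc.frc (v, q) \<rho> B"
    note vq = pleD(3,5)[OF v(1)] ple_env[OF v(1) w(3)]
    have "at_stages v q \<rho> A \<or> at_stages v q \<rho> B" using v(2) pi_charD[OF ok(1) vq] pi_charD[OF ok(2) vq] by blast
    thus "at_stages v q \<rho> (Disj A B)" unfolding at_stages_def R.simps by meson
  qed
  show "fc.frc (w, p) \<rho> (Disj A B)" if ch: "at_stages w p \<rho> (Disj A B)"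
    unfolding fc.frc.simps cl_pair
  proof (intro HOL.allI impI ballI)
    fix v q c
    assume v: "ple (w, p) (v, q)" "c \<in> D v"
      and g: "\<forall>u r. ple (v, q) (u, r) \<longrightarrow> fc.frc (u, r) \<rho> A \<or> fc.frc (u, r) \<rho> B \<longrightarrow> G u r c"
    note vq = pleD(3,5)[OF v(1)] ple_env[OF v(1) w(3)]
    have wv: "le w v" using pleD(1)[OF v(1)] .
    obtain qa where qa: "ple (v, q) (v, qa)" "fc.frc (v, qa) \<rho> A"
      "\<And>u z. le v u \<Longrightarrow> \<Phi> u q z \<Longrightarrow> (\<And>u' y. le u u' \<Longrightarrow> y \<in> D u' \<Longrightarrow> mem u' y z \<Longrightarrow> R u' \<rho> y A) \<Longrightarrow> \<Phi> u qa z"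
      using force_code[OF ok(1) c(2) vq] by blast
    obtain qb where qb: "ple (v, q) (v, qb)" "fc.frc (v, qb) \<rho> B"
      "\<And>u z. le v u \<Longrightarrow> \<Phi> u q z \<Longrightarrow> (\<And>u' y. le u u' \<Longrightarrow> y \<in> D u' \<Longrightarrow> mem u' y z \<Longrightarrow> R u' \<rho> y B) \<Longrightarrow> \<Phi> u qb z"
      using force_code[OF ok(2) c(3) vq] by blast
    obtain a where a: "a \<in> D v" "\<And>u. le v u \<Longrightarrow> \<Phi> u qa a \<Longrightarrow> \<Psi> u c a" 
    proof -
      have "G v qa c" using g qa(1,2) by blast
      thus ?thesis using that by (rule G_E) blast
    qed
    obtain b where b: "b \<in> D v" "\<And>u. le v u \<Longrightarrow> \<Phi> u qb b \<Longrightarrow> \<Psi> u c b" 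
    proof -
      have "G v qb c" using g qb(1,2) by blast
      thus ?thesis using that by (rule G_E) blast
    qed
    obtain s where s: "s \<in> D v" "sub v a s" "sub v b s" using upper_bound[OF vq(1) a(1) b(1)] by blast
    \<comment> \<open>The disjunction is requested at a stage above all members of \<open>s\<close>.
      Whichever disjunct holds there comes down to the members of \<open>a\<close> or of
      \<open>b\<close>, as the extended conditions demand.\<close>
    obtain z where z: "z \<in> D v" "sub v s z" "\<And>u y. le v u \<Longrightarrow> y \<in> D u \<Longrightarrow> mem u y s \<Longrightarrow> sub u y z"
      using transitive_bound[OF vq(1) s(1)] by blast
    obtain z' where z': "z' \<in> D v" "\<And>u. le v u \<Longrightarrow> \<Phi> u p z' \<Longrightarrow> R u \<rho> z (Disj A B)"
      using at_stagesE[OF ch wv z(1)] by blast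
    obtain t where t: "t \<in> D v" "sub v z t" "sub v z' t" using upper_bound[OF vq(1) z(1) z'(1)] by blast
    have at: "sub v a t" "sub v b t" using s z(2) t(2) sub_trans by blast+
    have "\<Psi> x c t" if x: "le v x" "\<Phi> x q t" for x
    proof -
      have xx: "le x x" using le_refl(2)[OF x(1)] .
      have down: "R u \<rho> y C" if "PiF C" "R x \<rho> z C" "le x u" "y \<in> D u" "mem u y s" for C u y
        using R_down[OF that(1) le_refl(2)[OF that(3)] z(3)[OF le_trans[OF x(1) that(3)] that(4,5)] R_mono[OF that(2,3)]] .
      have "R x \<rho> z A \<or> R x \<rho> z B" using z'(2)[OF x(1) \<Phi>_ple[OF \<Phi>_sub[OF x(2) t(3) x(1)] v(1) x(1)]] by simp
      thus ?thesis
      proof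
        assume A: "R x \<rho> z A"
        have "\<Phi> x qa a"
        proof (rule qa(3)[OF x(1) \<Phi>_sub[OF x(2) at(1) x(1)]])
          fix u y assume u: "le x u" "y \<in> D u" "mem u y a"
          have "mem u y s" using subD[OF s(2) le_trans[OF x(1) u(1)] u(2,3)] .
          thus "R u \<rho> y A" using down[OF S'(1) A u(1,2)] by blast
        qed
        thus ?thesis using \<Psi>_sub[OF a(2)[OF x(1)] xx sub_mono[OF at(1) x(1)]] by blast
      next
        assume B: "R x \<rho> z B"
        have "\<Phi> x qb b"
        proof (rule qb(3)[OF x(1) \<Phi>_sub[OF x(2) at(2) x(1)]])
          fix u y assume u: "le x u" "y \<in> D u" "mem u y b"
          have "mem u y s" using subD[OF s(3) le_trans[OF x(1) u(1)] u(2,3)] .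
          thus "R u \<rho> y B" using down[OF S'(2) B u(1,2)] by blast
        qed
        thus ?thesis using \<Psi>_sub[OF b(2)[OF x(1)] xx sub_mono[OF at(2) x(1)]] by blast
      qed
    qed
    thus "G v q c" unfolding G_def using t(1) by blast
  qed
qed

lemma pi_char_BEx:
  assumes ok: "pi_char A" and S: "PiF (BEx x s A)" and L: "BEx x s A \<in> L"
  shows "pi_char (BEx x s A)"
  unfolding pi_char_def
proof (intro HOL.allI impI iffI)
  fix w p and \<rho> :: "nat \<Rightarrow> 'b" assume w: "le w w" "p \<in> D w" "range \<rho> \<subseteq> D w"
  have S': "PiF A" "x \<noteq> s" using PiF_BExD[OF S] by auto
  have A: "A \<in> L" using L_BEx L by blast
  have cod: "coded (BEx x s A)" "coded A" using coded_L L A S S' by blast+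
  have e: "(\<rho>(x := d)) s = \<rho> s" for d using S' by simp
  show "at_stages w p \<rho> (BEx x s A)" if f: "fc.frc (w, p) \<rho> (BEx x s A)"
  proof (rule cl_pi_elim[OF w cod(1) f[unfolded fc.frc.simps(10)]])
    fix v q assume v: "ple (w, p) (v, q)"
      "\<exists>d\<in>D (fst (v, q)). fc.cl (\<lambda>b. mem (fst b) d ((\<rho>(x := d)) s)) (v, q) \<and> fc.frc (v, q) (\<rho>(x := d)) A"
    then obtain d where d: "d \<in> D v" "fc.frc (v, q) (\<rho>(x := d)) (Mem x s)" "fc.frc (v, q) (\<rho>(x := d)) A"
      unfolding fc.frc.simps fst_conv fun_upd_same by blast
    note vq = pleD(3,5)[OF v(1)] env_upd[OF ple_env[OF v(1) w(3)] d(1), of x]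
    have ch: "at_stages v q (\<rho>(x := d)) A" using d(3) pi_charD[OF ok vq] by blast
    obtain y where y: "y \<in> D v" "\<And>u. le v u \<Longrightarrow> \<Phi> u q y \<Longrightarrow> mem u ((\<rho>(x := d)) x) ((\<rho>(x := d)) s)"
      using frc_MemE[OF d(2) vq] by blast
    show "at_stages v q \<rho> (BEx x s A)"
    proof (rule at_stagesI)
      fix u z assume u: "le v u" "z \<in> D u"
      obtain z' where z': "z' \<in> D u" "\<And>t. le u t \<Longrightarrow> \<Phi> t q z' \<Longrightarrow> R t (\<rho>(x := d)) z A"
        using at_stagesE[OF ch u] by blast
      have yu: "y \<in> D u" using y(1) D_mono[OF u(1)] by blast
      obtain b where b: "b \<in> D u" "sub u z' b" "sub u y b"
        using upper_bound[OF le_refl(2)[OF u(1)] z'(1) yu] by blast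
      have "R t \<rho> z (BEx x s A)" if t: "le u t" "\<Phi> t q b" for t
      proof -
        have vt: "le v t" using le_trans[OF u(1) t(1)] .
        have "R t (\<rho>(x := d)) z A" using z'(2)[OF t(1) \<Phi>_sub[OF t(2) b(2) t(1)]] .
        moreover have "mem t d ((\<rho>(x := d)) s)" using y(2)[OF vt \<Phi>_sub[OF t(2) b(3) t(1)]] by simp
        moreover have "d \<in> D t" using d(1) D_mono[OF vt] by blast
        ultimately show ?thesis unfolding R.simps by blast
      qed
      thus "\<exists>z'\<in>D u. \<forall>t. le u t \<longrightarrow> \<Phi> t q z' \<longrightarrow> R t \<rho> z (BEx x s A)" using b(1) by blast
    qed
  qed
  show "fc.frc (w, p) \<rho> (BEx x s A)" if ch: "at_stages w p \<rho> (BEx x s A)"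
    unfolding fc.frc.simps(10)
  proof (rule cl_pair[THEN iffD2], intro HOL.allI impI ballI)
    fix v q c
    assume v: "ple (w, p) (v, q)" "c \<in> D v"
      and g: "\<forall>u r. ple (v, q) (u, r) \<longrightarrow> (\<exists>d\<in>D (fst (u, r)). fc.cl (\<lambda>b. mem (fst b) d ((\<rho>(x := d)) s)) (u, r) \<and>
        fc.frc (u, r) (\<rho>(x := d)) A) \<longrightarrow> G u r c"
    have g': "G u r c" if "ple (v, q) (u, r)" "d \<in> D u" "mem u d (\<rho> s)" "fc.frc (u, r) (\<rho>(x := d)) A" for u r d
    proof -
      have "fc.frc (u, r) (\<rho>(x := d)) (Mem x s)" by (rule frc_MemI) (use that(3) S' in simp)
      thus ?thesis using g that unfolding fc.frc.simps(1) fst_conv fun_upd_same by blast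
    qed
    note vq = pleD(3,5)[OF v(1)] ple_env[OF v(1) w(3)]
    have wv: "le w v" using pleD(1)[OF v(1)] .
    \<comment> \<open>The goal holds at \<open>z\<close> provided the condition does and
      \<open>A\<close> holds at all members of \<open>z\<close>. Unlike forcing, this is a bounded
      property, so the stages obtained for the various \<open>d\<close> can be collected.\<close>
    define H where "H u d z \<longleftrightarrow> (\<forall>t. le u t \<longrightarrow> \<Phi> t q z \<longrightarrow>
      (\<forall>t'. le t t' \<longrightarrow> (\<forall>y\<in>D t'. mem t' y z \<longrightarrow> R t' (\<rho>(x := d)) y A)) \<longrightarrow> \<Psi> t c z)" for u d z
    have h: "\<exists>z\<in>D u. H u d z" if u: "le v u" "d \<in> D u" "mem u d (\<rho> s)" for u d
    proof -
      have uq: "le u u" "q \<in> D u" "range (\<rho>(x := d)) \<subseteq> D u"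
        using le_refl(2)[OF u(1)] D_mono[OF u(1)] vq(2) env_upd[OF env_mono[OF vq(3) u(1)] u(2)] by blast+
      obtain r where r: "ple (u, q) (u, r)" "fc.frc (u, r) (\<rho>(x := d)) A"
        "\<And>t z. le u t \<Longrightarrow> \<Phi> t q z \<Longrightarrow> (\<And>t' y. le t t' \<Longrightarrow> y \<in> D t' \<Longrightarrow> mem t' y z \<Longrightarrow> R t' (\<rho>(x := d)) y A) \<Longrightarrow> \<Phi> t r z"
        using force_code[OF ok cod(2) uq] by blast
      have "G u r c" using g'[OF ple_trans[OF ple_same[OF u(1) vq(2)] r(1)] u(2,3) r(2)] .
      then obtain z where z: "z \<in> D u" "\<And>t. le u t \<Longrightarrow> \<Phi> t r z \<Longrightarrow> \<Psi> t c z" by (rule G_E) blast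
      have "H u d z" unfolding H_def using z(2) r(3) by blast
      thus ?thesis using z(1) by blast
    qed
    define \<sigma> where "\<sigma> = \<rho>(P := q, uu := c)"
    have \<sigma>: "range \<sigma> \<subseteq> D v" unfolding \<sigma>_def by (intro env_upd vq v(2))
    have xne: "x \<noteq> P" "x \<noteq> Z" "x \<noteq> uu" "x \<noteq> st" using L_fresh[OF L, of x] by auto
    note fA = L_fresh'[OF A]
    let ?B = "Imp phiF (Imp (BAll st Z (rel st A)) psiF)"
    have d: "Delta0 ?B"
      using Delta0_rel[of A st] S' fA ne by (intro Delta0.intros Delta0_phiF Delta0_psiF) auto
    have R: "sem u (\<sigma>(x := d, Z := z, st := y)) (rel st A) \<longleftrightarrow> R u (\<rho>(x := d)) y A" for u d z y
    proof -
      have "R u (\<sigma>(x := d, Z := z)) y A = R u (\<rho>(x := d)) y A"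
        using fA nonvar_nonfree[of _ A] by (intro R_cong) (auto simp: \<sigma>_def)
      thus ?thesis using sem_rel[of st A u "\<sigma>(x := d, Z := z)" y] fA by simp
    qed
    have val: "(\<sigma>(x := d, Z := z)) P = q" "(\<sigma>(x := d, Z := z)) Z = z" "(\<sigma>(x := d, Z := z)) uu = c"
      "(\<sigma>(x := d, Z := z, st := y)) Z = z" for d z y
      using xne ne by (auto simp: \<sigma>_def)
    have sem: "sem u (\<sigma>(x := d, Z := z)) ?B \<longleftrightarrow> H u d z" for u d z
    proof -
      have "sem u (\<sigma>(x := d, Z := z)) ?B \<longleftrightarrow> (\<forall>t. le u t \<longrightarrow> \<Phi> t q z \<longrightarrow> (\<forall>t'. le t t' \<longrightarrow>
        (\<forall>t''. le t' t'' \<longrightarrow> (\<forall>y\<in>D t''. mem t'' y z \<longrightarrow> R t'' (\<rho>(x := d)) y A)) \<longrightarrow> \<Psi> t' c z))"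
        unfolding sem.simps R val sem_psiF using sem_phiF[OF le_refl(2)] val by metis
      also have "\<dots> \<longleftrightarrow> H u d z"
        unfolding H_def using le_refl(2) le_trans \<Phi>_mono by meson
      finally show ?thesis .
    qed
    have "\<rho> s \<in> D v" using vq(3) by auto
    then obtain b where b: "b \<in> D v" "\<And>u d. le v u \<Longrightarrow> d \<in> D u \<Longrightarrow> mem u d (\<rho> s) \<Longrightarrow> \<exists>z\<in>D u. mem u z b \<and> H u d z"
      using collection[OF d xne(2) vq(1) \<sigma>] h unfolding sem by blast
    obtain a where a: "a \<in> D v" "\<And>u z. le v u \<Longrightarrow> z \<in> D u \<Longrightarrow> mem u z b \<Longrightarrow> sub u z a"
      using union_bound[OF vq(1) b(1)] by blast
    obtain z where z: "z \<in> D v" "sub v a z" "\<And>u y. le v u \<Longrightarrow> y \<in> D u \<Longrightarrow> mem u y a \<Longrightarrow> sub u y z"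
      using transitive_bound[OF vq(1) a(1)] by blast
    obtain z' where z': "z' \<in> D v" "\<And>u. le v u \<Longrightarrow> \<Phi> u p z' \<Longrightarrow> R u \<rho> z (BEx x s A)"
      using at_stagesE[OF ch wv z(1)] by blast
    obtain t where t: "t \<in> D v" "sub v z t" "sub v z' t" using upper_bound[OF vq(1) z(1) z'(1)] by blast
    have "\<Psi> u c t" if u: "le v u" "\<Phi> u q t" for u
    proof -
      have uu: "le u u" using le_refl(2)[OF u(1)] .
      have "R u \<rho> z (BEx x s A)" using z'(2)[OF u(1) \<Phi>_ple[OF \<Phi>_sub[OF u(2) t(3) u(1)] v(1) u(1)]] .
      then obtain d where d: "d \<in> D u" "mem u d (\<rho> s)" "R u (\<rho>(x := d)) z A" unfolding R.simps e by blast
      obtain y where y: "y \<in> D u" "mem u y b" "H u d y" using b(2)[OF u(1) d(1,2)] by blast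
      have ya: "sub u y a" using a(2)[OF u(1) y(1,2)] .
      have yt: "sub u y t" using sub_trans[OF sub_trans[OF ya sub_mono[OF z(2) u(1)]] sub_mono[OF t(2) u(1)]] .
      have "R t' (\<rho>(x := d)) y' A" if t': "le u t'" "y' \<in> D t'" "mem t' y' y" for t' y'
      proof -
        have "mem t' y' a" using subD[OF ya t'] .
        hence "sub t' y' z" using z(3)[OF le_trans[OF u(1) t'(1)] t'(2)] by blast
        thus ?thesis using R_down[OF S'(1) le_refl(2)[OF t'(1)]] R_mono[OF d(3) t'(1)] by blast
      qed
      hence "\<Psi> u c y" using y(3) uu \<Phi>_anti[OF u(2) sub_refl yt] unfolding H_def by blast
      thus ?thesis using \<Psi>_sub[OF _ uu yt] by blast
    qed
    thus "G v q c" unfolding G_def using t(1) by blast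
  qed
qed

text \<open>One induction treats both classes, since the antecedent of an implication belongs to the
  opposite class.\<close>

theorem stage_characterization: "A \<in> L \<Longrightarrow> (SigmaF A \<longrightarrow> sigma_char A) \<and> (PiF A \<longrightarrow> pi_char A)"
proof (induction A)
  case (Mem x y) show ?case using char_Mem by blast
next
  case (Eq x y) show ?case using char_Eq by blast
next
  case Bot show ?case using char_Bot by blast
next
  case (Conj A B) thus ?case using L_Conj SigmaF_ConjD PiF_ConjD sigma_char_Conj pi_char_Conj by meson
next
  case (Disj A B) thus ?case using L_Disj SigmaF_DisjD PiF_DisjD sigma_char_Disj pi_char_Disj by meson
next
  case (Imp A B) thus ?case using L_Imp SigmaF_ImpD PiF_ImpD sigma_char_Imp pi_char_Imp coded_L by meson
next
  case (All x A) thus ?case using L_All SigmaF_AllD PiF_AllD pi_char_All by meson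
next
  case (Ex x A) thus ?case using L_Ex SigmaF_ExD PiF_ExD sigma_char_Ex by meson
next
  case (BAll x s A) thus ?case using L_BAll SigmaF_BAllD PiF_BAllD sigma_char_BAll pi_char_BAll by meson
next
  case (BEx x s A) thus ?case using L_BEx SigmaF_BExD PiF_BExD sigma_char_BEx pi_char_BEx by meson
qed

end

section \<open>Definability of forcing\<close>

context reflection
begin

text \<open>The condition is the value of the variable \<open>p\<close>. The defining formula may be
  unbounded: forcing quantifies over all conditions and goals, and set induction is available for
  arbitrary formulas.\<close>

definition definable :: "((nat \<Rightarrow> 'b) \<Rightarrow> 'a \<times> 'b \<Rightarrow> bool) \<Rightarrow> nat \<Rightarrow> bool" where
  "definable X p \<longleftrightarrow> (\<exists>B. \<forall>v \<rho>. le v v \<longrightarrow> range \<rho> \<subseteq> D v \<longrightarrow> (sem v \<rho> B \<longleftrightarrow> X \<rho> (v, \<rho> p)))"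

lemma definableI: "(\<And>v \<rho>. le v v \<Longrightarrow> range \<rho> \<subseteq> D v \<Longrightarrow> sem v \<rho> B \<longleftrightarrow> X \<rho> (v, \<rho> p)) \<Longrightarrow> definable X p"
  unfolding definable_def by blast

lemma definableE:
  assumes "definable X p"
  obtains B where "\<And>v \<rho>. le v v \<Longrightarrow> range \<rho> \<subseteq> D v \<Longrightarrow> sem v \<rho> B \<longleftrightarrow> X \<rho> (v, \<rho> p)"
  using assms unfolding definable_def by blast

definition subF :: "nat \<Rightarrow> nat \<Rightarrow> fm" where
  "subF p q = BAll (Suc (p + q)) p (Mem (Suc (p + q)) q)"

lemma sem_subF: "sem v \<rho> (subF p q) \<longleftrightarrow> sub v (\<rho> p) (\<rho> q)"
  unfolding subF_def sub_def by auto

lemma G_formula: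
  obtains B where "\<And>v \<rho>. sem v \<rho> B \<longleftrightarrow> G v (\<rho> q) (\<rho> c)"
proof -
  have val: "(\<rho>(Z := z)) P = \<rho> P" "(\<rho>(Z := z)) Z = z" "(\<rho>(Z := z)) uu = \<rho> uu" for \<rho> :: "nat \<Rightarrow> 'b" and z
    using ne by auto
  have "sem v (\<rho>(Z := z)) (Imp phiF psiF) \<longleftrightarrow> (\<forall>u. le v u \<longrightarrow> \<Phi> u (\<rho> P) z \<longrightarrow> \<Psi> u (\<rho> uu) z)" for v \<rho> z
    unfolding sem.simps sem_psiF val using sem_phiF le_refl val by metis
  hence "sem v \<rho> (Ex Z (Imp phiF psiF)) \<longleftrightarrow> G v (\<rho> P) (\<rho> uu)" for v \<rho>
    unfolding G_def sem.simps(8) by simp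
  moreover obtain B where B: "\<And>v \<rho>. sem v \<rho> B = sem v (\<rho> \<circ> id(P := q, uu := c)) (Ex Z (Imp phiF psiF))"
    by (rule ex_rename[of "Ex Z (Imp phiF psiF)" "id(P := q, uu := c)"]) metis
  moreover have "(\<rho> \<circ> id(P := q, uu := c)) P = \<rho> q" "(\<rho> \<circ> id(P := q, uu := c)) uu = \<rho> c" for \<rho> :: "nat \<Rightarrow> 'b"
    using ne by auto
  ultimately have "sem v \<rho> B \<longleftrightarrow> G v (\<rho> q) (\<rho> c)" for v \<rho> by metis
  thus ?thesis by (rule that)
qed

text \<open>The Kripke semantics of \<open>All\<close> and \<open>Imp\<close> already ranges over
  later worlds, so a quantifier over extensions of a condition has to spell out only the
  inclusion.\<close>

lemma sem_extensions:
  assumes q: "q \<noteq> p" and w: "le w w" "range \<rho> \<subseteq> D w"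
    and B: "\<And>v \<rho>. le v v \<Longrightarrow> range \<rho> \<subseteq> D v \<Longrightarrow> sem v \<rho> B \<longleftrightarrow> X \<rho> v"
  shows "sem w \<rho> (All q (Imp (subF p q) B)) \<longleftrightarrow> (\<forall>v r. ple (w, \<rho> p) (v, r) \<longrightarrow> X (\<rho>(q := r)) v)"
proof -
  have "sem w \<rho> (All q (Imp (subF p q) B)) \<longleftrightarrow>
    (\<forall>v. le w v \<longrightarrow> (\<forall>r\<in>D v. \<forall>u. le v u \<longrightarrow> sub u (\<rho> p) r \<longrightarrow> sem u (\<rho>(q := r)) B))"
    unfolding sem.simps sem_subF using q by simp
  also have "\<dots> \<longleftrightarrow> (\<forall>v r. ple (w, \<rho> p) (v, r) \<longrightarrow> sem v (\<rho>(q := r)) B)"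
  proof (intro iffI HOL.allI impI ballI)
    fix v r
    assume h: "\<forall>v. le w v \<longrightarrow> (\<forall>r\<in>D v. \<forall>u. le v u \<longrightarrow> sub u (\<rho> p) r \<longrightarrow> sem u (\<rho>(q := r)) B)"
      and v: "ple (w, \<rho> p) (v, r)"
    show "sem v (\<rho>(q := r)) B" using h pleD[OF v] by blast
  next
    fix v r u
    assume h: "\<forall>v r. ple (w, \<rho> p) (v, r) \<longrightarrow> sem v (\<rho>(q := r)) B"
      and v: "le w v" "r \<in> D v" "le v u" "sub u (\<rho> p) r"
    have "ple (w, \<rho> p) (u, r)"
      using le_trans[OF v(1,3)] w(2) D_mono[OF v(3)] v(2,4) by (auto simp: ple_pair)
    thus "sem u (\<rho>(q := r)) B" using h by blast
  qed
  also have "\<dots> \<longleftrightarrow> (\<forall>v r. ple (w, \<rho> p) (v, r) \<longrightarrow> X (\<rho>(q := r)) v)"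
  proof -
    have "sem v (\<rho>(q := r)) B \<longleftrightarrow> X (\<rho>(q := r)) v" if v: "ple (w, \<rho> p) (v, r)" for v r
      by (rule B[OF pleD(3)[OF v] env_upd[OF ple_env[OF v w(2)] pleD(5)[OF v]]])
    thus ?thesis by blast
  qed
  finally show ?thesis .
qed

text \<open>Conditions and goals are elements of the domain, which makes the closure expressible. As
  \<open>X\<close> depends only on variables in \<open>S\<close>, the auxiliary variables for two
  conditions and a goal are chosen outside \<open>S\<close> and do not disturb it.\<close>

lemma definable_cl:
  assumes S: "finite S" "p \<notin> S" and X: "\<And>\<rho> \<sigma> a. \<forall>i\<in>S. \<rho> i = \<sigma> i \<Longrightarrow> X \<rho> a \<longleftrightarrow> X \<sigma> a"
    and d: "\<And>r. r \<notin> S \<Longrightarrow> definable X r"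
  shows "definable (\<lambda>\<rho>. fc.cl (X \<rho>)) p"
proof -
  obtain q where q: "q \<notin> insert p S" using fresh_var[of "insert p S"] S by auto
  obtain r where r: "r \<notin> insert q (insert p S)" using fresh_var[of "insert q (insert p S)"] S by auto
  obtain c where c: "c \<notin> insert r (insert q (insert p S))"
    using fresh_var[of "insert r (insert q (insert p S))"] S by auto
  have "r \<notin> S" using r by auto
  then obtain B where B: "\<And>v \<rho>. le v v \<Longrightarrow> range \<rho> \<subseteq> D v \<Longrightarrow> sem v \<rho> B \<longleftrightarrow> X \<rho> (v, \<rho> r)"
    using definableE[OF d] by blast
  obtain G1 where G1: "\<And>v \<rho>. sem v \<rho> G1 \<longleftrightarrow> G v (\<rho> r) (\<rho> c)" using G_formula by blast
  obtain G2 where G2: "\<And>v \<rho>. sem v \<rho> G2 \<longleftrightarrow> G v (\<rho> q) (\<rho> c)" using G_formula by blast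
  let ?H = "All r (Imp (subF q r) (Imp B G1))"
  let ?F = "All c (Imp ?H G2)"
  have inner: "sem v \<rho> (Imp B G1) \<longleftrightarrow> (\<forall>u. le v u \<longrightarrow> X \<rho> (u, \<rho> r) \<longrightarrow> G u (\<rho> r) (\<rho> c))"
    if "le v v" "range \<rho> \<subseteq> D v" for v \<rho>
  proof -
    have "sem u \<rho> B \<longleftrightarrow> X \<rho> (u, \<rho> r)" if "le v u" for u
      by (rule B[OF le_refl(2)[OF that] env_mono[OF \<open>range \<rho> \<subseteq> D v\<close> that]])
    thus ?thesis unfolding sem.simps G1 by blast
  qed
  have H: "sem v \<rho> ?H \<longleftrightarrow> (\<forall>u s. ple (v, \<rho> q) (u, s) \<longrightarrow> X \<rho> (u, s) \<longrightarrow> G u s (\<rho> c))"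
    if v: "le v v" "range \<rho> \<subseteq> D v" for v \<rho>
  proof -
    have "q \<noteq> r" using r by auto
    have "sem v \<rho> ?H \<longleftrightarrow> (\<forall>u s. ple (v, \<rho> q) (u, s) \<longrightarrow> (\<forall>t. le u t \<longrightarrow> X (\<rho>(r := s)) (t, s) \<longrightarrow> G t s (\<rho> c)))"
      using sem_extensions[OF \<open>q \<noteq> r\<close>[symmetric] v inner] r c by simp
    also have "\<dots> \<longleftrightarrow> (\<forall>u s. ple (v, \<rho> q) (u, s) \<longrightarrow> (\<forall>t. le u t \<longrightarrow> X \<rho> (t, s) \<longrightarrow> G t s (\<rho> c)))"
    proof -
      have "X (\<rho>(r := s)) a \<longleftrightarrow> X \<rho> a" for s a by (rule X) (use r in auto)
      thus ?thesis by simp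
    qed
    also have "\<dots> \<longleftrightarrow> (\<forall>u s. ple (v, \<rho> q) (u, s) \<longrightarrow> X \<rho> (u, s) \<longrightarrow> G u s (\<rho> c))"
      using pleD(3) ple_trans[OF _ ple_same] pleD(5) by meson
    finally show ?thesis .
  qed
  have F: "sem v \<rho> ?F \<longleftrightarrow> (\<forall>u. le v u \<longrightarrow> (\<forall>e\<in>D u. \<forall>t. le u t \<longrightarrow>
      (\<forall>x s. ple (t, \<rho> q) (x, s) \<longrightarrow> X \<rho> (x, s) \<longrightarrow> G x s e) \<longrightarrow> G t (\<rho> q) e))"
    if v: "le v v" "range \<rho> \<subseteq> D v" for v \<rho>
  proof -
    have "sem t (\<rho>(c := e)) ?H \<longleftrightarrow> (\<forall>x s. ple (t, \<rho> q) (x, s) \<longrightarrow> X \<rho> (x, s) \<longrightarrow> G x s e)"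
      if "le v u" "e \<in> D u" "le u t" for t e u
    proof -
      have "range (\<rho>(c := e)) \<subseteq> D t" using env_mono[OF env_upd[OF env_mono[OF v(2) that(1)] that(2)] that(3)] .
      moreover have "X (\<rho>(c := e)) a \<longleftrightarrow> X \<rho> a" for a by (rule X) (use c in auto)
      moreover have "(\<rho>(c := e)) q = \<rho> q" "(\<rho>(c := e)) c = e" using c by auto
      ultimately show ?thesis using H[of t "\<rho>(c := e)"] le_refl(2)[OF that(3)] by simp
    qed
    moreover have "(\<rho>(c := e)) q = \<rho> q" "(\<rho>(c := e)) c = e" for e using c by auto
    ultimately show ?thesis unfolding sem.simps(7)[of _ _ c] sem.simps(6)[of _ _ ?H] G2 by auto
  qed
  show ?thesis
  proof (rule definableI[of "All q (Imp (subF p q) ?F)"])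
    fix v and \<rho> :: "nat \<Rightarrow> 'b" assume v: "le v v" "range \<rho> \<subseteq> D v"
    have "q \<noteq> p" using q by auto
    have "sem v \<rho> (All q (Imp (subF p q) ?F)) \<longleftrightarrow> (\<forall>u s. ple (v, \<rho> p) (u, s) \<longrightarrow>
      (\<forall>t. le u t \<longrightarrow> (\<forall>e\<in>D t. \<forall>y. le t y \<longrightarrow>
        (\<forall>x s'. ple (y, s) (x, s') \<longrightarrow> X \<rho> (x, s') \<longrightarrow> G x s' e) \<longrightarrow> G y s e)))"
    proof -
      have "X (\<rho>(q := s)) a \<longleftrightarrow> X \<rho> a" for s a by (rule X) (use q in auto)
      thus ?thesis using sem_extensions[OF \<open>q \<noteq> p\<close> v F] by simp
    qed
    also have "\<dots> \<longleftrightarrow> fc.cl (X \<rho>) (v, \<rho> p)"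
      unfolding cl_pair
    proof (intro iffI HOL.allI impI ballI)
      fix u s e
      assume h: "\<forall>u s. ple (v, \<rho> p) (u, s) \<longrightarrow> (\<forall>t. le u t \<longrightarrow> (\<forall>e\<in>D t. \<forall>y. le t y \<longrightarrow>
        (\<forall>x s'. ple (y, s) (x, s') \<longrightarrow> X \<rho> (x, s') \<longrightarrow> G x s' e) \<longrightarrow> G y s e))"
        and u: "ple (v, \<rho> p) (u, s)" "e \<in> D u" "\<forall>x s'. ple (u, s) (x, s') \<longrightarrow> X \<rho> (x, s') \<longrightarrow> G x s' e"
      show "G u s e" using h u pleD(3)[OF u(1)] by blast
    next
      fix u s t e y
      assume h: "\<forall>u s. ple (v, \<rho> p) (u, s) \<longrightarrow> (\<forall>e\<in>D u.
          (\<forall>x s'. ple (u, s) (x, s') \<longrightarrow> X \<rho> (x, s') \<longrightarrow> G x s' e) \<longrightarrow> G u s e)"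
        and u: "ple (v, \<rho> p) (u, s)" "le u t" "e \<in> D t" "le t y"
          "\<forall>x s'. ple (y, s) (x, s') \<longrightarrow> X \<rho> (x, s') \<longrightarrow> G x s' e"
      have "ple (v, \<rho> p) (y, s)" using ple_trans[OF u(1) ple_same[OF le_trans[OF u(2,4)] pleD(5)[OF u(1)]]] .
      moreover have "e \<in> D y" using u(3) D_mono[OF u(4)] by blast
      ultimately show "G y s e" using h u(5) by blast
    qed
    finally show "sem v \<rho> (All q (Imp (subF p q) ?F)) \<longleftrightarrow> fc.cl (X \<rho>) (v, \<rho> p)" .
  qed
qed

lemma definable_Conj_Disj:
  assumes "definable X p" "definable Y p"
  shows "definable (\<lambda>\<rho> a. X \<rho> a \<and> Y \<rho> a) p" "definable (\<lambda>\<rho> a. X \<rho> a \<or> Y \<rho> a) p"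
proof -
  obtain A where A: "\<And>v \<rho>. le v v \<Longrightarrow> range \<rho> \<subseteq> D v \<Longrightarrow> sem v \<rho> A \<longleftrightarrow> X \<rho> (v, \<rho> p)" using definableE[OF assms(1)] by blast
  obtain B where B: "\<And>v \<rho>. le v v \<Longrightarrow> range \<rho> \<subseteq> D v \<Longrightarrow> sem v \<rho> B \<longleftrightarrow> Y \<rho> (v, \<rho> p)" using definableE[OF assms(2)] by blast
  show "definable (\<lambda>\<rho> a. X \<rho> a \<and> Y \<rho> a) p" by (rule definableI[of "Conj A B"]) (simp add: A B)
  show "definable (\<lambda>\<rho> a. X \<rho> a \<or> Y \<rho> a) p" by (rule definableI[of "Disj A B"]) (simp add: A B)
qed

lemma definable_Ex:
  assumes "definable X p" "p \<noteq> x"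
  shows "definable (\<lambda>\<rho> a. \<exists>d\<in>D (fst a). X (\<rho>(x := d)) a) p"
proof -
  obtain A where A: "\<And>v \<rho>. le v v \<Longrightarrow> range \<rho> \<subseteq> D v \<Longrightarrow> sem v \<rho> A \<longleftrightarrow> X \<rho> (v, \<rho> p)" using definableE[OF assms(1)] by blast
  show ?thesis
  proof (rule definableI[of "Ex x A"])
    fix v and \<rho> :: "nat \<Rightarrow> 'b" assume v: "le v v" "range \<rho> \<subseteq> D v"
    have "sem v (\<rho>(x := d)) A \<longleftrightarrow> X (\<rho>(x := d)) (v, \<rho> p)" if "d \<in> D v" for d
      using A[OF v(1) env_upd[OF v(2) that]] assms(2) by simp
    thus "sem v \<rho> (Ex x A) \<longleftrightarrow> (\<exists>d\<in>D (fst (v, \<rho> p)). X (\<rho>(x := d)) (v, \<rho> p))" by auto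
  qed
qed

abbreviation forces :: "fm \<Rightarrow> (nat \<Rightarrow> 'b) \<Rightarrow> 'a \<times> 'b \<Rightarrow> bool" where
  "forces A \<equiv> \<lambda>\<rho> a. fc.frc a \<rho> A"

lemma definable_Imp:
  assumes S: "finite S" "p \<notin> S" "vars A \<subseteq> S" "vars B \<subseteq> S"
    and d: "\<And>q. q \<notin> S \<Longrightarrow> definable (forces A) q" "\<And>q. q \<notin> S \<Longrightarrow> definable (forces B) q"
  shows "definable (forces (Imp A B)) p"
proof -
  obtain q where q: "q \<notin> insert p S" using fresh_var[of "insert p S"] S by auto
  hence qS: "q \<notin> S" "q \<noteq> p" by auto
  obtain A' where A: "\<And>v \<rho>. le v v \<Longrightarrow> range \<rho> \<subseteq> D v \<Longrightarrow> sem v \<rho> A' \<longleftrightarrow> fc.frc (v, \<rho> q) \<rho> A"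
    using definableE[OF d(1)[OF qS(1)]] by blast
  obtain B' where B: "\<And>v \<rho>. le v v \<Longrightarrow> range \<rho> \<subseteq> D v \<Longrightarrow> sem v \<rho> B' \<longleftrightarrow> fc.frc (v, \<rho> q) \<rho> B"
    using definableE[OF d(2)[OF qS(1)]] by blast
  have i: "sem v \<rho> (Imp A' B') \<longleftrightarrow> (\<forall>u. le v u \<longrightarrow> fc.frc (u, \<rho> q) \<rho> A \<longrightarrow> fc.frc (u, \<rho> q) \<rho> B)"
    if "le v v" "range \<rho> \<subseteq> D v" for v \<rho>
  proof -
    have "(sem u \<rho> A' \<longleftrightarrow> fc.frc (u, \<rho> q) \<rho> A) \<and> (sem u \<rho> B' \<longleftrightarrow> fc.frc (u, \<rho> q) \<rho> B)" if "le v u" for u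
      using A B le_refl(2)[OF that] env_mono[OF \<open>range \<rho> \<subseteq> D v\<close> that] by blast
    thus ?thesis unfolding sem.simps by blast
  qed
  show ?thesis
  proof (rule definableI[of "All q (Imp (subF p q) (Imp A' B'))"])
    fix v and \<rho> :: "nat \<Rightarrow> 'b" assume v: "le v v" "range \<rho> \<subseteq> D v"
    have c: "fc.frc a (\<rho>(q := r)) A = fc.frc a \<rho> A" "fc.frc a (\<rho>(q := r)) B = fc.frc a \<rho> B" for a r
    proof -
      have "q \<notin> fv A" "q \<notin> fv B" using qS S nonvar_nonfree by blast+
      thus "fc.frc a (\<rho>(q := r)) A = fc.frc a \<rho> A" "fc.frc a (\<rho>(q := r)) B = fc.frc a \<rho> B"
        by (auto intro!: fc.frc_cong)
    qed
    have "sem v \<rho> (All q (Imp (subF p q) (Imp A' B'))) \<longleftrightarrow> (\<forall>u r. ple (v, \<rho> p) (u, r) \<longrightarrow>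
        (\<forall>t. le u t \<longrightarrow> fc.frc (t, r) \<rho> A \<longrightarrow> fc.frc (t, r) \<rho> B))"
      using sem_extensions[OF qS(2) v i] c by simp
    also have "\<dots> \<longleftrightarrow> fc.frc (v, \<rho> p) \<rho> (Imp A B)"
      unfolding frc_Imp using pleD(3) ple_trans[OF _ ple_same] pleD(5) by meson
    finally show "sem v \<rho> (All q (Imp (subF p q) (Imp A' B'))) \<longleftrightarrow> fc.frc (v, \<rho> p) \<rho> (Imp A B)" .
  qed
qed

lemma definable_All:
  assumes p: "p \<notin> insert x (vars A)" and d: "\<And>q. q \<notin> vars A \<Longrightarrow> definable (forces A) q"
  shows "definable (forces (All x A)) p"
proof -
  obtain q where q: "q \<notin> insert p (insert x (vars A))"
    using fresh_var[of "insert p (insert x (vars A))"] by (auto simp: finite_vars)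
  hence q': "q \<notin> vars A" "q \<noteq> p" "q \<noteq> x" by auto
  obtain A' where A: "\<And>v \<rho>. le v v \<Longrightarrow> range \<rho> \<subseteq> D v \<Longrightarrow> sem v \<rho> A' \<longleftrightarrow> fc.frc (v, \<rho> q) \<rho> A"
    using definableE[OF d[OF q'(1)]] by blast
  have i: "sem v \<rho> (All x A') \<longleftrightarrow> (\<forall>u. le v u \<longrightarrow> (\<forall>e\<in>D u. fc.frc (u, \<rho> q) (\<rho>(x := e)) A))"
    if "le v v" "range \<rho> \<subseteq> D v" for v \<rho>
  proof -
    have "sem u (\<rho>(x := e)) A' \<longleftrightarrow> fc.frc (u, \<rho> q) (\<rho>(x := e)) A" if "le v u" "e \<in> D u" for u e
      using A[OF le_refl(2)[OF that(1)] env_upd[OF env_mono[OF \<open>range \<rho> \<subseteq> D v\<close> that(1)] that(2)], of x] q' by simp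
    thus ?thesis unfolding sem.simps by blast
  qed
  show ?thesis
  proof (rule definableI[of "All q (Imp (subF p q) (All x A'))"])
    fix v and \<rho> :: "nat \<Rightarrow> 'b" assume v: "le v v" "range \<rho> \<subseteq> D v"
    have c: "fc.frc a (\<rho>(q := r, x := e)) A = fc.frc a (\<rho>(x := e)) A" for a r e
      using q' nonvar_nonfree[of q A] by (intro fc.frc_cong) auto
    have "sem v \<rho> (All q (Imp (subF p q) (All x A'))) \<longleftrightarrow> (\<forall>u r. ple (v, \<rho> p) (u, r) \<longrightarrow>
        (\<forall>t. le u t \<longrightarrow> (\<forall>e\<in>D t. fc.frc (t, r) (\<rho>(x := e)) A)))"
      using sem_extensions[OF q'(2) v i] c by simp
    also have "\<dots> \<longleftrightarrow> fc.frc (v, \<rho> p) \<rho> (All x A)"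
      unfolding frc_All using pleD(3) ple_trans[OF _ ple_same] pleD(5) by meson
    finally show "sem v \<rho> (All q (Imp (subF p q) (All x A'))) \<longleftrightarrow> fc.frc (v, \<rho> p) \<rho> (All x A)" .
  qed
qed

lemma definable_frc_Ex:
  assumes p: "p \<notin> insert x (vars A)" and d: "\<And>q. q \<notin> vars A \<Longrightarrow> definable (forces A) q"
  shows "definable (forces (Ex x A)) p"
  unfolding fc.frc.simps
proof (rule definable_cl[of "insert x (vars A)"])
  fix \<rho> \<sigma> :: "nat \<Rightarrow> 'b" and a
  assume "\<forall>i\<in>insert x (vars A). \<rho> i = \<sigma> i"
  hence "fc.frc a (\<rho>(x := e)) A = fc.frc a (\<sigma>(x := e)) A" for e
    using fv_subset_vars[of A] by (intro fc.frc_cong) auto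
  thus "(\<exists>d\<in>D (fst a). fc.frc a (\<rho>(x := d)) A) \<longleftrightarrow> (\<exists>d\<in>D (fst a). fc.frc a (\<sigma>(x := d)) A)" by simp
next
  fix r assume "r \<notin> insert x (vars A)"
  thus "definable (\<lambda>\<rho> b. \<exists>d\<in>D (fst b). fc.frc b (\<rho>(x := d)) A) r"
    using definable_Ex[OF d] by auto
qed (use p finite_vars in auto)

lemma definable_atoms:
  "p \<notin> {x, y} \<Longrightarrow> definable (forces (Mem x y)) p"
  "p \<notin> {x, y} \<Longrightarrow> definable (forces (Eq x y)) p"
  "definable (forces Bot) p"
proof -
  have "definable (\<lambda>\<rho> b. mem (fst b) (\<rho> x) (\<rho> y)) r" for r by (rule definableI[of "Mem x y"]) simp
  thus "p \<notin> {x, y} \<Longrightarrow> definable (forces (Mem x y)) p"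
    unfolding fc.frc.simps by (intro definable_cl[of "{x, y}"]) auto
  have "definable (\<lambda>\<rho> b. eq (fst b) (\<rho> x) (\<rho> y)) r" for r by (rule definableI[of "Eq x y"]) simp
  thus "p \<notin> {x, y} \<Longrightarrow> definable (forces (Eq x y)) p"
    unfolding fc.frc.simps by (intro definable_cl[of "{x, y}"]) auto
  have "definable (\<lambda>\<rho> b. False) r" for r by (rule definableI[of Bot]) simp
  thus "definable (forces Bot) p"
    unfolding fc.frc.simps by (intro definable_cl[of "{}"]) auto
qed

theorem definable_frc: "p \<notin> vars A \<Longrightarrow> definable (forces A) p"
proof (induction A arbitrary: p)
  case (Mem x y) thus ?case using definable_atoms(1) by simp
next
  case (Eq x y) thus ?case using definable_atoms(2) by simp
next
  case Bot show ?case using definable_atoms(3) by simp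
next
  case (Conj A B) thus ?case unfolding fc.frc.simps by (intro definable_Conj_Disj(1)) auto
next
  case (Disj A B)
  show ?case unfolding fc.frc.simps
  proof (rule definable_cl[of "vars A \<union> vars B"])
    fix \<rho> \<sigma> :: "nat \<Rightarrow> 'b" and a
    assume "\<forall>i\<in>vars A \<union> vars B. \<rho> i = \<sigma> i"
    hence "fc.frc a \<rho> A = fc.frc a \<sigma> A" "fc.frc a \<rho> B = fc.frc a \<sigma> B"
      using fv_subset_vars[of A] fv_subset_vars[of B] by (auto intro!: fc.frc_cong)
    thus "fc.frc a \<rho> A \<or> fc.frc a \<rho> B \<longleftrightarrow> fc.frc a \<sigma> A \<or> fc.frc a \<sigma> B" by simp
  qed (use Disj finite_vars definable_Conj_Disj(2) in auto)
next
  case (Imp A B) show ?case by (rule definable_Imp[of "vars A \<union> vars B"]) (use Imp finite_vars in auto)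
next
  case (All x A) show ?case by (rule definable_All) (use All in auto)
next
  case (Ex x A) show ?case by (rule definable_frc_Ex) (use Ex in auto)
next
  case (BAll x s A)
  have "definable (forces (Imp (Mem x s) A)) q" if "q \<notin> vars (Imp (Mem x s) A)" for q
    by (rule definable_Imp[of "{x, s} \<union> vars A"]) (use that BAll.IH finite_vars definable_atoms(1) in auto)
  hence "definable (forces (All x (Imp (Mem x s) A))) p" by (intro definable_All) (use BAll.prems in auto)
  moreover have "forces (BAll x s A) = forces (All x (Imp (Mem x s) A))"
    by (simp only: fc.frc_BAll_iff)
  ultimately show ?case by simp
next
  case (BEx x s A)
  have "definable (forces (Conj (Mem x s) A)) q" if "q \<notin> vars (Conj (Mem x s) A)" for q
    unfolding fc.frc.simps(4) by (rule definable_Conj_Disj(1)) (use that BEx.IH definable_atoms(1) in \<open>auto simp del: fc.frc.simps\<close>)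
  hence "definable (forces (Ex x (Conj (Mem x s) A))) p" by (intro definable_frc_Ex) (use BEx.prems in auto)
  moreover have "forces (BEx x s A) = forces (Ex x (Conj (Mem x s) A))" by (auto simp: fun_eq_iff)
  ultimately show ?case by simp
qed

section \<open>Forcing the axioms\<close>

text \<open>With the condition \<open>r\<close> stored in a fresh variable \<open>pv\<close>,
  forcing of \<open>A\<close> at \<open>r\<close> becomes the truth of a formula \<open>B\<close>,
  and set induction for \<open>B\<close> in the model gives the claim.\<close>

lemma forced_Set_Ind:
  assumes x: "x \<noteq> a" "x \<notin> fv A" "substitutable x a A" and w: "le w w" "p \<in> D w" "range \<rho> \<subseteq> D w"
  shows "fc.frc (w, p) \<rho> (Imp (All a (Imp (BAll x a (subst A a x)) A)) (All a A))"
  unfolding frc_Imp[of _ _ _ _ "All a A"] frc_All[of _ _ _ _ A]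
proof (intro HOL.allI impI ballI)
  fix v q u r d
  assume v: "ple (w, p) (v, q)" and f: "fc.frc (v, q) \<rho> (All a (Imp (BAll x a (subst A a x)) A))"
    and u: "ple (v, q) (u, r)" and d: "d \<in> D u"
  obtain pv where pv: "pv \<notin> insert a (vars A)" using fresh_var[of "insert a (vars A)"] by (auto simp: finite_vars)
  then obtain B where B: "\<And>v \<rho>. le v v \<Longrightarrow> range \<rho> \<subseteq> D v \<Longrightarrow> sem v \<rho> B \<longleftrightarrow> fc.frc (v, \<rho> pv) \<rho> A"
    using definableE[OF definable_frc[of pv A]] by blast
  define \<sigma> where "\<sigma> = \<rho>(pv := r)"
  have \<sigma>: "range \<sigma> \<subseteq> D u"
    unfolding \<sigma>_def by (rule env_upd[OF ple_env[OF u ple_env[OF v w(3)]] pleD(5)[OF u]])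
  have B': "sem t (\<sigma>(a := e)) B \<longleftrightarrow> fc.frc (t, r) (\<rho>(a := e)) A" if "le u t" "e \<in> D t" for t e
  proof -
    have "fc.frc (t, r) (\<sigma>(a := e)) A = fc.frc (t, r) (\<rho>(a := e)) A"
      using pv nonvar_nonfree[of pv A] by (intro fc.frc_cong) (auto simp: \<sigma>_def)
    moreover have "(\<sigma>(a := e)) pv = r" using pv by (auto simp: \<sigma>_def)
    ultimately show ?thesis
      using B[OF le_refl(2)[OF that(1)] env_upd[OF env_mono[OF \<sigma> that(1)] that(2)], of a] by simp
  qed
  have "sem u (\<sigma>(a := d)) B"
  proof (rule set_induction[OF pleD(3)[OF u] \<sigma> _ d])
    fix t d assume t: "le u t" "d \<in> D t"
      and IH: "\<And>t' e. le t t' \<Longrightarrow> e \<in> D t' \<Longrightarrow> mem t' e d \<Longrightarrow> sem t' (\<sigma>(a := e)) B"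
    have tr: "ple (v, q) (t, r)" using ple_trans[OF u ple_same[OF t(1) pleD(5)[OF u]]] .
    have tt: "ple (t, r) (t, r)" using fc.le_refl(2)[OF tr] .
    have "fc.frc (t, r) (\<rho>(a := d)) (BAll x a (subst A a x))"
      unfolding frc_BAll
    proof (intro HOL.allI impI ballI)
      fix t1 r1 e
      assume t1: "ple (t, r) (t1, r1)" "e \<in> D t1" "fc.frc (t1, r1) (\<rho>(a := d, x := e)) (Mem x a)"
      have env: "range (\<rho>(a := d, x := e)) \<subseteq> D t1"
        by (rule env_upd[OF ple_env[OF t1(1) env_upd[OF ple_env[OF tr ple_env[OF v w(3)]] t(2)]] t1(2)])
      obtain z where z: "z \<in> D t1" "\<And>t2. le t1 t2 \<Longrightarrow> \<Phi> t2 r1 z \<Longrightarrow> mem t2 ((\<rho>(a := d, x := e)) x) ((\<rho>(a := d, x := e)) a)"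
        using frc_MemE[OF t1(3) pleD(3,5)[OF t1(1)] env] by blast
      \<comment> \<open>Forced membership is true membership only under \<open>\<Phi>\<close> at the
        stage \<open>z\<close>. \<open>glue_frc\<close> grants that assumption, and then the
        induction hypothesis applies.\<close>
      show "fc.frc (t1, r1) (\<rho>(a := d, x := e)) (subst A a x)"
      proof (rule glue_frc[OF pleD(3,5)[OF t1(1)] z(1)])
        fix t2 assume t2: "le t1 t2" "\<Phi> t2 r1 z"
        have tt2: "le t t2" using le_trans[OF pleD(1)[OF t1(1)] t2(1)] .
        have e: "e \<in> D t2" using t1(2) D_mono[OF t2(1)] by blast
        have "mem t2 e d" using z(2)[OF t2] x(1) by simp
        hence "fc.frc (t2, r) (\<rho>(a := e)) A" using IH[OF tt2 e] B'[OF le_trans[OF t(1) tt2] e] by blast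
        moreover have "ple (t2, r) (t2, r1)"
          using t1(1) pleD[OF t1(1)] t2(1) D_mono[OF t2(1)] le_refl(2)[OF t2(1)] by (auto simp: ple_pair intro: sub_mono)
        ultimately have "fc.frc (t2, r1) (\<rho>(a := e)) A" using fc.frc_mono by blast
        moreover have "fc.frc (t2, r1) (\<rho>(a := d, x := e, a := e)) A = fc.frc (t2, r1) (\<rho>(a := e)) A"
          using x(2) by (intro fc.frc_cong) auto
        ultimately show "fc.frc (t2, r1) (\<rho>(a := d, x := e)) (subst A a x)"
          unfolding fc.frc_subst[OF x(3)] fun_upd_same by blast
      qed
    qed
    hence "fc.frc (t, r) (\<rho>(a := d)) A" using f tr tt t(2) unfolding frc_All frc_Imp by blast
    thus "sem t (\<sigma>(a := d)) B" using B'[OF t] by blast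
  qed
  thus "fc.frc (u, r) (\<rho>(a := d)) A" using B'[OF pleD(3)[OF u] d] by blast
qed

text \<open>A true \<Pi> formula stays true when relativized to any stage, so its stage description
  holds whatever the condition.\<close>

lemma forced_true:
  assumes "A \<in> L" "PiF A" "le w w" "p \<in> D w" "range \<rho> \<subseteq> D w" "sem w \<rho> A"
  shows "fc.frc (w, p) \<rho> A"
proof -
  have "at_stages w p \<rho> A"
  proof (rule at_stagesI)
    fix v z assume v: "le w v" "z \<in> D v"
    have "R u \<rho> z A" if "le v u" for u
    proof -
      have "sem u \<rho> A" "z \<in> D u" "le u u"
        using sem_mono[OF assms(6) le_trans[OF v(1) that]] D_mono[OF that] v(2) le_refl(2)[OF that] by auto
      thus ?thesis using R_sem assms(2) by blast
    qed
    thus "\<exists>z'\<in>D v. \<forall>u. le v u \<longrightarrow> \<Phi> u p z' \<longrightarrow> R u \<rho> z A" using v(2) by blast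
  qed
  thus ?thesis using pi_charD[OF _ assms(3-5)] stage_characterization assms(1,2) by blast
qed

lemma frc_ExI:
  assumes "d \<in> D w" "fc.frc (w, p) (\<rho>(x := d)) A"
  shows "fc.frc (w, p) \<rho> (Ex x A)"
  unfolding fc.frc.simps
proof (rule fc.clI)
  fix b assume b: "ple (w, p) b"
  hence "d \<in> D (fst b)" using assms(1) D_mono by (auto simp: ple_def)
  thus "\<exists>d\<in>D (fst b). fc.frc b (\<rho>(x := d)) A" using fc.frc_mono[OF assms(2) b] by blast
qed

lemma frc_at_stage: "A \<in> L \<Longrightarrow> SigmaF A \<Longrightarrow> le w w \<Longrightarrow> p \<in> D w \<Longrightarrow> range \<rho> \<subseteq> D w \<Longrightarrow> fc.frc (w, p) \<rho> A \<longleftrightarrow> at_stage w p \<rho> A"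
  using sigma_charD stage_characterization by blast

text \<open>The stage \<open>e\<close> at which \<open>A\<close> is obtained is itself the
  reflecting set. Once \<open>z\<close> denotes \<open>e\<close>, the formula \<open>rel z A\<close>
  is bounded and holds under \<open>\<Phi>\<close> at \<open>e\<close>.\<close>

lemma forced_Sigma_Refl:
  assumes L: "Imp A (Ex z (rel z A)) \<in> L" and A: "SigmaF A" "z \<notin> vars A"
    and w: "le w w" "p \<in> D w" "range \<rho> \<subseteq> D w"
  shows "fc.frc (w, p) \<rho> (Imp A (Ex z (rel z A)))"
  unfolding frc_Imp
proof (intro HOL.allI impI)
  fix v q assume v: "ple (w, p) (v, q)" "fc.frc (v, q) \<rho> A"
  note vq = pleD(3,5)[OF v(1)] ple_env[OF v(1) w(3)]
  have L': "A \<in> L" "rel z A \<in> L" using L L_Imp L_Ex by blast+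
  have d: "Delta0 (rel z A)" using Delta0_rel A by blast
  obtain e where e: "e \<in> D v" "\<And>u. le v u \<Longrightarrow> \<Phi> u q e \<Longrightarrow> R u \<rho> e A"
    using v(2) frc_at_stage[OF L'(1) A(1) vq] at_stageE by blast
  have "at_stage v q (\<rho>(z := e)) (rel z A)"
    by (rule at_stageI[OF e(1)]) (use e(2) R_Delta0[OF d] sem_rel[OF A(2)] in simp)
  hence "fc.frc (v, q) (\<rho>(z := e)) (rel z A)"
    using frc_at_stage[OF L'(2) SigmaF_Delta0[OF d] vq(1,2) env_upd[OF vq(3) e(1)]] by blast
  thus "fc.frc (v, q) \<rho> (Ex z (rel z A))" by (rule frc_ExI[OF e(1)])
qed

text \<open>The premise is a \<Sigma> formula; at its stage \<open>e\<close> the quantifier over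
  \<open>y\<close> is bounded by \<open>e\<close>, so \<open>e\<close> itself is the collecting
  set.\<close>

lemma forced_Coll:
  assumes L: "Imp (BAll x a (Ex y A)) (Ex b (BAll x a (BEx y b A))) \<in> L" and A: "Delta0 A"
    and dist: "distinct [a, b, x, y]" "b \<notin> fv A"
    and w: "le w w" "p \<in> D w" "range \<rho> \<subseteq> D w"
  shows "fc.frc (w, p) \<rho> (Imp (BAll x a (Ex y A)) (Ex b (BAll x a (BEx y b A))))"
  unfolding frc_Imp
proof (intro HOL.allI impI)
  fix v q assume v: "ple (w, p) (v, q)" "fc.frc (v, q) \<rho> (BAll x a (Ex y A))"
  note vq = pleD(3,5)[OF v(1)] ple_env[OF v(1) w(3)]
  have L': "BAll x a (Ex y A) \<in> L" "BAll x a (BEx y b A) \<in> L" using L L_Imp L_Ex by blast+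
  have S: "SigmaF (BAll x a (Ex y A))" 
    by (rule SigmaF_PiF.intros(7)[OF SigmaF_PiF.intros(11)[OF SigmaF_Delta0[OF A]]]) (use dist in auto)
  have d: "Delta0 (BAll x a (BEx y b A))" using dist A by (auto intro!: Delta0.intros)
  obtain e where e: "e \<in> D v" "\<And>u. le v u \<Longrightarrow> \<Phi> u q e \<Longrightarrow> R u \<rho> e (BAll x a (Ex y A))"
    using v(2) frc_at_stage[OF L'(1) S vq] at_stageE by blast
  have c: "sem u (\<rho>(b := e, x := d1, y := d2)) A = sem u (\<rho>(x := d1, y := d2)) A" for u d1 d2
    using dist by (intro sem_cong) auto
  have "sem u (\<rho>(b := e)) (BAll x a (BEx y b A))" if "R u \<rho> e (BAll x a (Ex y A))" for u
    using that dist unfolding sem.simps R.simps R_Delta0[OF A] c by auto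
  hence "at_stage v q (\<rho>(b := e)) (BAll x a (BEx y b A))"
    using e unfolding at_stage_def R_Delta0[OF d] by blast
  hence "fc.frc (v, q) (\<rho>(b := e)) (BAll x a (BEx y b A))"
    using frc_at_stage[OF L'(2) SigmaF_Delta0[OF d] vq(1,2) env_upd[OF vq(3) e(1)]] by blast
  thus "fc.frc (v, q) \<rho> (Ex b (BAll x a (BEx y b A)))" by (rule frc_ExI[OF e(1)])
qed

text \<open>The separated set is taken from the model, and what has to be forced about it is a true
  \<Pi> formula.\<close>

lemma forced_Sep:
  assumes L: "All a (Ex b (All x (Iff (Mem x b) (Conj (Mem x a) A)))) \<in> L" and A: "Delta0 A"
    and ax: "All a (Ex b (All x (Iff (Mem x b) (Conj (Mem x a) A)))) \<in> IKP"
    and w: "le w w" "p \<in> D w" "range \<rho> \<subseteq> D w"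
  shows "fc.frc (w, p) \<rho> (All a (Ex b (All x (Iff (Mem x b) (Conj (Mem x a) A)))))"
  unfolding frc_All[of _ _ _ a]
proof (intro HOL.allI impI ballI)
  fix v q d assume v: "ple (w, p) (v, q)" "d \<in> D v"
  let ?B = "All x (Iff (Mem x b) (Conj (Mem x a) A))"
  note vq = pleD(3,5)[OF v(1)] env_upd[OF ple_env[OF v(1) w(3)] v(2), of a]
  have L': "?B \<in> L" using L L_All L_Ex by blast
  have P: "PiF ?B" unfolding Iff_def
    using A by (intro SigmaF_PiF.intros(12) PiF_Delta0 Delta0.intros)
  have "sem v (\<rho>(a := d)) (Ex b ?B)"
    using IKP_sem[OF ax w(1,3)] pleD(1)[OF v(1)] v(2) unfolding sem.simps(7)[of _ _ a] by blast
  then obtain e where e: "e \<in> D v" "sem v (\<rho>(a := d, b := e)) ?B" unfolding sem.simps(8) by blast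
  have "fc.frc (v, q) (\<rho>(a := d, b := e)) ?B"
    by (rule forced_true[OF L' P vq(1,2) env_upd[OF vq(3) e(1)] e(2)])
  thus "fc.frc (v, q) (\<rho>(a := d)) (Ex b ?B)" by (rule frc_ExI[OF e(1)])
qed

lemma forced_Extensionality:
  assumes L: "Extensionality \<in> L" and w: "le w w" "p \<in> D w" "range \<rho> \<subseteq> D w"
  shows "fc.frc (w, p) \<rho> Extensionality"
proof (rule forced_true[OF L _ w])
  show "PiF Extensionality" unfolding Extensionality_def
    by (intro SigmaF_PiF.intros(12) PiF_Delta0 Delta0.intros) auto
  show "sem w \<rho> Extensionality" by (rule IKP_sem[OF _ w(1,3)]) (simp add: IKP_def)
qed

lemma forced_Pairing:
  assumes L: "Pairing \<in> L" and w: "le w w" "p \<in> D w" "range \<rho> \<subseteq> D w"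
  shows "fc.frc (w, p) \<rho> Pairing"
  unfolding Pairing_def frc_All
proof (intro HOL.allI impI ballI)
  fix v q d u r e assume v: "ple (w, p) (v, q)" "d \<in> D v" and u: "ple (v, q) (u, r)" "e \<in> D u"
  have env: "range (\<rho>(0 := d, 1 := e)) \<subseteq> D u"
    by (rule env_upd[OF ple_env[OF u(1) env_upd[OF ple_env[OF v(1) w(3)] v(2)]] u(2)])
  have "d \<in> D u" using v(2) D_mono[OF pleD(1)[OF u(1)]] by blast
  then obtain c where c: "c \<in> D u" "mem u d c" "mem u e c" using ex_pair[OF pleD(3)[OF u(1)] _ u(2)] by blast
  have "Conj (Mem 0 2) (Mem 1 2) \<in> L" using L L_All L_Ex unfolding Pairing_def by blast
  hence "fc.frc (u, r) (\<rho>(0 := d, 1 := e, 2 := c)) (Conj (Mem 0 2) (Mem 1 2))"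
    by (rule forced_true[OF _ _ pleD(3,5)[OF u(1)] env_upd[OF env c(1)]])
      (use c in \<open>auto intro!: PiF_Delta0 Delta0.intros\<close>)
  thus "fc.frc (u, r) (\<rho>(0 := d, 1 := e)) (Ex 2 (Conj (Mem 0 2) (Mem 1 2)))" by (rule frc_ExI[OF c(1)])
qed

lemma forced_Union:
  assumes L: "Union_ax \<in> L" and w: "le w w" "p \<in> D w" "range \<rho> \<subseteq> D w"
  shows "fc.frc (w, p) \<rho> Union_ax"
  unfolding Union_ax_def frc_All
proof (intro HOL.allI impI ballI)
  fix v q d assume v: "ple (w, p) (v, q)" "d \<in> D v"
  let ?B = "BAll 2 0 (BAll 3 2 (Mem 3 1))"
  note vq = pleD(3,5)[OF v(1)] env_upd[OF ple_env[OF v(1) w(3)] v(2), of 0]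
  have "?B \<in> L" using L L_All L_Ex unfolding Union_ax_def by blast
  have "sem w \<rho> Union_ax" by (rule IKP_sem[OF _ w(1,3)]) (simp add: IKP_def)
  hence "sem v (\<rho>(0 := d)) (Ex 1 ?B)"
    using pleD(1)[OF v(1)] v(2) unfolding Union_ax_def sem.simps(7) by blast
  then obtain e where e: "e \<in> D v" "sem v (\<rho>(0 := d, 1 := e)) ?B" unfolding sem.simps(8) by blast
  have "fc.frc (v, q) (\<rho>(0 := d, 1 := e)) ?B"
    by (rule forced_true[OF \<open>?B \<in> L\<close> _ vq(1,2) env_upd[OF vq(3) e(1)] e(2)])
      (auto intro!: PiF_Delta0 Delta0.intros)
  thus "fc.frc (v, q) (\<rho>(0 := d)) (Ex 1 ?B)" by (rule frc_ExI[OF e(1)])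
qed

lemma forced_Infinity:
  assumes L: "Infinity \<in> L" and w: "le w w" "p \<in> D w" "range \<rho> \<subseteq> D w"
  shows "fc.frc (w, p) \<rho> Infinity"
proof -
  let ?B = "BAll 1 0 (BEx 2 0 (Mem 1 2))"
  have L': "Mem 1 0 \<in> L" "?B \<in> L" using L L_Conj L_Ex unfolding Infinity_def by blast+
  have "sem w \<rho> Infinity" by (rule IKP_sem[OF _ w(1,3)]) (simp add: IKP_def)
  then obtain d e where d: "d \<in> D w" "e \<in> D w" "sem w (\<rho>(0 := d, 1 := e)) (Mem 1 0)" "sem w (\<rho>(0 := d)) ?B"
    unfolding Infinity_def sem.simps(4,8) by blast
  have "fc.frc (w, p) (\<rho>(0 := d)) ?B"
    by (rule forced_true[OF L'(2) _ w(1,2) env_upd[OF w(3) d(1)] d(4)]) (auto intro!: PiF_Delta0 Delta0.intros)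
  moreover have "fc.frc (w, p) (\<rho>(0 := d, 1 := e)) (Mem 1 0)" by (rule frc_MemI) (use d(3) in simp)
  hence "fc.frc (w, p) (\<rho>(0 := d)) (Ex 1 (Mem 1 0))" by (rule frc_ExI[OF d(2)])
  ultimately have "fc.frc (w, p) (\<rho>(0 := d)) (Conj (Ex 1 (Mem 1 0)) ?B)" unfolding fc.frc.simps(4) by blast
  thus ?thesis unfolding Infinity_def by (rule frc_ExI[OF d(1)])
qed

lemma forced_axioms:
  assumes B: "B \<in> IKP \<union> Sigma_Refl" "B \<in> L" and w: "le w w" "p \<in> D w" "range \<rho> \<subseteq> D w"
  shows "fc.frc (w, p) \<rho> B"
proof -
  consider "B \<in> {Extensionality, Pairing, Union_ax, Infinity}" | "B \<in> Delta0_Sep" | "B \<in> Delta0_Coll"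
    | "B \<in> Set_Ind" | "B \<in> Sigma_Refl" using B(1) unfolding IKP_def by blast
  thus ?thesis
  proof cases
    case 1
    thus ?thesis using forced_Extensionality forced_Pairing forced_Union forced_Infinity B(2) w by blast
  next
    case 2
    hence "B \<in> IKP" by (simp add: IKP_def)
    thus ?thesis using 2 B(2) forced_Sep[OF _ _ _ w] unfolding Delta0_Sep_def by blast
  next
    case 3
    thus ?thesis using B(2) forced_Coll[OF _ _ _ _ w] unfolding Delta0_Coll_def by blast
  next
    case 4
    thus ?thesis using forced_Set_Ind[OF _ _ _ w] unfolding Set_Ind_def by blast
  next
    case 5
    thus ?thesis using B(2) forced_Sigma_Refl[OF _ _ _ w] unfolding Sigma_Refl_def by blast
  qed
qed

text \<open>Soundness holds for derivations through arbitrary formulas; it is the axioms used and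
  the conclusion that have to lie in \<open>L\<close>.\<close>

theorem reflected:
  assumes T: "T0 \<subseteq> IKP \<union> Sigma_Refl" "T0 \<subseteq> L" and A: "prov T0 A" "A \<in> L" "SigmaF A"
    and w: "le w w" "range \<rho> \<subseteq> D w"
  shows "\<exists>z\<in>D w. R w \<rho> z A"
proof -
  \<comment> \<open>An arbitrary element, from which \<open>Bot\<close> separates the empty
    condition.\<close>
  have "\<rho> 0 \<in> D w" using w by auto
  obtain p where p: "p \<in> D w" "\<And>v d. le w v \<Longrightarrow> d \<in> D v \<Longrightarrow> \<not> mem v d p"
    using separation[OF Delta0.intros(3) w \<open>\<rho> 0 \<in> D w\<close>] by (metis sem.simps(3))
  have f: "fc.frc a \<sigma> B" if "B \<in> T0" "ple a a" "range \<sigma> \<subseteq> D (fst a)" for B a \<sigma>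
    using that T forced_axioms[of B "fst a" "snd a" \<sigma>] by (auto simp: ple_def)
  have "fc.frc (w, p) \<rho> A"
    by (rule fc.soundness[OF A(1) f]) (use w ple_same[OF w(1) p(1)] in auto)
  then obtain z where z: "z \<in> D w" "\<And>v. le w v \<Longrightarrow> \<Phi> v p z \<Longrightarrow> R v \<rho> z A"
    using frc_at_stage[OF A(2,3) w(1) p(1) w(2)] at_stageE by blast
  have "\<Phi> w p z" unfolding \<Phi>_def using p(2) by blast
  thus ?thesis using z w(1) by blast
qed

end

section \<open>Conservativity\<close>

fun subformulas :: "fm \<Rightarrow> fm set" where
  "subformulas (Mem x y) = {Mem x y}"
| "subformulas (Eq x y) = {Eq x y}"
| "subformulas Bot = {Bot}"
| "subformulas (Conj A B) = insert (Conj A B) (subformulas A \<union> subformulas B)"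
| "subformulas (Disj A B) = insert (Disj A B) (subformulas A \<union> subformulas B)"
| "subformulas (Imp A B) = insert (Imp A B) (subformulas A \<union> subformulas B)"
| "subformulas (All x A) = insert (All x A) (subformulas A)"
| "subformulas (Ex x A) = insert (Ex x A) (subformulas A)"
| "subformulas (BAll x s A) = insert (BAll x s A) (subformulas A)"
| "subformulas (BEx x s A) = insert (BEx x s A) (subformulas A)"

lemma finite_subformulas: "finite (subformulas A)"
  by (induction A) auto

lemma subformulas_refl: "A \<in> subformulas A"
  by (cases A) auto

lemma subformulas_closed: "B \<in> subformulas A \<Longrightarrow> subformulas B \<subseteq> subformulas A"
  by (induction A) auto

lemma prov_finite: "prov T A \<Longrightarrow> \<exists>T0. finite T0 \<and> T0 \<subseteq> T \<and> prov T0 A"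
proof (induction rule: prov.induct)
  case (hyp A) thus ?case by (intro exI[of _ "{A}"]) (auto intro: prov.hyp)
next
  case (mp A B)
  then obtain S S' where "finite S" "S \<subseteq> T" "prov S (Imp A B)" "finite S'" "S' \<subseteq> T" "prov S' A" by blast
  thus ?case by (intro exI[of _ "S \<union> S'"])
      (auto intro: prov.mp[OF prov_mono[of S] prov_mono[of S']])
next
  case (allI B A x) thus ?case using prov.allI by blast
next
  case (exE A B x) thus ?case using prov.exE by blast
qed (rule exI[of _ "{}"], auto intro: prov.intros)+

context kripke_ikp
begin

text \<open>A derivation uses finitely many axioms. Their subformulas form a finite
  \<open>L\<close>, and the finitely many relativizations then have a universal formula.\<close>

theorem reflected_in_model:
  assumes A: "prov (IKP \<union> Sigma_Refl) A" "SigmaF A" and w: "le w w" "range \<rho> \<subseteq> D w"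
  shows "\<exists>z\<in>D w. R w \<rho> z A"
proof -
  obtain T0 where T0: "finite T0" "T0 \<subseteq> IKP \<union> Sigma_Refl" "prov T0 A" using prov_finite[OF A(1)] by blast
  \<comment> \<open>The three extra atoms provide codes for all atomic formulas.\<close>
  define L where "L = (\<Union>B\<in>insert A (insert (Mem 0 1) (insert (Eq 0 1) (insert Bot T0))). subformulas B)"
  have L: "finite L" unfolding L_def using T0(1) finite_subformulas by auto
  have sub: "subformulas B \<subseteq> L" if "B \<in> L" for B
    using that subformulas_closed unfolding L_def by blast
  have mem: "B \<in> L" if "B \<in> insert A (insert (Mem 0 1) (insert (Eq 0 1) (insert Bot T0)))" for B
    using that subformulas_refl unfolding L_def by blast
  have "finite (\<Union>B\<in>L. vars B)" using L finite_vars by blast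
  \<comment> \<open>\<open>N\<close> exceeds every variable of \<open>L\<close>, so \<open>N\<close>
    to \<open>N + 4\<close> can take the reserved roles.\<close>
  then obtain N where N: "\<forall>x\<in>(\<Union>B\<in>L. vars B). x < N" using finite_nat_set_iff_bounded by blast
  let ?\<Theta> = "(\<lambda>(k, A). rel k A) ` ({N, N + 1} \<times> {B \<in> L. SigmaF B \<or> PiF B})"
  have "Delta0 \<theta>" if "\<theta> \<in> ?\<Theta>" for \<theta>
  proof -
    obtain k B where k: "\<theta> = rel k B" "k \<in> {N, N + 1}" "B \<in> L" "SigmaF B \<or> PiF B" using \<open>\<theta> \<in> ?\<Theta>\<close> by auto
    have "k \<notin> vars B" using N k(2,3) by force
    thus ?thesis using Delta0_rel k by blast
  qed
  moreover have "finite ?\<Theta>" using L by auto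
  ultimately have "\<exists>U u. universal_for U u N ?\<Theta>" by (intro ex_universal) auto
  then obtain U0 u0 where "universal_for U0 u0 N ?\<Theta>" by blast
  then obtain U where U: "universal_for U (N + 2) N ?\<Theta>" using universal_rename[of U0 u0 N _ "N + 2"] by auto
  interpret reflection le D mem eq L N "N + 1" "N + 2" "N + 3" "N + 4" U
  proof
    show "distinct [N, N + 1, N + 2, N + 3, N + 4]" by simp
    show "{N, N + 1, N + 2, N + 3, N + 4} \<inter> vars B = {}" if "B \<in> L" for B using N that by force
    show "Mem 0 1 \<in> L" "Eq 0 1 \<in> L" "Bot \<in> L" using mem by auto
    show "universal_for U (N + 2) N ?\<Theta>" by (rule U)
  qed (use sub subformulas_refl in force)+
  show ?thesis by (rule reflected[OF T0(2) _ T0(3) _ A(2) w]) (use mem in auto)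
qed

end

text \<open>Both conclusions are read off from the stage found in the canonical model of IKP:
  \<open>R_sem\<close> turns it into the truth of \<open>A\<close>, and \<open>sem_rel\<close> into
  the truth of the reflected formula.\<close>

theorem Sigma_Refl_conservative:
  assumes A: "prov (IKP \<union> Sigma_Refl) A" "SigmaF A"
  shows "prov IKP A" and "z \<notin> vars A \<Longrightarrow> prov IKP (Ex z (rel z A))"
proof -
  have *: "prov IKP B" if B: "\<And>w \<rho>. can_le IKP w w \<Longrightarrow> range \<rho> \<subseteq> level (fst w) \<Longrightarrow>
      \<exists>e\<in>level (fst w). can.R IKP w \<rho> e A \<Longrightarrow> can.sem IKP w \<rho> B" for B
  proof (rule completeness)
    assume "\<And>B. B \<in> IKP \<Longrightarrow> can.valid IKP B"
    \<comment> \<open>The interpretation is local because the axioms are known to hold in the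
      canonical model only under the hypothesis that \<open>completeness\<close> supplies.\<close>
    then interpret kripke_ikp "can_le IKP" "\<lambda>w. level (fst w)" "\<lambda>w x y. Mem x y \<in> snd w" "\<lambda>w x y. Eq x y \<in> snd w"
      by unfold_locales
    show "can.valid IKP B" unfolding can.valid_def
    proof (intro HOL.allI impI)
      fix w and \<rho> :: "nat \<Rightarrow> nat" assume w: "can_le IKP w w" "range \<rho> \<subseteq> level (fst w)"
      show "can.sem IKP w \<rho> B" by (rule B[OF w reflected_in_model[OF A w]])
    qed
  qed
  show "prov IKP A" by (rule *) (use can.R_sem A(2) in blast)
  show "prov IKP (Ex z (rel z A))" if "z \<notin> vars A"
    by (rule *) (use can.sem_rel[OF that] in auto)
qed

theorem theorem2p37:
  shows "(\<forall>A. SigmaF A \<and> sentence A \<longrightarrow> (prov IKP A \<longleftrightarrow> prov (IKP \<union> Sigma_Refl) A))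
       \<and> (\<forall>A z. SigmaF A \<and> sentence A \<and> z \<notin> vars A \<and> prov IKP A \<longrightarrow> prov IKP (Ex z (rel z A)))"
  using Sigma_Refl_conservative prov_mono[of IKP _ "IKP \<union> Sigma_Refl"] by blast

end
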